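(* Let $\alpha\in(-1,1)$, $k=\tan(\pi\alpha/2)$, and $u\in C_0^\infty(\mathbf{R})$. Then the $\dot H^1$ solution to the Dirichlet problem for the equation $\mathrm{div}A_k(x)\nabla U=0$ in $\mathbf{R}^2_+$, where $A_k(x)=\begin{bmatrix}1&k\,\mathrm{sgn}(x)\\-k\,\mathrm{sgn}(x)&1\end{bmatrix}$, with boundary datum $U(0,\cdot)=u$, is given, for $(t,x)\in\mathbf{R}^2_+$, by $$U(t,x)=\frac1\pi\int_{\mathbf{R}}\frac{2xty+|y|^{-\alpha}\,\mathrm{Im}\big\{(|x|+it)^{\alpha+1}\big(y^2-(|x|-it)^2\big)\big\}}{(t^2+(x-y)^2)(t^2+(x+y)^2)}\,u(y)\,dy .$$
   Context: $\mathbf{R}^2_+=\{(t,x): t>0, x\in\mathbf{R}\}$; $\nabla U=[\partial_tU,\partial_xU]^t$. Powers $(|x|+it)^{\alpha+1}$ are defined with $\arg(|x|+it)\in(0,\pi)$. The $\dot H^1$ solution to the Dirichlet problem with (smooth and localised) datum $u$ is constructed by Lax--Milgram: choose a (smooth, compactly supported) function $U_1$ in $\mathbf{R}^2$ with $U_1(0,x)=u(x)$, let $U_2\in\dot H^1_0(\mathbf{R}^2_+)$ be the function such that $\iint_{\mathbf{R}^2_+}(A_k\nabla U_2,\nabla\psi)\,dt\,dx=\iint_{\mathbf{R}^2_+}(A_k\nabla U_1,\nabla\psi)\,dt\,dx$ for all $\psi\in\dot H^1_0(\mathbf{R}^2_+)$, and set $U:=U_1-U_2$. Here $\dot H^1_0(\mathbf{R}^2_+)$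 is the completion of $C_0^\infty(\mathbf{R}^2_+)$ in the norm $\|\nabla\psi\|_{L_2(\mathbf{R}^2_+)}$. Thus $U$ is a weak solution with $\nabla U\in L_2(\mathbf{R}^2_+)$ and with trace $u$ in the weak sense. *)

theory Defs
  imports "HOL-Analysis.Analysis"
begin

section \<open>Smooth functions and test functions\<close>

text \<open>\<open>C_k n f\<close>: all iterated partial derivatives of \<open>f\<close> up to order \<open>n\<close> exist and are continuous.\<close>

primrec C_k :: "nat \<Rightarrow> ('a::euclidean_space \<Rightarrow> 'b::real_normed_vector) \<Rightarrow> bool" where
  "C_k 0 f \<longleftrightarrow> continuous_on UNIV f"
| "C_k (Suc n) f \<longleftrightarrow>
     (\<forall>p. f differentiable (at p)) \<and>
     (\<forall>b\<in>Basis. C_k n (\<lambda>p. frechet_derivative f (at p) b))"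

definition smooth :: "('a::euclidean_space \<Rightarrow> 'b::real_normed_vector) \<Rightarrow> bool" where
  "smooth f \<longleftrightarrow> (\<forall>n. C_k n f)"

text \<open>The space \<open>C\<^sub>0\<^sup>\<infinity>(\<Omega>)\<close> for open \<open>\<Omega>\<close>; its elements are extended by zero to the whole space.\<close>

definition test_function :: "'a::euclidean_space set \<Rightarrow> ('a \<Rightarrow> 'b::real_normed_vector) \<Rightarrow> bool" where
  "test_function \<Omega> f \<longleftrightarrow>
     smooth f \<and> compact (closure {p. f p \<noteq> 0}) \<and> closure {p. f p \<noteq> 0} \<subseteq> \<Omega>"

section \<open>The half-plane, gradients and coefficients\<close>

text \<open>Points of the plane are pairs \<open>(t, x)\<close>. All functions are complex valued.\<close>

definition halfplane :: "(real \<times> real) set" where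
  "halfplane = {(t, x). 0 < t}"

definition grad :: "(real \<times> real \<Rightarrow> complex) \<Rightarrow> real \<times> real \<Rightarrow> complex ^ 2" where
  "grad f p = vector [frechet_derivative f (at p) (1, 0), frechet_derivative f (at p) (0, 1)]"

definition A_coeff :: "real \<Rightarrow> real \<Rightarrow> complex ^ 2 ^ 2" where
  "A_coeff k x = vector [vector [1, complex_of_real (k * sgn x)],
                         vector [complex_of_real (- k * sgn x), 1]]"

definition hermitian :: "complex ^ 2 \<Rightarrow> complex ^ 2 \<Rightarrow> complex" where
  "hermitian v w = (\<Sum>i\<in>UNIV. v $ i * cnj (w $ i))"

definition A_form ::
    "real \<Rightarrow> (real \<times> real \<Rightarrow> complex ^ 2) \<Rightarrow> (real \<times> real \<Rightarrow> complex ^ 2) \<Rightarrow> complex" where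
  "A_form k G H = (\<integral>p. hermitian (A_coeff k (snd p) *v G p) (H p) \<partial>(lebesgue_on halfplane))"

section \<open>The completion of the test functions in the gradient norm\<close>

text \<open>
  By the Poincar\'e inequality on strips \<open>0 < t < T\<close>, a sequence in \<open>C\<^sub>0\<^sup>\<infinity>\<close> of the half-plane
  whose gradients form a Cauchy sequence in \<open>L\<^sub>2\<close> converges in \<open>L\<^sub>2\<close> on compact subsets, and its limit
  is zero if the gradients tend to zero. The completion is thereby a space of (classes of)
  functions: \<open>Hdot10 V G\<close> says that \<open>V\<close> represents an element of it, with gradient \<open>G\<close>.
\<close>

definition Hdot10 :: "(real \<times> real \<Rightarrow> complex) \<Rightarrow> (real \<times> real \<Rightarrow> complex ^ 2) \<Rightarrow> bool" where
  "Hdot10 V G \<longleftrightarrow>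
     V \<in> borel_measurable (lebesgue_on halfplane) \<and>
     G \<in> borel_measurable (lebesgue_on halfplane) \<and>
     (\<exists>\<phi> :: nat \<Rightarrow> real \<times> real \<Rightarrow> complex.
        (\<forall>n. test_function halfplane (\<phi> n)) \<and>
        (\<lambda>n. \<integral>\<^sup>+p. ennreal ((norm (grad (\<phi> n) p - G p))\<^sup>2) \<partial>(lebesgue_on halfplane))
           \<longlonglongrightarrow> 0 \<and>
        (\<forall>K. compact K \<and> K \<subseteq> halfplane \<longrightarrow>
           (\<lambda>n. \<integral>\<^sup>+p. ennreal ((norm (\<phi> n p - V p))\<^sup>2) \<partial>(lebesgue_on K)) \<longlonglongrightarrow> 0))"

section \<open>The Dirichlet problem\<close>

text \<open>Only the values of \<open>U\<close> on the half-plane are relevant.\<close>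

definition Hdot1_Dirichlet_solution ::
    "real \<Rightarrow> (real \<Rightarrow> complex) \<Rightarrow> (real \<times> real \<Rightarrow> complex) \<Rightarrow> bool" where
  "Hdot1_Dirichlet_solution k u U \<longleftrightarrow>
     (\<exists>U\<^sub>1 U\<^sub>2 G\<^sub>2.
        test_function UNIV U\<^sub>1 \<and> (\<forall>x. U\<^sub>1 (0, x) = u x) \<and>
        Hdot10 U\<^sub>2 G\<^sub>2 \<and>
        (\<forall>\<psi> H. Hdot10 \<psi> H \<longrightarrow> A_form k G\<^sub>2 H = A_form k (grad U\<^sub>1) H) \<and>
        (\<forall>p\<in>halfplane. U p = U\<^sub>1 p - U\<^sub>2 p))"

text \<open>
  For \<open>t > 0\<close> the principal branch used by \<^const>\<open>powr\<close> is the one with argument in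
  \<open>(0, \<pi>)\<close>. The kernel does not include the factor \<open>1 / \<pi>\<close>.
\<close>

definition kernel :: "real \<Rightarrow> real \<Rightarrow> real \<Rightarrow> real \<Rightarrow> real" where
  "kernel \<alpha> t x y =
     (2 * x * t * y
       + \<bar>y\<bar> powr (- \<alpha>)
         * Im (Complex \<bar>x\<bar> t powr complex_of_real (\<alpha> + 1)
               * (complex_of_real (y\<^sup>2) - (Complex \<bar>x\<bar> (- t))\<^sup>2)))
     / ((t\<^sup>2 + (x - y)\<^sup>2) * (t\<^sup>2 + (x + y)\<^sup>2))"

definition U_formula :: "real \<Rightarrow> (real \<Rightarrow> complex) \<Rightarrow> real \<times> real \<Rightarrow> complex" where
  "U_formula \<alpha> u = (\<lambda>(t, x). complex_of_real (1 / pi) *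
     (\<integral>y. complex_of_real (kernel \<alpha> t x y) * u y \<partial>lborel))"

end

theory Submission
  imports Defs "HOL-Complex_Analysis.Complex_Analysis"
begin

text \<open>
  With \<open>z = \<bar>x\<bar> + i t\<close>, the kernel is the imaginary part of
  \<open>\<bar>y\<bar> powr (- \<alpha>) * z powr (\<alpha> + 1) / (y\<^sup>2 - z\<^sup>2)\<close> plus that of
  \<open>y / (y\<^sup>2 - (x + i t)\<^sup>2)\<close>. So the integral is harmonic in each quadrant, and on the axis
  \<open>x = 0\<close> the holomorphic functions behind it have constant argument, which is what makes
  the conormal derivative continuous there: the equation holds weakly. The first kernel is positive
  and its mass is homogeneous of degree \<open>0\<close>, hence constant, so it is an approximate
  identity and the boundary values are attained.

  Finite energy needs no estimate of the gradient. The difference \<open>w\<close> between a smooth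
  extension of the datum and the integral tends to \<open>0\<close> at the boundary and at infinity, so
  a smooth truncation \<open>trunc d w\<close> that vanishes for \<open>\<bar>w\<bar> \<le> d\<close> has compact support in
  the open half-plane. It is an admissible test function, the antisymmetric part of the coefficients
  drops out, and \<open>d \<rightarrow> 0\<close> bounds the energy of \<open>w\<close>. The same truncations show
  that \<open>w\<close> lies in the completion of the test functions. Uniqueness is coercivity together with
  Hardy's inequality.
\<close>

section \<open>Smoothness on open sets\<close>

text \<open>The value of \<open>k\<close> is dictated by the exponent. On the axis z = i t the
  square of z is negative, so the Cauchy integral behind the even part is real and only the factor
  \<open>z powr (\<alpha> + 1)\<close> carries an argument, namely pi (\<alpha> + 1) / 2. The
  combination Re + k Im of the even part therefore vanishes there for k = tan (pi \<alpha> / 2). The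
  odd part is real on the axis, which removes its contribution to the jump of the conormal
  derivative. Two obstacles shape the approximation arguments. The solution depends on
  \<open>\<bar>x\<bar>\<close> and may have a kink at x = 0, whereas membership in the completion is
  witnessed by smooth functions; so each truncation of w is itself obtained as a bounded limit of
  smooth functions. And truncation destroys the gradient on the zero set of w at every level d, so
  it has to be shown that the gradient vanishes almost everywhere on that set. The kernel is real,
  so the analysis is done for real data, and complex data are recovered by linearity.\<close>

primrec Ck_on :: "nat \<Rightarrow> 'a::euclidean_space set \<Rightarrow> ('a \<Rightarrow> 'b::real_normed_vector) \<Rightarrow> bool" where
  "Ck_on 0 S f \<longleftrightarrow> continuous_on S f"
| "Ck_on (Suc n) S f \<longleftrightarrow>
     (\<forall>p\<in>S. f differentiable (at p)) \<and>
     (\<forall>b\<in>Basis. Ck_on n S (\<lambda>p. frechet_derivative f (at p) b))"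

lemma C_k_eq_Ck_on: "C_k n f \<longleftrightarrow> Ck_on n UNIV f"
  by (induction n arbitrary: f) auto

text \<open>The derivative \<open>at p\<close> sees only values near p, so agreement on an open set
  passes to all iterated derivatives. Local formulas and extension by zero rely on this.\<close>

lemma Ck_on_cong:
  assumes "open S" "\<And>p. p \<in> S \<Longrightarrow> f p = g p" "Ck_on n S f"
  shows "Ck_on n S g"
  using assms(2,3)
proof (induction n arbitrary: f g)
  case 0
  then show ?case by (simp cong: continuous_on_cong)
next
  case (Suc n)
  have D: "(g has_derivative frechet_derivative f (at p)) (at p)" if "p \<in> S" for p
  proof (rule has_derivative_transform_within_open[OF _ assms(1) that])
    show "(f has_derivative frechet_derivative f (at p)) (at p)"
      using Suc.prems(2) that by (simp add: frechet_derivative_works)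
  qed (use Suc.prems in auto)
  have "Ck_on n S (\<lambda>p. frechet_derivative g (at p) b)" if "b \<in> Basis" for b
  proof (rule Suc.IH)
    show "Ck_on n S (\<lambda>p. frechet_derivative f (at p) b)"
      using Suc.prems(2) that by simp
    show "frechet_derivative f (at p) b = frechet_derivative g (at p) b" if "p \<in> S" for p
      using frechet_derivative_at[OF D[OF that]] by simp
  qed
  then show ?case
    using D by (auto intro: differentiableI)
qed

text \<open>Lets the closure properties below be proved with an explicit derivative D instead of the
  choice operator behind \<open>frechet_derivative\<close>.\<close>

lemma Ck_on_SucI:
  assumes "open S" "\<And>p. p \<in> S \<Longrightarrow> (f has_derivative D p) (at p)"
    and "\<And>b. b \<in> Basis \<Longrightarrow> Ck_on n S (\<lambda>p. D p b)"
  shows "Ck_on (Suc n) S f"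
proof -
  have "Ck_on n S (\<lambda>p. frechet_derivative f (at p) b)" if "b \<in> Basis" for b
    by (rule Ck_on_cong[OF assms(1) _ assms(3)[OF that]])
      (use assms(2) frechet_derivative_at in force)
  then show ?thesis
    using assms(2) by (auto intro: differentiableI)
qed

lemma Ck_on_has_derivative:
  assumes "Ck_on (Suc n) S f" "p \<in> S"
  shows "(f has_derivative frechet_derivative f (at p)) (at p)"
  using assms by (simp add: frechet_derivative_works)

lemma Ck_on_SucD: "Ck_on (Suc n) S f \<Longrightarrow> Ck_on n S f"
proof (induction n arbitrary: f)
  case 0
  then show ?case
    by (auto intro!: continuous_at_imp_continuous_on differentiable_imp_continuous_within)
next
  case (Suc n)
  then show ?case
    by (metis Ck_on.simps(2))
qed

lemma Ck_on_subset: "Ck_on n S f \<Longrightarrow> T \<subseteq> S \<Longrightarrow> Ck_on n T f"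
  by (induction n arbitrary: f) (auto intro: continuous_on_subset)

lemma Ck_on_Un:
  "open S \<Longrightarrow> open T \<Longrightarrow> Ck_on n S f \<Longrightarrow> Ck_on n T f \<Longrightarrow> Ck_on n (S \<union> T) f"
  by (induction n arbitrary: f) (auto intro: continuous_on_open_Un)

lemma Ck_on_const: "open S \<Longrightarrow> Ck_on n S (\<lambda>p. c)"
proof (induction n arbitrary: c)
  case (Suc n)
  show ?case
    by (rule Ck_on_SucI[where D = "\<lambda>p h. 0"]) (use Suc in auto)
qed auto

lemma Ck_on_bounded_linear:
  assumes "open S" "bounded_linear L" "Ck_on n S f"
  shows "Ck_on n S (\<lambda>p. L (f p))"
  using assms(3)
proof (induction n arbitrary: f)
  case 0
  then show ?case
    using bounded_linear.continuous_on[OF assms(2)] by simp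
next
  case (Suc n)
  show ?case
  proof (rule Ck_on_SucI[OF assms(1)])
    show "((\<lambda>p. L (f p)) has_derivative (\<lambda>h. L (frechet_derivative f (at p) h))) (at p)"
      if "p \<in> S" for p
      by (rule bounded_linear.has_derivative[OF assms(2) Ck_on_has_derivative[OF Suc.prems that]])
    show "Ck_on n S (\<lambda>p. L (frechet_derivative f (at p) b))" if "b \<in> Basis" for b
      using Suc that by simp
  qed
qed

lemma Ck_on_linear:
  assumes "open S" "bounded_linear L"
  shows "Ck_on n S L"
proof (cases n)
  case 0
  then show ?thesis
    using linear_continuous_on[OF assms(2)] by simp
next
  case (Suc m)
  show ?thesis unfolding Suc
    by (rule Ck_on_SucI[OF assms(1) bounded_linear_imp_has_derivative[OF assms(2)]])
      (simp add: Ck_on_const assms(1))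
qed

lemma Ck_on_add:
  assumes "open S" "Ck_on n S f" "Ck_on n S g"
  shows "Ck_on n S (\<lambda>p. f p + g p)"
  using assms(2,3)
proof (induction n arbitrary: f g)
  case 0
  then show ?case by (simp add: continuous_on_add)
next
  case (Suc n)
  show ?case
  proof (rule Ck_on_SucI[OF assms(1)])
    show "((\<lambda>p. f p + g p) has_derivative
        (\<lambda>h. frechet_derivative f (at p) h + frechet_derivative g (at p) h)) (at p)"
      if "p \<in> S" for p
      by (intro has_derivative_add Ck_on_has_derivative[OF Suc.prems(1) that]
          Ck_on_has_derivative[OF Suc.prems(2) that])
  qed (use Suc in auto)
qed

lemma Ck_on_bilinear:
  assumes B: "bounded_bilinear B" and "open S" "Ck_on n S f" "Ck_on n S g"
  shows "Ck_on n S (\<lambda>p. B (f p) (g p))"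
  using assms(3,4)
proof (induction n arbitrary: f g)
  case 0
  then show ?case
    using bounded_bilinear.continuous_on[OF B] by simp
next
  case (Suc n)
  show ?case
  proof (rule Ck_on_SucI[OF assms(2)])
    show "((\<lambda>p. B (f p) (g p)) has_derivative
        (\<lambda>h. B (f p) (frechet_derivative g (at p) h) + B (frechet_derivative f (at p) h) (g p))) (at p)"
      if "p \<in> S" for p
      by (intro bounded_bilinear.FDERIV[OF B] Ck_on_has_derivative[OF Suc.prems(1) that]
          Ck_on_has_derivative[OF Suc.prems(2) that])
    show "Ck_on n S (\<lambda>p. B (f p) (frechet_derivative g (at p) b)
        + B (frechet_derivative f (at p) b) (g p))" if "b \<in> Basis" for b
      using Suc that Ck_on_SucD[OF Suc.prems(1)] Ck_on_SucD[OF Suc.prems(2)]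
      by (intro Ck_on_add assms) auto
  qed
qed

text \<open>The induction step replaces \<open>F m\<close> by \<open>F (Suc m)\<close>, so the outer
  function comes with its whole tower of derivatives. One formulation then covers real functions
  such as \<open>flat\<close> and holomorphic functions with their higher derivatives.\<close>

lemma Ck_on_comp:
  fixes F :: "nat \<Rightarrow> 'b::real_normed_field \<Rightarrow> 'b"
  assumes "open S" "Ck_on n S f" "\<And>p. p \<in> S \<Longrightarrow> f p \<in> T"
    and F: "\<And>m z. z \<in> T \<Longrightarrow> (F m has_field_derivative F (Suc m) z) (at z)"
  shows "Ck_on n S (\<lambda>p. F m (f p))"
  using assms(2)
proof (induction n arbitrary: m)
  case 0
  have "continuous_on T (F m)"
    using F by (meson DERIV_isCont continuous_at_imp_continuous_on)
  then show ?case
    using 0 assms(3) by (auto intro: continuous_on_compose2)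
next
  case (Suc n)
  show ?case
  proof (rule Ck_on_SucI[OF assms(1)])
    show "((\<lambda>p. F m (f p)) has_derivative
        (\<lambda>h. F (Suc m) (f p) * frechet_derivative f (at p) h)) (at p)"
      if "p \<in> S" for p
      using has_derivative_compose[OF Ck_on_has_derivative[OF Suc.prems that]
          F[OF assms(3)[OF that], unfolded has_field_derivative_def]]
      by simp
    show "Ck_on n S (\<lambda>p. F (Suc m) (f p) * frechet_derivative f (at p) b)"
      if "b \<in> Basis" for b
    proof (rule Ck_on_bilinear[OF bounded_bilinear_mult assms(1)])
      show "Ck_on n S (\<lambda>p. F (Suc m) (f p))"
        by (rule Suc.IH[OF Ck_on_SucD[OF Suc.prems]])
      show "Ck_on n S (\<lambda>p. frechet_derivative f (at p) b)"
        using Suc.prems that by simp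
    qed
  qed
qed

definition smooth_on ::
    "'a::euclidean_space set \<Rightarrow> ('a \<Rightarrow> 'b::real_normed_vector) \<Rightarrow> bool" where
  "smooth_on S f \<longleftrightarrow> (\<forall>n. Ck_on n S f)"

lemma smooth_eq_smooth_on: "smooth f \<longleftrightarrow> smooth_on UNIV f"
  by (simp add: smooth_def smooth_on_def C_k_eq_Ck_on)

lemma smooth_on_cong:
  "smooth_on S f \<Longrightarrow> open S \<Longrightarrow> (\<And>p. p \<in> S \<Longrightarrow> f p = g p) \<Longrightarrow> smooth_on S g"
  unfolding smooth_on_def by (blast intro: Ck_on_cong)

lemma smooth_on_subset: "smooth_on S f \<Longrightarrow> T \<subseteq> S \<Longrightarrow> smooth_on T f"
  unfolding smooth_on_def by (blast intro: Ck_on_subset)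

lemma smooth_on_Un:
  "smooth_on S f \<Longrightarrow> smooth_on T f \<Longrightarrow> open S \<Longrightarrow> open T \<Longrightarrow> smooth_on (S \<union> T) f"
  unfolding smooth_on_def by (blast intro: Ck_on_Un)

lemma smooth_on_const: "open S \<Longrightarrow> smooth_on S (\<lambda>p. c)"
  unfolding smooth_on_def by (metis Ck_on_const)

lemma smooth_on_linear: "bounded_linear L \<Longrightarrow> open S \<Longrightarrow> smooth_on S L"
  unfolding smooth_on_def by (metis Ck_on_linear)

lemma smooth_on_bounded_linear:
  "bounded_linear L \<Longrightarrow> open S \<Longrightarrow> smooth_on S f \<Longrightarrow> smooth_on S (\<lambda>p. L (f p))"
  unfolding smooth_on_def by (blast intro: Ck_on_bounded_linear)

lemma smooth_on_add:
  "open S \<Longrightarrow> smooth_on S f \<Longrightarrow> smooth_on S g \<Longrightarrow> smooth_on S (\<lambda>p. f p + g p)"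
  unfolding smooth_on_def by (blast intro: Ck_on_add)

lemma smooth_on_diff:
  assumes "open S" "smooth_on S f" "smooth_on S g"
  shows "smooth_on S (\<lambda>p. f p - g p)"
proof -
  have "bounded_linear (uminus :: 'b \<Rightarrow> 'b)"
    by (intro bounded_linear_minus bounded_linear_ident)
  then have "smooth_on S (\<lambda>p. - g p)"
    by (rule smooth_on_bounded_linear[where L = uminus and f = g]) (use assms in auto)
  with assms(2) have "smooth_on S (\<lambda>p. f p + - g p)"
    by (rule smooth_on_add[OF assms(1), where f = f and g = "\<lambda>p. - g p"])
  then show ?thesis by simp
qed

lemma smooth_on_mult:
  fixes f g :: "'a::euclidean_space \<Rightarrow> 'b::real_normed_algebra"
  shows "open S \<Longrightarrow> smooth_on S f \<Longrightarrow> smooth_on S g \<Longrightarrow> smooth_on S (\<lambda>p. f p * g p)"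
  unfolding smooth_on_def by (blast intro: Ck_on_bilinear bounded_bilinear_mult)

lemma smooth_on_comp:
  fixes F :: "nat \<Rightarrow> 'b::real_normed_field \<Rightarrow> 'b"
  assumes "smooth_on S f" "open S" "\<And>p. p \<in> S \<Longrightarrow> f p \<in> T"
    and "\<And>m z. z \<in> T \<Longrightarrow> (F m has_field_derivative F (Suc m) z) (at z)"
  shows "smooth_on S (\<lambda>p. F m (f p))"
  using assms unfolding smooth_on_def by (blast intro: Ck_on_comp)

lemma smooth_on_holomorphic:
  assumes "smooth_on S f" "open S" "\<And>p. p \<in> S \<Longrightarrow> f p \<in> T" "g holomorphic_on T" "open T"
  shows "smooth_on S (\<lambda>p. g (f p))"
proof -
  have "smooth_on S (\<lambda>p. (deriv ^^ 0) g (f p))"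
  proof (rule smooth_on_comp[OF assms(1-3)])
    fix m z assume "z \<in> T"
    then show "((deriv ^^ m) g has_field_derivative (deriv ^^ Suc m) g z) (at z)"
      using holomorphic_higher_deriv[OF assms(4,5), of m] assms(5)
      by (simp add: holomorphic_derivI)
  qed
  then show ?thesis by simp
qed

lemma smooth_on_inverse:
  fixes f :: "'a::euclidean_space \<Rightarrow> real"
  assumes "smooth_on S f" "open S" "\<And>p. p \<in> S \<Longrightarrow> f p \<noteq> 0"
  shows "smooth_on S (\<lambda>p. inverse (f p))"
proof -
  define F :: "nat \<Rightarrow> real \<Rightarrow> real" where "F m x = (-1)^m * fact m * inverse x ^ Suc m" for m x
  have "smooth_on S (\<lambda>p. F 0 (f p))"
  proof (rule smooth_on_comp[OF assms(1,2)])
    show "f p \<in> -{0}" if "p \<in> S" for p using assms(3)[OF that] by simp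
    show "(F m has_field_derivative F (Suc m) x) (at x)" if "x \<in> -{0}" for m x
    proof -
      from that have "x \<noteq> 0" by simp
      from DERIV_cmult[OF DERIV_power_Suc[OF DERIV_inverse[OF this]], of "(-1)^m * fact m" m]
      show ?thesis
        by (simp add: F_def[abs_def] algebra_simps)
    qed
  qed
  then show ?thesis by (simp add: F_def)
qed

lemma smooth_on_imp_continuous_on: "smooth_on S f \<Longrightarrow> continuous_on S f"
  unfolding smooth_on_def by (metis Ck_on.simps(1))

lemma smooth_on_has_derivative:
  "smooth_on S f \<Longrightarrow> p \<in> S \<Longrightarrow> (f has_derivative frechet_derivative f (at p)) (at p)"
  unfolding smooth_on_def by (metis Ck_on_has_derivative)

lemma smooth_on_frechet_derivative:
  assumes "smooth_on S f" "b \<in> Basis"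
  shows "smooth_on S (\<lambda>p. frechet_derivative f (at p) b)"
  using assms unfolding smooth_on_def by (metis Ck_on.simps(2))

text \<open>\<Omega> and the complement of K are open and cover the space, so smoothness on the
  first and vanishing on the second glue to global smoothness.\<close>

lemma test_functionI:
  assumes "smooth_on \<Omega> f" "open \<Omega>" "compact K" "K \<subseteq> \<Omega>" "\<And>p. p \<notin> K \<Longrightarrow> f p = 0"
  shows "test_function \<Omega> f"
proof -
  have "smooth_on (- K) f"
    by (rule smooth_on_cong[OF smooth_on_const[where c = 0]])
      (use assms compact_imp_closed in \<open>auto simp: open_Compl\<close>)
  then have "smooth_on (\<Omega> \<union> - K) f"
    using assms compact_imp_closed by (intro smooth_on_Un) (auto simp: open_Compl)
  moreover have "\<Omega> \<union> - K = UNIV" using assms(4) by auto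
  ultimately have "smooth f" by (simp add: smooth_eq_smooth_on)
  have sub: "closure {p. f p \<noteq> 0} \<subseteq> K"
    using assms(5) by (intro closure_minimal compact_imp_closed assms(3)) auto
  then have "compact (closure {p. f p \<noteq> 0})"
    using compact_Int_closed[OF assms(3) closed_closure, of "{p. f p \<noteq> 0}"] by (simp add: inf.absorb2)
  then show ?thesis
    using \<open>smooth f\<close> sub assms(4) by (auto simp: test_function_def)
qed

lemma test_functionE:
  assumes "test_function \<Omega> f"
  obtains K where "smooth_on UNIV f" "compact K" "K \<subseteq> \<Omega>" "\<And>p. p \<notin> K \<Longrightarrow> f p = 0"
proof (rule that)
  show "smooth_on UNIV f" "compact (closure {p. f p \<noteq> 0})" "closure {p. f p \<noteq> 0} \<subseteq> \<Omega>"
    using assms by (auto simp: test_function_def smooth_eq_smooth_on)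
  show "f p = 0" if "p \<notin> closure {p. f p \<noteq> 0}" for p
    using that closure_subset[of "{p. f p \<noteq> 0}"] by auto
qed

section \<open>A flat function, truncations and cutoffs\<close>

text \<open>Differentiating p(1/x) exp (-1/x) gives (p - p')(1/x) exp (-1/x) divided by the square
  of x, whence the recursion.\<close>

primrec flat_poly :: "nat \<Rightarrow> real poly" where
  "flat_poly 0 = 1"
| "flat_poly (Suc n) = [:0, 0, 1:] * (flat_poly n - pderiv (flat_poly n))"

text \<open>\<open>flat n\<close> is the \<open>n\<close>-th derivative of the function that is \<open>exp (- 1 / x)\<close> for \<open>x > 0\<close>
  and \<open>0\<close> otherwise.\<close>

definition flat :: "nat \<Rightarrow> real \<Rightarrow> real" where
  "flat n x = (if x \<le> 0 then 0 else poly (flat_poly n) (inverse x) * exp (- inverse x))"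

lemma poly_times_exp_minus_tendsto_0:
  "((\<lambda>y::real. poly p y * exp (- y)) \<longlongrightarrow> 0) at_top"
proof -
  have "((\<lambda>y::real. \<Sum>i\<le>degree p. coeff p i * (y ^ i / exp y)) \<longlongrightarrow> (\<Sum>i\<le>degree p. coeff p i * 0)) at_top"
    by (intro tendsto_sum tendsto_mult tendsto_const tendsto_power_div_exp_0)
  then show ?thesis
    by (simp add: poly_altdef sum_distrib_right exp_minus divide_inverse mult.assoc)
qed

lemma flat_has_field_derivative: "(flat n has_field_derivative flat (Suc n) x) (at x)"
proof -
  consider "x < 0" | "x > 0" | "x = 0" by linarith
  then show ?thesis
  proof cases
    case 1
    have "((\<lambda>_. 0) has_field_derivative 0) (at x)" by simp
    then have "(flat n has_field_derivative 0) (at x)"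
      by (rule has_field_derivative_transform_within_open[where S = "{..<0}"])
        (use 1 in \<open>auto simp: flat_def\<close>)
    then show ?thesis using 1 by (simp add: flat_def)
  next
    case 2
    have "((\<lambda>x. poly (flat_poly n) (inverse x) * exp (- inverse x)) has_field_derivative flat (Suc n) x) (at x)"
      using 2 by (auto intro!: derivative_eq_intros
          simp: flat_def power2_eq_square algebra_simps)
    then show ?thesis
      by (rule has_field_derivative_transform_within_open[where S = "{0<..}"])
        (use 2 in \<open>auto simp: flat_def\<close>)
  next
    case 3
    have "((\<lambda>h. flat n h / h) \<longlongrightarrow> 0) (at 0)"
    proof (rule filterlim_split_at)
      have "eventually (\<lambda>h. 0 = flat n h / h) (at_left 0)"
        by (auto simp: eventually_at_filter flat_def)
      then show "((\<lambda>h. flat n h / h) \<longlongrightarrow> 0) (at_left 0)"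
        by (rule Lim_transform_eventually[OF tendsto_const])
      \<comment> \<open>With y = 1 / h the difference quotient at 0 is p(y) y exp (- y); the extra
        factor y is the \<open>pCons 0\<close>.\<close>
      have "((\<lambda>h::real. poly (pCons 0 (flat_poly n)) (inverse h) * exp (- inverse h)) \<longlongrightarrow> 0) (at_right 0)"
        by (rule filterlim_compose[OF poly_times_exp_minus_tendsto_0 filterlim_inverse_at_top_right])
      moreover have "eventually (\<lambda>h. poly (pCons 0 (flat_poly n)) (inverse h) * exp (- inverse h)
          = flat n h / h) (at_right 0)"
        by (auto simp: eventually_at_filter flat_def field_simps)
      ultimately show "((\<lambda>h. flat n h / h) \<longlongrightarrow> 0) (at_right 0)"
        by (rule Lim_transform_eventually)
    qed
    then show ?thesis
      using 3 by (simp add: has_field_derivative_iff flat_def)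
  qed
qed

lemma flat_0: "flat 0 x = (if x \<le> 0 then 0 else exp (- inverse x))"
  by (simp add: flat_def)

lemma flat_1: "flat (Suc 0) x = (if x \<le> 0 then 0 else (inverse x)\<^sup>2 * exp (- inverse x))"
  by (simp add: flat_def power2_eq_square)

lemma flat_0_bounds: "0 \<le> flat 0 x" "flat 0 x \<le> 1"
  by (simp_all add: flat_0)

lemma flat_1_nonneg: "0 \<le> flat (Suc 0) x"
  by (simp add: flat_1)

lemma exp_minus_power_le:
  fixes y :: real
  assumes "0 \<le> y"
  shows "y * exp (- y) \<le> 1" "y\<^sup>2 * exp (- y) \<le> 2"
proof -
  have "y \<le> exp y" using exp_ge_add_one_self[of y] by linarith
  then show "y * exp (- y) \<le> 1"
    by (simp add: exp_minus field_simps)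
  have "1 + y + y\<^sup>2 / 2 \<le> exp y"
    by (rule exp_lower_Taylor_quadratic[OF assms])
  with assms have "y\<^sup>2 \<le> 2 * exp y" by simp
  then show "y\<^sup>2 * exp (- y) \<le> 2"
    by (simp add: exp_minus field_simps)
qed

lemma smooth_on_flat:
  assumes "open S" "smooth_on S f"
  shows "smooth_on S (\<lambda>p. flat n (f p))"
  by (rule smooth_on_comp[OF assms(2,1), where T = UNIV]) (auto intro: flat_has_field_derivative)

text \<open>Feeding the flat function with \<open>s\<^sup>2 / d\<^sup>2 - 1\<close> makes the
  truncation odd and smooth with no case distinction on the sign of s. The scaling by d keeps the
  bound on the derivative independent of d.\<close>

definition trunc :: "real \<Rightarrow> real \<Rightarrow> real" where
  "trunc d s = s * flat 0 (s\<^sup>2 / d\<^sup>2 - 1)"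

definition dtrunc :: "real \<Rightarrow> real \<Rightarrow> real" where
  "dtrunc d s = flat 0 (s\<^sup>2 / d\<^sup>2 - 1) + 2 * (s\<^sup>2 / d\<^sup>2) * flat (Suc 0) (s\<^sup>2 / d\<^sup>2 - 1)"

lemma trunc_has_field_derivative: "(trunc d has_field_derivative dtrunc d s) (at s)"
proof -
  have "((\<lambda>s. s\<^sup>2 / d\<^sup>2 - 1) has_field_derivative 2 * s / d\<^sup>2 - 0) (at s)"
    by (intro DERIV_diff DERIV_cdivide DERIV_const) (auto intro!: derivative_eq_intros)
  from DERIV_mult[OF DERIV_ident DERIV_chain'[OF this flat_has_field_derivative[of 0]]]
  show ?thesis
    by (simp add: trunc_def[abs_def] dtrunc_def power2_eq_square algebra_simps)
qed

lemma trunc_eq_0: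
  assumes "0 < d" "\<bar>s\<bar> \<le> d"
  shows "trunc d s = 0" "dtrunc d s = 0"
proof -
  have "s\<^sup>2 \<le> d\<^sup>2" using assms by (metis abs_le_square_iff abs_of_pos)
  then have "s\<^sup>2 / d\<^sup>2 - 1 \<le> 0" using assms by simp
  then show "trunc d s = 0" "dtrunc d s = 0"
    by (auto simp: trunc_def dtrunc_def flat_0 flat_1)
qed

lemma dtrunc_nonneg: "0 \<le> dtrunc d s"
  unfolding dtrunc_def by (intro add_nonneg_nonneg mult_nonneg_nonneg flat_0_bounds flat_1_nonneg) auto

text \<open>Uniformity in d is the point: the same constant serves in the energy bound and as a
  dominating factor when d tends to 0. With v = s^2 / d^2 - 1 and y = 1 / v, the second summand is 2
  (y + y^2) exp (- y) \<le> 6, and the first is at most 1.\<close>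

lemma dtrunc_le: "dtrunc d s \<le> 7"
proof -
  define v where "v = s\<^sup>2 / d\<^sup>2 - 1"
  have "2 * (v + 1) * flat (Suc 0) v \<le> 6"
  proof (cases "v \<le> 0")
    case False
    define y where "y = inverse v"
    have y: "0 \<le> y" "v * y = 1" using False by (auto simp: y_def)
    have "2 * (v + 1) * flat (Suc 0) v = 2 * ((v * y) * y + y\<^sup>2) * exp (- y)"
      using False by (simp add: flat_1 y_def power2_eq_square algebra_simps)
    also have "\<dots> = 2 * (y * exp (- y) + y\<^sup>2 * exp (- y))"
      by (simp add: y algebra_simps)
    also have "\<dots> \<le> 2 * (1 + 2)"
      by (intro mult_left_mono add_mono exp_minus_power_le y) auto
    finally show ?thesis by simp
  qed (simp add: flat_1)
  then show ?thesis
    using flat_0_bounds(2)[of v] by (simp add: dtrunc_def v_def)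
qed

text \<open>Up to 2 d the error is at most \<bar>s\<bar>, because the factor lies between 0 and 1.
  Beyond that, 1 - exp (-1/v) \<le> 1/v, and v is at least half of s^2 / d^2. The bound is uniform
  in s, so truncations converge uniformly as d tends to 0.\<close>

lemma trunc_close:
  assumes "0 < d"
  shows "\<bar>trunc d s - s\<bar> \<le> 2 * d"
proof (cases "\<bar>s\<bar> \<le> 2 * d")
  case True
  have "trunc d s - s = - (s * (1 - flat 0 (s\<^sup>2 / d\<^sup>2 - 1)))"
    by (simp add: trunc_def algebra_simps)
  then have "\<bar>trunc d s - s\<bar> = \<bar>s\<bar> * (1 - flat 0 (s\<^sup>2 / d\<^sup>2 - 1))"
    using flat_0_bounds(2)[of "s\<^sup>2 / d\<^sup>2 - 1"] by (simp add: abs_mult)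
  also have "\<dots> \<le> \<bar>s\<bar> * 1"
    by (intro mult_left_mono) (use flat_0_bounds in auto)
  finally show ?thesis using True by linarith
next
  case False
  define v where "v = s\<^sup>2 / d\<^sup>2 - 1"
  have "(2 * d)\<^sup>2 \<le> s\<^sup>2"
    using False assms by (metis abs_le_square_iff abs_of_pos mult_pos_pos not_le order_less_imp_le zero_less_numeral)
  then have s2: "4 * d\<^sup>2 \<le> s\<^sup>2" by (simp add: power2_eq_square)
  then have "4 \<le> s\<^sup>2 / d\<^sup>2" using assms by (simp add: field_simps)
  then have v: "v \<ge> 3" "s\<^sup>2 / d\<^sup>2 \<le> 2 * v" by (auto simp: v_def)
  have "s\<^sup>2 \<le> 2 * v * d\<^sup>2" using v(2) assms by (simp add: field_simps)
  then have "\<bar>s\<bar> * \<bar>s\<bar> \<le> 2 * v * d * d"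
    by (simp add: power2_eq_square)
  also have "\<dots> \<le> 2 * v * d * \<bar>s\<bar>"
    using False v assms by (intro mult_left_mono) auto
  finally have "\<bar>s\<bar> \<le> 2 * v * d"
    by (rule mult_right_le_imp_le) (use False assms in auto)
  then have *: "\<bar>s\<bar> * inverse v \<le> 2 * d"
    using v by (simp add: field_simps)
  have "1 - inverse v \<le> flat 0 v"
    using v exp_ge_add_one_self[of "- inverse v"] by (simp add: flat_0)
  then have "1 - flat 0 v \<le> inverse v" by linarith
  then have "\<bar>s\<bar> * (1 - flat 0 v) \<le> \<bar>s\<bar> * inverse v"
    by (intro mult_left_mono) auto
  moreover have "\<bar>trunc d s - s\<bar> = \<bar>s\<bar> * (1 - flat 0 v)"
  proof -
    have "trunc d s - s = - (s * (1 - flat 0 v))"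
      by (simp add: trunc_def v_def algebra_simps)
    then show ?thesis using flat_0_bounds(2)[of v] by (simp add: abs_mult)
  qed
  ultimately show ?thesis using * by linarith
qed

text \<open>At s = 0 the limit fails, since the derivative is 0 there for every d. This is why the
  zero set of w is treated separately in \<open>AE_gradient_zero\<close>.\<close>

lemma dtrunc_tendsto_1:
  assumes "s \<noteq> 0"
  shows "(\<lambda>n. dtrunc (inverse (real (Suc n))) s) \<longlonglongrightarrow> 1"
proof -
  define v where "v n = s\<^sup>2 * (real (Suc n))\<^sup>2 - 1" for n
  have v: "filterlim v at_top sequentially"
  proof -
    have "filterlim (\<lambda>n. real (Suc n)) at_top sequentially"
      using filterlim_real_sequentially filterlim_sequentially_Suc by blast
    then have "filterlim (\<lambda>n. - 1 + s\<^sup>2 * (real (Suc n))\<^sup>2) at_top sequentially"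
      using assms by (intro filterlim_tendsto_add_at_top[OF tendsto_const]
          filterlim_tendsto_pos_mult_at_top[OF tendsto_const] filterlim_pow_at_top) auto
    then show ?thesis by (simp add: v_def[abs_def])
  qed
  have eq: "dtrunc (inverse (real (Suc n))) s = flat 0 (v n) + 2 * (v n + 1) * flat (Suc 0) (v n)" for n
    by (simp add: dtrunc_def v_def field_simps)
  define h :: "real \<Rightarrow> real" where "h y = exp (- y) + 2 * (y + y\<^sup>2) * exp (- y)" for y
  have "isCont h 0" unfolding h_def by (intro continuous_intros)
  moreover have iv: "(\<lambda>n. inverse (v n)) \<longlonglongrightarrow> 0"
    by (rule tendsto_inverse_0_at_top[OF v])
  ultimately have "(\<lambda>n. h (inverse (v n))) \<longlonglongrightarrow> h 0"
    by (rule isCont_tendsto_compose)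
  moreover have "eventually (\<lambda>n. h (inverse (v n)) = dtrunc (inverse (real (Suc n))) s) sequentially"
    using v[THEN filterlim_at_top_dense[THEN iffD1, rule_format], of 0]
  proof eventually_elim
    case (elim n)
    then show ?case
      unfolding eq h_def by (simp add: flat_0 flat_1 power2_eq_square field_simps)
  qed
  ultimately show ?thesis
    by (auto simp: h_def intro: Lim_transform_eventually)
qed

text \<open>Put in place of \<open>\<bar>x\<bar>\<close>, this removes the kink of the solution at \<open>x = 0\<close>.\<close>

definition sabs :: "nat \<Rightarrow> real \<Rightarrow> real" where
  "sabs n x = x * (flat 0 (real (Suc n) * x) - flat 0 (- (real (Suc n) * x)))"

definition dsabs :: "nat \<Rightarrow> real \<Rightarrow> real" where
  "dsabs n x = (flat 0 (real (Suc n) * x) - flat 0 (- (real (Suc n) * x)))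
     + real (Suc n) * x * (flat (Suc 0) (real (Suc n) * x) + flat (Suc 0) (- (real (Suc n) * x)))"

lemma sabs_has_field_derivative: "(sabs n has_field_derivative dsabs n x) (at x)"
  unfolding sabs_def[abs_def] dsabs_def
  by (auto intro!: derivative_eq_intros DERIV_chain'[OF _ flat_has_field_derivative]
      simp: algebra_simps)

lemma sabs_minus: "sabs n (- x) = sabs n x"
  by (simp add: sabs_def algebra_simps)

lemma dsabs_minus: "dsabs n (- x) = - dsabs n x"
  by (simp add: dsabs_def algebra_simps)

lemma sabs_pos: "0 < x \<Longrightarrow> sabs n x = x * exp (- inverse (real (Suc n) * x))"
  by (simp add: sabs_def flat_0 mult_le_0_iff)

lemma dsabs_pos:
  assumes "0 < x"
  shows "dsabs n x = (1 + inverse (real (Suc n) * x)) * exp (- inverse (real (Suc n) * x))"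
proof -
  define y where "y = real (Suc n) * x"
  have "y > 0" using assms by (simp add: y_def)
  then show ?thesis unfolding dsabs_def y_def[symmetric]
    by (simp add: flat_0 flat_1 power2_eq_square field_simps)
qed

text \<open>The bounds do not depend on n. In particular, replacing \<open>\<bar>x\<bar>\<close> by
  \<open>sabs n x\<close> never leaves the strip in which \<bar>x\<bar> \<le> R, so bounds of
  holomorphic functions on a rectangle apply to all approximations at once.\<close>

lemma sabs_bounds: "0 \<le> sabs n x" "sabs n x \<le> \<bar>x\<bar>" "\<bar>dsabs n x\<bar> \<le> 2"
proof -
  have *: "0 \<le> sabs n x \<and> sabs n x \<le> x \<and> \<bar>dsabs n x\<bar> \<le> 2" if "0 < x" for x
  proof -
    define y where "y = inverse (real (Suc n) * x)"
    have y: "0 \<le> y" using that by (simp add: y_def)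
    have e: "exp (- y) \<le> 1" using y by simp
    have "\<bar>(1 + y) * exp (- y)\<bar> = exp (- y) + y * exp (- y)" 
      using y by (simp add: algebra_simps abs_mult)
    then have "\<bar>(1 + y) * exp (- y)\<bar> \<le> 2"
      using exp_minus_power_le(1)[OF y] e by linarith
    then show ?thesis
      unfolding sabs_pos[OF that] dsabs_pos[OF that] y_def[symmetric]
      using that e by (simp add: mult_left_le)
  qed
  consider "0 < x" | "x = 0" | "0 < - x" by linarith
  then have "0 \<le> sabs n x \<and> sabs n x \<le> \<bar>x\<bar> \<and> \<bar>dsabs n x\<bar> \<le> 2"
  proof cases
    case 3
    then show ?thesis using *[OF 3] by (simp add: sabs_minus dsabs_minus)
  qed (use * in \<open>auto simp: sabs_def dsabs_def flat_0\<close>)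
  then show "0 \<le> sabs n x" "sabs n x \<le> \<bar>x\<bar>" "\<bar>dsabs n x\<bar> \<le> 2" by auto
qed

lemma sabs_tendsto:
  assumes "x \<noteq> 0"
  shows "(\<lambda>n. sabs n x) \<longlonglongrightarrow> \<bar>x\<bar>" "(\<lambda>n. dsabs n x) \<longlonglongrightarrow> sgn x"
proof -
  have *: "(\<lambda>n. sabs n x) \<longlonglongrightarrow> x" "(\<lambda>n. dsabs n x) \<longlonglongrightarrow> 1" if "0 < x" for x
  proof -
    have "(\<lambda>n. inverse (real (Suc n)) * inverse x) \<longlonglongrightarrow> 0 * inverse x"
      by (intro tendsto_mult LIMSEQ_inverse_real_of_nat tendsto_const)
    then have y: "(\<lambda>n. inverse (real (Suc n) * x)) \<longlonglongrightarrow> 0" by (simp add: field_simps)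
    have "(\<lambda>n. x * exp (- inverse (real (Suc n) * x))) \<longlonglongrightarrow> x * exp (- 0)"
      by (intro tendsto_intros y)
    then show "(\<lambda>n. sabs n x) \<longlonglongrightarrow> x" by (simp add: sabs_pos[OF that])
    have "(\<lambda>n. (1 + inverse (real (Suc n) * x)) * exp (- inverse (real (Suc n) * x))) \<longlonglongrightarrow> (1 + 0) * exp (- 0)"
      by (intro tendsto_intros y)
    then show "(\<lambda>n. dsabs n x) \<longlonglongrightarrow> 1" by (simp add: dsabs_pos[OF that])
  qed
  have "(\<lambda>n. sabs n x) \<longlonglongrightarrow> \<bar>x\<bar> \<and> (\<lambda>n. dsabs n x) \<longlonglongrightarrow> sgn x"
  proof (cases "0 < x")
    case True
    then show ?thesis using * by simp
  next
    case False
    then have "0 < - x" using assms by simp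
    from *[OF this] False assms show ?thesis
      by (simp add: sabs_minus dsabs_minus tendsto_minus_cancel_left)
  qed
  then show "(\<lambda>n. sabs n x) \<longlonglongrightarrow> \<bar>x\<bar>" "(\<lambda>n. dsabs n x) \<longlonglongrightarrow> sgn x" by auto
qed


lemma smooth_on_sabs:
  assumes "open S" "smooth_on S f"
  shows "smooth_on S (\<lambda>p. sabs n (f p))"
proof -
  have "smooth_on S (\<lambda>p. f p * (flat 0 (real (Suc n) * f p) - flat 0 (- real (Suc n) * f p)))"
    by (intro smooth_on_mult smooth_on_diff smooth_on_flat smooth_on_const assms)
  then show ?thesis by (simp only: sabs_def mult_minus_left)
qed

lemma smooth_on_trunc:
  assumes "open S" "smooth_on S f"
  shows "smooth_on S (\<lambda>p. trunc d (f p))"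
proof -
  have "smooth_on S (\<lambda>p. f p * (flat 0 (f p * f p * inverse (d\<^sup>2) - 1)))"
    by (intro smooth_on_mult smooth_on_diff smooth_on_flat smooth_on_const assms)
  then show ?thesis by (simp add: trunc_def power2_eq_square divide_inverse)
qed

section \<open>Smooth steps, exhausting rectangles and cutoffs\<close>

definition step :: "real \<Rightarrow> real" where
  "step x = flat 0 x * inverse (flat 0 x + flat 0 (1 - x))"

lemma step_eq: "x \<le> 0 \<Longrightarrow> step x = 0" "1 \<le> x \<Longrightarrow> step x = 1"
  by (auto simp: step_def flat_0)

lemma smooth_on_step:
  assumes "open S" "smooth_on S f"
  shows "smooth_on S (\<lambda>p. step (f p))"
  unfolding step_def
proof (intro smooth_on_mult smooth_on_inverse smooth_on_add smooth_on_flat smooth_on_diff smooth_on_const assms)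
  show "flat 0 (f p) + flat 0 (1 - f p) \<noteq> 0" for p
    by (cases "f p \<le> 0") (auto simp: flat_0 add_pos_pos less_imp_neq[symmetric])
qed

text \<open>A one-parameter exhaustion: these sets are compact in the open half-plane for R > 0,
  increase with R, and every compact subset of the half-plane lies in one with R \<ge> 1.\<close>

definition rect :: "real \<Rightarrow> (real \<times> real) set" where
  "rect R = {1 / R..R} \<times> {- R..R}"

text \<open>The arguments of \<open>step\<close> are at least 1 on \<open>rect R\<close> and drop to
  0 at t = 1 / (2 R), t = R + 1 and \<bar>x\<bar> = R + 1. For R \<ge> 1 the cutoff thus vanishes
  outside \<open>rect (2 * R)\<close>.\<close>

definition cutoff :: "real \<Rightarrow> real \<times> real \<Rightarrow> real" where
  "cutoff R p = step (2 * R * fst p - 1) * step (R + 1 - fst p)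
     * (step (R + 1 - snd p) * step (R + 1 + snd p))"

lemma open_halfplane: "open halfplane"
proof -
  have "halfplane = {0<..} \<times> UNIV" by (auto simp: halfplane_def)
  then show ?thesis by (metis open_Times open_UNIV open_greaterThan)
qed

lemma mem_halfplane [simp]: "(t, x) \<in> halfplane \<longleftrightarrow> 0 < t" "p \<in> halfplane \<longleftrightarrow> 0 < fst p"
  by (auto simp: halfplane_def case_prod_unfold)

lemma compact_rect: "compact (rect R)"
  by (simp add: rect_def compact_Times)

lemma rect_subset_halfplane: "0 < R \<Longrightarrow> rect R \<subseteq> halfplane"
proof
  fix p assume "0 < R" "p \<in> rect R"
  then have "0 < 1 / R" "1 / R \<le> fst p" by (auto simp: rect_def)
  then show "p \<in> halfplane" by (simp del: zero_less_divide_1_iff)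
qed

lemma rect_mono:
  assumes "0 < R" "R \<le> R'"
  shows "rect R \<subseteq> rect R'"
proof -
  have "1 / R' \<le> 1 / R" using assms by (intro divide_left_mono) auto
  with assms show ?thesis by (auto simp: rect_def simp del: divide_le_eq_1)
qed

lemma compact_subset_rect:
  assumes "compact K" "K \<subseteq> halfplane"
  obtains R where "1 \<le> R" "K \<subseteq> rect R"
proof (cases "K = {}")
  case True
  then show ?thesis using that[of 1] by simp
next
  case False
  obtain p where p: "p \<in> K" "\<And>q. q \<in> K \<Longrightarrow> fst p \<le> fst q"
    using continuous_attains_inf[OF assms(1) False, of fst] continuous_on_fst[OF continuous_on_id]
    by blast
  have p0: "0 < fst p" using p(1) assms(2) by auto
  obtain B where B: "\<And>q. q \<in> K \<Longrightarrow> norm q \<le> B"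
    using compact_imp_bounded[OF assms(1)] by (auto simp: bounded_iff)
  define R where "R = max 1 (max B (1 / fst p))"
  have R: "1 \<le> R" "B \<le> R" "1 / fst p \<le> R" by (auto simp: R_def)
  show ?thesis
  proof (rule that[OF R(1)], rule)
    fix q assume q: "q \<in> K"
    have "\<bar>fst q\<bar> \<le> norm q" "\<bar>snd q\<bar> \<le> norm q"
      by (metis norm_fst_le real_norm_def prod.collapse) (metis norm_snd_le real_norm_def prod.collapse)
    moreover have "1 / R \<le> fst p"
      using R(1,3) p0 by (simp add: field_simps)
    ultimately show "q \<in> rect R"
      using B[OF q] p(2)[OF q] R by (auto simp: rect_def mem_Times_iff)
  qed
qed

lemma smooth_on_fst: "open S \<Longrightarrow> smooth_on S (fst :: 'a::euclidean_space \<times> 'b::euclidean_space \<Rightarrow> 'a)"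
  by (rule smooth_on_linear[OF bounded_linear_fst])

lemma smooth_on_snd: "open S \<Longrightarrow> smooth_on S (snd :: 'a::euclidean_space \<times> 'b::euclidean_space \<Rightarrow> 'b)"
  by (rule smooth_on_linear[OF bounded_linear_snd])

lemma smooth_on_cutoff: "open S \<Longrightarrow> smooth_on S (cutoff R)"
  unfolding cutoff_def[abs_def]
  by (intro smooth_on_mult smooth_on_step smooth_on_diff smooth_on_add smooth_on_const
      smooth_on_fst smooth_on_snd)

lemma cutoff_eq_1:
  assumes "1 \<le> R" "p \<in> rect R"
  shows "cutoff R p = 1"
proof -
  have "2 * R * fst p - 1 \<ge> 1" "R + 1 - fst p \<ge> 1" "R + 1 - snd p \<ge> 1" "R + 1 + snd p \<ge> 1"
    using assms by (auto simp: rect_def mem_Times_iff field_simps)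
  then show ?thesis by (simp add: cutoff_def step_eq)
qed

lemma cutoff_eq_0:
  assumes "1 \<le> R" "p \<notin> rect (2 * R)"
  shows "cutoff R p = 0"
proof -
  have "2 * R * fst p - 1 \<le> 0 \<or> R + 1 - fst p \<le> 0 \<or> R + 1 - snd p \<le> 0 \<or> R + 1 + snd p \<le> 0"
    using assms by (auto simp: rect_def mem_Times_iff field_simps)
  then show ?thesis by (auto simp: cutoff_def step_eq)
qed

section \<open>Cauchy integrals\<close>

text \<open>The argument c stands for the square of z. In the variable s = y^2 this is a Cauchy
  integral over the positive half-line, so it is holomorphic off that half-line and commutes with
  conjugation.\<close>

definition cauchy_int :: "(real \<Rightarrow> real) \<Rightarrow> complex \<Rightarrow> complex" where
  "cauchy_int w c = (\<integral>y. complex_of_real (w y) / (complex_of_real (y\<^sup>2) - c) \<partial>lborel)"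

text \<open>A mere distance d is upgraded to growth like 1 + y^2, uniformly for z near c; this is
  why integrability of w / (1 + y^2) suffices everywhere below. With e the distance of y^2 from c,
  the estimate 1 + y^2 \<le> 1 + \<bar>c\<bar> + e and d \<le> e give d (1 + y^2) \<le> e (d + 1 +
  \<bar>c\<bar>). Half of the resulting bound pays for moving from c to z.\<close>

lemma cauchy_denominator_bound:
  fixes c z :: complex
  assumes "0 < d" "d \<le> cmod (complex_of_real (y\<^sup>2) - c)"
    and "cmod (z - c) \<le> d / (d + 1 + cmod c) / 2"
  shows "d / (d + 1 + cmod c) / 2 * (1 + y\<^sup>2) \<le> cmod (complex_of_real (y\<^sup>2) - z)"
proof -
  define e where "e = cmod (complex_of_real (y\<^sup>2) - c)"
  define q where "q = d / (d + 1 + cmod c)"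
  have e: "d \<le> e" using assms(2) by (simp add: e_def)
  have D: "0 < d + 1 + cmod c" using assms(1) by (simp add: add_pos_nonneg)
  have q: "q > 0" using D assms(1) by (simp add: q_def)
  have "y\<^sup>2 = cmod (complex_of_real (y\<^sup>2))" by (simp only: norm_of_real) simp
  also have "\<dots> \<le> e + cmod c"
    unfolding e_def by (metis diff_add_cancel norm_triangle_ineq)
  finally have "1 + y\<^sup>2 \<le> (1 + cmod c) * 1 + e" by simp
  moreover have "(1 + cmod c) * d \<le> (1 + cmod c) * e"
    using e by (intro mult_left_mono) auto
  ultimately have "d * (1 + y\<^sup>2) \<le> e * (d + 1 + cmod c)"
    using mult_left_mono[of "1 + y\<^sup>2" "(1 + cmod c) * 1 + e" d] assms(1) by (simp add: algebra_simps)
  then have *: "q * (1 + y\<^sup>2) \<le> e"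
    using D by (simp add: q_def field_simps)
  have "cmod (z - c) \<le> q / 2" using assms(3) by (simp add: q_def)
  also have "\<dots> \<le> q / 2 * (1 + y\<^sup>2)" using q by simp
  finally have "cmod (z - c) \<le> q / 2 * (1 + y\<^sup>2)" .
  moreover have "e \<le> cmod (complex_of_real (y\<^sup>2) - z) + cmod (z - c)"
    unfolding e_def by (metis diff_add_cancel add_diff_eq norm_triangle_ineq)
  ultimately show ?thesis
    using * unfolding q_def[symmetric] by (simp add: algebra_simps)
qed

lemma cauchy_int_integrable:
  assumes [measurable]: "w \<in> borel_measurable borel"
    and int: "integrable lborel (\<lambda>y. w y / (1 + y\<^sup>2))"
    and "0 < d" "\<And>y. w y \<noteq> 0 \<Longrightarrow> d \<le> cmod (complex_of_real (y\<^sup>2) - c)"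
  shows "integrable lborel (\<lambda>y. complex_of_real (w y) / (complex_of_real (y\<^sup>2) - c))"
proof -
  define q where "q = d / (d + 1 + cmod c) / 2"
  have q: "q > 0" using assms(3) by (auto simp: q_def add_pos_nonneg intro!: divide_pos_pos)
  show ?thesis
  proof (rule Bochner_Integration.integrable_bound[OF integrable_mult_right[OF int, of "1 / q"]])
    show "AE y in lborel. norm (complex_of_real (w y) / (complex_of_real (y\<^sup>2) - c))
        \<le> norm (1 / q * (w y / (1 + y\<^sup>2)))"
    proof (rule AE_I2)
      fix y
      show "norm (complex_of_real (w y) / (complex_of_real (y\<^sup>2) - c))
        \<le> norm (1 / q * (w y / (1 + y\<^sup>2)))"
      proof (cases "w y = 0")
        case False
        have "q * (1 + y\<^sup>2) \<le> cmod (complex_of_real (y\<^sup>2) - c)"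
          unfolding q_def by (rule cauchy_denominator_bound) (use assms(3) assms(4)[OF False] in auto)
        moreover have "0 < q * (1 + y\<^sup>2)" using q by (simp add: add_pos_nonneg)
        ultimately have "\<bar>w y\<bar> / cmod (complex_of_real (y\<^sup>2) - c) \<le> \<bar>w y\<bar> / (q * (1 + y\<^sup>2))"
          by (intro divide_left_mono) (auto intro!: mult_pos_pos)
        then show ?thesis using q by (simp add: norm_divide abs_mult add_nonneg_nonneg)
      qed simp
    qed
  qed simp
qed

text \<open>The distance condition is imposed only where w is nonzero. This admits points c on the
  positive half-line that stay away from the squares of the support, which is how the far part of a
  boundary limit is treated.\<close>

lemma cauchy_int_has_field_derivative:
  assumes [measurable]: "w \<in> borel_measurable borel"
    and int: "integrable lborel (\<lambda>y. w y / (1 + y\<^sup>2))"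
    and d: "0 < d" "\<And>y. w y \<noteq> 0 \<Longrightarrow> d \<le> cmod (complex_of_real (y\<^sup>2) - c)"
  shows "(cauchy_int w has_field_derivative
    (\<integral>y. complex_of_real (w y) / (complex_of_real (y\<^sup>2) - c)\<^sup>2 \<partial>lborel)) (at c)"
    (is "(_ has_field_derivative ?D) _")
proof -
  define q where "q = d / (d + 1 + cmod c) / 2"
  have q: "q > 0" using d(1) by (auto simp: q_def add_pos_nonneg intro!: divide_pos_pos)
  define N where "N z y = complex_of_real (y\<^sup>2) - z" for z y
  have [measurable]: "N z \<in> borel_measurable borel" for z unfolding N_def by measurable
  have lb: "q * (1 + y\<^sup>2) \<le> cmod (N z y)" if "cmod (z - c) \<le> q" "w y \<noteq> 0" for z y
    unfolding q_def N_def by (rule cauchy_denominator_bound) (use d(1) d(2)[OF that(2)] that q_def in auto)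
  have pos: "0 < q * (1 + y\<^sup>2)" for y using q by (simp add: add_pos_nonneg)
  have bound: "\<bar>w y\<bar> / cmod (N c y) ^ m / cmod (N z y) \<le> \<bar>w y\<bar> / (1 + y\<^sup>2) / q ^ Suc m"
    if "cmod (z - c) \<le> q" for m z y
  proof (cases "w y = 0")
    case False
    note 1 = lb[of c y] lb[OF that False]
    have p: "0 < cmod (N c y)" "0 < cmod (N z y)"
      using 1 pos[of y] False q by auto
    have "(q * (1 + y\<^sup>2)) ^ m * (q * (1 + y\<^sup>2)) \<le> cmod (N c y) ^ m * cmod (N z y)"
      using 1 pos[of y] False q by (intro mult_mono power_mono) auto
    \<comment> \<open>One factor 1 + y^2 is kept for integrability; the others are at least 1 and
      are dropped.\<close>
    moreover have "q ^ Suc m * (1 + y\<^sup>2) \<le> (q * (1 + y\<^sup>2)) ^ m * (q * (1 + y\<^sup>2))"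
    proof -
      have "q ^ Suc m * (1 + y\<^sup>2) * 1 \<le> q ^ Suc m * (1 + y\<^sup>2) * (1 + y\<^sup>2) ^ m"
        using q by (intro mult_left_mono one_le_power) auto
      then show ?thesis by (simp add: power_mult_distrib mult_ac)
    qed
    ultimately have "q ^ Suc m * (1 + y\<^sup>2) \<le> cmod (N c y) ^ m * cmod (N z y)" by linarith
    moreover have "0 < q ^ Suc m * (1 + y\<^sup>2)" using q by (simp add: add_pos_nonneg)
    ultimately have "\<bar>w y\<bar> / (cmod (N c y) ^ m * cmod (N z y)) \<le> \<bar>w y\<bar> / (q ^ Suc m * (1 + y\<^sup>2))"
      using p q by (intro divide_left_mono mult_pos_pos zero_less_power) (auto intro: add_pos_nonneg)
    then show ?thesis by (simp add: mult_ac)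
  qed simp
  have intb: "integrable lborel (\<lambda>y. complex_of_real (w y) / N c y ^ m / N z y)"
    if "cmod (z - c) \<le> q" for m z
  proof (rule Bochner_Integration.integrable_bound[OF integrable_divide[OF integrable_abs[OF int], of "q ^ Suc m"]])
    show "AE y in lborel. norm (complex_of_real (w y) / N c y ^ m / N z y)
        \<le> norm (\<bar>w y / (1 + y\<^sup>2)\<bar> / q ^ Suc m)"
      using bound[OF that, of _ m] q by (intro AE_I2) (simp add: norm_divide norm_mult norm_power abs_mult add_nonneg_nonneg)
  qed measurable
  define I where "I = (\<integral>y. \<bar>w y\<bar> / (1 + y\<^sup>2) \<partial>lborel)"
  have intI: "integrable lborel (\<lambda>y. \<bar>w y\<bar> / (1 + y\<^sup>2))"
    using integrable_abs[OF int] by (simp add: abs_divide add_nonneg_nonneg)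
  have est: "cmod ((cauchy_int w (c + h) - cauchy_int w c) / h - ?D) \<le> cmod h * (I / q ^ 3)"
    if h: "h \<noteq> 0" "cmod h \<le> q" for h
  proof -
    have hc: "cmod (c + h - c) \<le> q" "cmod (c - c) \<le> q" using h q by auto
    have "(cauchy_int w (c + h) - cauchy_int w c) / h - ?D
      = (\<integral>y. (complex_of_real (w y) / N (c + h) y - complex_of_real (w y) / N c y) / h
          - complex_of_real (w y) / (N c y)\<^sup>2 \<partial>lborel)"
      using intb[OF hc(1), of 0] intb[OF hc(2), of 0] intb[OF hc(2), of 1]
      by (simp add: cauchy_int_def N_def[abs_def] power2_eq_square)
    \<comment> \<open>By the resolvent identity, used twice, the error of the difference quotient is
      h times an integral that is bounded uniformly in h.\<close>
    also have "\<dots> = (\<integral>y. h * (complex_of_real (w y) / N c y ^ 2 / N (c + h) y) \<partial>lborel)"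
    proof (rule Bochner_Integration.integral_cong[OF refl])
      fix y
      show "(complex_of_real (w y) / N (c + h) y - complex_of_real (w y) / N c y) / h
          - complex_of_real (w y) / (N c y)\<^sup>2 = h * (complex_of_real (w y) / N c y ^ 2 / N (c + h) y)"
      proof (cases "w y = 0")
        case False
        have nz: "N c y \<noteq> 0" "N (c + h) y \<noteq> 0"
          using lb[OF hc(1) False] lb[OF hc(2) False] pos[of y] by auto
        have hN: "N c y - N (c + h) y = h" by (simp add: N_def)
        have "W / A - W / C = W / (A * C) * (C - A)" "W / (A * C) - W / C\<^sup>2 = (C - A) * (W / C ^ 2 / A)"
          if "A \<noteq> 0" "C \<noteq> 0" for A C W :: complex
          using that by (simp_all add: field_simps power2_eq_square)
        from this[of "N (c + h) y" "N c y"] nz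
        have "complex_of_real (w y) / N (c + h) y - complex_of_real (w y) / N c y
            = complex_of_real (w y) / (N (c + h) y * N c y) * h"
          "complex_of_real (w y) / (N (c + h) y * N c y) - complex_of_real (w y) / (N c y)\<^sup>2
            = h * (complex_of_real (w y) / N c y ^ 2 / N (c + h) y)"
          unfolding hN by blast+
        then show ?thesis using h(1) by simp
      qed simp
    qed
    also have "cmod \<dots> \<le> (\<integral>y. cmod h * (\<bar>w y\<bar> / (1 + y\<^sup>2) / q ^ 3) \<partial>lborel)"
    proof (rule Bochner_Integration.integral_norm_bound_integral)
      show "integrable lborel (\<lambda>y. h * (complex_of_real (w y) / N c y ^ 2 / N (c + h) y))"
        by (intro integrable_mult_right intb hc)
      show "integrable lborel (\<lambda>y. cmod h * (\<bar>w y\<bar> / (1 + y\<^sup>2) / q ^ 3))"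
        by (intro integrable_mult_right integrable_divide intI)
      show "cmod (h * (complex_of_real (w y) / N c y ^ 2 / N (c + h) y))
          \<le> cmod h * (\<bar>w y\<bar> / (1 + y\<^sup>2) / q ^ 3)" for y
        using mult_left_mono[OF bound[OF hc(1), of y 2], of "cmod h"]
        by (simp add: norm_mult norm_divide norm_power numeral_3_eq_3)
    qed
    also have "\<dots> = cmod h * (I / q ^ 3)"
    proof -
      have "(\<lambda>y. cmod h * (\<bar>w y\<bar> / (1 + y\<^sup>2) / q ^ 3)) = (\<lambda>y. (cmod h / q ^ 3) * (\<bar>w y\<bar> / (1 + y\<^sup>2)))"
        by (simp add: mult.commute)
      then show ?thesis using q by (simp only: I_def integral_mult_right_zero) simp
    qed
    finally show ?thesis .
  qed
  have "((\<lambda>h. (cauchy_int w (c + h) - cauchy_int w c) / h - ?D) \<longlongrightarrow> 0) (at 0)"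
  proof (rule Lim_null_comparison)
    show "\<forall>\<^sub>F h in at 0. cmod ((cauchy_int w (c + h) - cauchy_int w c) / h - ?D) \<le> cmod h * (I / q ^ 3)"
      unfolding eventually_at using est q by (intro exI[of _ q]) (auto simp: dist_norm)
    show "((\<lambda>h::complex. cmod h * (I / q ^ 3)) \<longlongrightarrow> 0) (at 0)"
      using q by (auto intro!: tendsto_eq_intros)
  qed
  then show ?thesis
    unfolding DERIV_def by (rule Lim_null[THEN iffD2])
qed

lemma nonneg_real_distance:
  assumes "c \<notin> \<real>\<^sub>\<ge>\<^sub>0"
  obtains d where "0 < d" "\<And>y::real. d \<le> cmod (complex_of_real (y\<^sup>2) - c)"
proof (cases "Im c = 0")
  case False
  show ?thesis
  proof (rule that)
    show "0 < \<bar>Im c\<bar>" using False by simp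
    show "\<bar>Im c\<bar> \<le> cmod (complex_of_real (y\<^sup>2) - c)" for y
      using abs_Im_le_cmod[of "complex_of_real (y\<^sup>2) - c"] by simp
  qed
next
  case True
  then have "Re c < 0" using assms by (auto simp: complex_nonneg_Reals_iff)
  show ?thesis
  proof (rule that)
    show "0 < - Re c" using \<open>Re c < 0\<close> by simp
    show "- Re c \<le> cmod (complex_of_real (y\<^sup>2) - c)" for y
      using abs_Re_le_cmod[of "complex_of_real (y\<^sup>2) - c"] \<open>Re c < 0\<close> zero_le_power2[of y]
      unfolding minus_complex.sel Re_complex_of_real by linarith
  qed
qed

lemma square_notin_nonneg_Reals: "0 < Im z \<Longrightarrow> z\<^sup>2 \<notin> \<real>\<^sub>\<ge>\<^sub>0"
  by (auto simp: complex_nonneg_Reals_iff power2_eq_square) (smt (verit) mult_eq_0_iff mult_pos_pos)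

lemma cauchy_int_holomorphic:
  assumes "w \<in> borel_measurable borel" "integrable lborel (\<lambda>y. w y / (1 + y\<^sup>2))"
  shows "cauchy_int w holomorphic_on (- \<real>\<^sub>\<ge>\<^sub>0)"
proof (rule holomorphic_onI)
  fix c :: complex assume "c \<in> - \<real>\<^sub>\<ge>\<^sub>0"
  then obtain d where "0 < d" "\<And>y::real. d \<le> cmod (complex_of_real (y\<^sup>2) - c)"
    using nonneg_real_distance[of c] by auto
  from cauchy_int_has_field_derivative[OF assms this]
  show "cauchy_int w field_differentiable at c within - \<real>\<^sub>\<ge>\<^sub>0"
    by (meson field_differentiable_def has_field_derivative_at_within)
qed

abbreviation upper_halfplane :: "complex set" where
  "upper_halfplane \<equiv> {z. 0 < Im z}"

lemma open_upper_halfplane: "open upper_halfplane"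
  by (rule open_halfspace_Im_gt)

lemma cauchy_int_square_holomorphic:
  assumes "w \<in> borel_measurable borel" "integrable lborel (\<lambda>y. w y / (1 + y\<^sup>2))"
  shows "(\<lambda>z. cauchy_int w (z\<^sup>2)) holomorphic_on upper_halfplane"
proof -
  have "(\<lambda>z::complex. z\<^sup>2) holomorphic_on upper_halfplane"
    by (intro holomorphic_intros)
  from holomorphic_on_compose_gen[OF this cauchy_int_holomorphic[OF assms]]
  show ?thesis
    using square_notin_nonneg_Reals by (auto simp: o_def)
qed

lemma cauchy_int_cnj: "cauchy_int w (cnj c) = cnj (cauchy_int w c)"
  unfolding cauchy_int_def by (simp flip: Bochner_Integration.integral_cnj)

section \<open>The total mass of the even kernel\<close>

lemma Beta_complementary:
  fixes a :: real
  assumes "0 < a" "a < 1"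
  shows "Beta a (1 - a) = pi / sin (pi * a)"
proof -
  have "Gamma (complex_of_real a) * Gamma (1 - complex_of_real a) = of_real pi / sin (of_real pi * of_real a)"
    by (rule Gamma_reflection_complex)
  moreover have "1 - complex_of_real a = complex_of_real (1 - a)"
    "sin (of_real pi * complex_of_real a) = complex_of_real (sin (pi * a))"
    by (simp_all only: of_real_diff of_real_1 sin_of_real of_real_mult[symmetric])
  ultimately have "complex_of_real (Gamma a * Gamma (1 - a)) = complex_of_real (pi / sin (pi * a))"
    by (simp only: Gamma_complex_of_real of_real_mult of_real_divide)
  then have "Gamma a * Gamma (1 - a) = pi / sin (pi * a)"
    by (simp only: of_real_eq_iff)
  then show ?thesis by (simp add: Beta_def)
qed

text \<open>The substitution t = y^2 / (1 + y^2) maps the half-line onto the unit interval and gives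
  half of a Beta integral with arguments (1 - \<alpha>) / 2 and (1 + \<alpha>) / 2. They add up to
  1, so the reflection formula turns it into a cosine.\<close>

lemma half_line_weight:
  fixes \<alpha> :: real
  assumes "-1 < \<alpha>" "\<alpha> < 1"
  shows "has_bochner_integral lborel (\<lambda>y. indicator {0<..} y * (\<bar>y\<bar> powr (- \<alpha>) / (1 + y\<^sup>2)))
    (pi / (2 * cos (pi * \<alpha> / 2)))"
proof -
  define a b where "a = (1 - \<alpha>) / 2" and "b = (1 + \<alpha>) / 2"
  have ab: "0 < a" "a < 1" "0 < b" "b = 1 - a" using assms by (auto simp: a_def b_def field_simps)
  define f where "f t = t powr (a - 1) * (1 - t) powr (b - 1)" for t :: real
  define g where "g y = y\<^sup>2 / (1 + y\<^sup>2)" for y :: real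
  define g' where "g' y = 2 * y / (1 + y\<^sup>2)\<^sup>2" for y :: real
  have nz: "1 + y\<^sup>2 \<noteq> 0" "0 < 1 + y\<^sup>2" for y :: real
    using zero_le_power2[of y] by linarith+
  have f_int: "(f has_integral Beta a b) {0<..<1}"
    using has_integral_Beta_real[of a b] ab by (simp add: has_integral_Icc_iff_Ioo f_def[abs_def])
  have "f absolutely_integrable_on {0<..<1}"
    by (rule nonnegative_absolutely_integrable_1) (use f_int in \<open>auto simp: f_def has_integral_integrable\<close>)
  moreover have "g ` {0<..} = {0<..<1}"
  proof (intro equalityI subsetI)
    fix t assume "t \<in> g ` {0<..}"
    then show "t \<in> {0<..<1}" by (auto simp: g_def nz field_simps intro!: divide_pos_pos)
  next
    fix t :: real assume t: "t \<in> {0<..<1}"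
    define y where "y = sqrt (t / (1 - t))"
    have "y\<^sup>2 = t / (1 - t)" "0 < y" using t by (auto simp: y_def)
    then have "t * (1 + y\<^sup>2) = y\<^sup>2" using t by (simp add: field_simps)
    then have "t = g y" using nz(1)[of y] by (simp add: g_def eq_divide_eq)
    then show "t \<in> g ` {0<..}" using \<open>0 < y\<close> by auto
  qed
  ultimately have *: "f absolutely_integrable_on (g ` {0<..}) \<and> integral (g ` {0<..}) f = Beta a b"
    using f_int by auto
  have der: "(g has_field_derivative g' y) (at y within {0<..})" for y
    unfolding g_def[abs_def] g'_def
    using nz by (auto intro!: derivative_eq_intros simp: power2_eq_square field_simps)
  have inj: "inj_on g {0<..}"
  proof (rule inj_onI)
    fix y z :: real assume yz: "y \<in> {0<..}" "z \<in> {0<..}" "g y = g z"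
    have "y\<^sup>2 = z\<^sup>2" using yz(3) nz[of y] nz[of z] by (simp add: g_def field_simps)
    then show "y = z" using yz(1,2) by (simp add: power2_eq_iff_nonneg)
  qed
  have eq: "\<bar>g' y\<bar> * f (g y) = 2 * (\<bar>y\<bar> powr (- \<alpha>) / (1 + y\<^sup>2))" if "y \<in> {0<..}" for y
  proof -
    define s where "s = 1 + y\<^sup>2"
    have y: "0 < y" "0 < s" using that nz by (auto simp: s_def)
    have "1 - g y = 1 / s" using y by (simp add: g_def s_def[symmetric] field_simps)
    then have "f (g y) = (y\<^sup>2 / s) powr (a - 1) * (1 / s) powr (b - 1)"
      by (simp add: f_def g_def s_def)
    also have "(y\<^sup>2 / s) powr (a - 1) = y powr (2 * (a - 1)) / s powr (a - 1)"
      using y by (simp add: powr_divide powr_powr flip: powr_numeral)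
    also have "(1 / s) powr (b - 1) = s powr (1 - b)"
      using y by (simp add: powr_divide powr_minus_divide[of s "b - 1", symmetric])
    also have "s powr (1 - b) = s * s powr (a - 1)"
      using y ab(4) by (simp add: powr_diff)
    also have "y powr (2 * (a - 1)) = y powr (- \<alpha>) / y"
    proof -
      have "2 * (a - 1) = - \<alpha> - 1" by (simp add: a_def field_simps)
      then show ?thesis using y by (simp only: powr_diff) simp
    qed
    finally have "f (g y) = y powr (- \<alpha>) / y * s"
      using y by simp
    then show ?thesis
      using y by (simp add: g'_def flip: s_def) (simp add: power2_eq_square)
  qed
  have "(\<lambda>y. \<bar>g' y\<bar> * f (g y)) absolutely_integrable_on {0<..} \<and>
      integral {0<..} (\<lambda>y. \<bar>g' y\<bar> * f (g y)) = Beta a b"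
    using * by (subst has_absolute_integral_change_of_variables_1'[OF _ der inj]) auto
  then have ai: "(\<lambda>y. 2 * (\<bar>y\<bar> powr (- \<alpha>) / (1 + y\<^sup>2))) absolutely_integrable_on {0<..}"
    and I: "integral {0<..} (\<lambda>y. 2 * (\<bar>y\<bar> powr (- \<alpha>) / (1 + y\<^sup>2))) = Beta a b"
  proof -
    have "set_integrable lebesgue {0<..} (\<lambda>y. \<bar>g' y\<bar> * f (g y))
        \<longleftrightarrow> set_integrable lebesgue {0<..} (\<lambda>y. 2 * (\<bar>y\<bar> powr (- \<alpha>) / (1 + y\<^sup>2)))"
      by (rule set_integrable_cong) (use eq in auto)
    moreover have "integral {0<..} (\<lambda>y. \<bar>g' y\<bar> * f (g y)) = integral {0<..} (\<lambda>y. 2 * (\<bar>y\<bar> powr (- \<alpha>) / (1 + y\<^sup>2)))"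
      by (rule Henstock_Kurzweil_Integration.integral_cong) (use eq in auto)
    moreover assume "(\<lambda>y. \<bar>g' y\<bar> * f (g y)) absolutely_integrable_on {0<..} \<and>
      integral {0<..} (\<lambda>y. \<bar>g' y\<bar> * f (g y)) = Beta a b"
    ultimately show "(\<lambda>y. 2 * (\<bar>y\<bar> powr (- \<alpha>) / (1 + y\<^sup>2))) absolutely_integrable_on {0<..}"
      "integral {0<..} (\<lambda>y. 2 * (\<bar>y\<bar> powr (- \<alpha>) / (1 + y\<^sup>2))) = Beta a b"
      by simp_all
  qed
  have [measurable]: "(\<lambda>y. indicator {0<..} y *\<^sub>R (2 * (\<bar>y\<bar> powr (- \<alpha>) / (1 + y\<^sup>2))))
      \<in> borel_measurable lborel" by measurable
  have 1: "integrable lborel (\<lambda>y. indicator {0<..} y *\<^sub>R (2 * (\<bar>y\<bar> powr (- \<alpha>) / (1 + y\<^sup>2))))"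
    using ai by (simp add: set_integrable_def integrable_completion)
  have 2: "(\<integral>y. indicator {0<..} y *\<^sub>R (2 * (\<bar>y\<bar> powr (- \<alpha>) / (1 + y\<^sup>2))) \<partial>lborel) = Beta a b"
    using set_lebesgue_integral_eq_integral(2)[OF ai] I
    by (simp add: set_lebesgue_integral_def integral_completion)
  have "Beta a b = pi / cos (pi * \<alpha> / 2)"
    using Beta_complementary[OF ab(1,2)] ab(4)
    by (simp add: a_def cos_sin_eq algebra_simps diff_divide_distrib)
  then have "has_bochner_integral lborel (\<lambda>y. 1 / 2 * (indicator {0<..} y *\<^sub>R (2 * (\<bar>y\<bar> powr (- \<alpha>) / (1 + y\<^sup>2)))))
      (1 / 2 * (pi / cos (pi * \<alpha> / 2)))"
    using 1 2 by (intro has_bochner_integral_mult_right) (simp add: has_bochner_integral_iff)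
  then show ?thesis by (simp add: mult.assoc)
qed

lemma weight_integral:
  fixes \<alpha> :: real
  assumes "-1 < \<alpha>" "\<alpha> < 1"
  shows "has_bochner_integral lborel (\<lambda>y. \<bar>y\<bar> powr (- \<alpha>) / (1 + y\<^sup>2)) (pi / cos (pi * \<alpha> / 2))"
proof -
  let ?h = "\<lambda>y::real. indicator {0<..} y * (\<bar>y\<bar> powr (- \<alpha>) / (1 + y\<^sup>2))"
  note h = half_line_weight[OF assms]
  have h': "has_bochner_integral lborel (\<lambda>y. ?h (0 + (-1) * y)) (pi / (2 * cos (pi * \<alpha> / 2)))"
    using lborel_has_bochner_integral_real_affine_iff[of "-1" ?h _ 0] h by simp
  have "(\<lambda>y. \<bar>y\<bar> powr (- \<alpha>) / (1 + y\<^sup>2)) = (\<lambda>y. ?h y + ?h (0 + (-1) * y))"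
    by (auto simp: indicator_def fun_eq_iff)
  then show ?thesis
    using has_bochner_integral_add[OF h h'] by (simp add: field_simps)
qed

lemma weight_measurable [measurable]: "(\<lambda>y::real. \<bar>y\<bar> powr (- \<alpha>)) \<in> borel_measurable borel"
  by measurable

text \<open>The total mass of the even kernel: the expression \<open>even_part\<close> below, taken
  for the constant datum 1.\<close>

definition mass_fun :: "real \<Rightarrow> complex \<Rightarrow> complex" where
  "mass_fun \<alpha> z = z powr complex_of_real (\<alpha> + 1) * cauchy_int (\<lambda>y. \<bar>y\<bar> powr (- \<alpha>)) (z\<^sup>2)"

lemma powr_holomorphic_upper:
  "(\<lambda>z. z powr c) holomorphic_on upper_halfplane"
  by (auto intro!: holomorphic_intros simp: complex_nonpos_Reals_iff)

lemma mass_fun_holomorphic: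
  assumes "-1 < \<alpha>" "\<alpha> < 1"
  shows "mass_fun \<alpha> holomorphic_on upper_halfplane"
  unfolding mass_fun_def
  by (intro holomorphic_on_mult powr_holomorphic_upper cauchy_int_square_holomorphic)
    (use weight_integral[OF assms] in \<open>auto simp: has_bochner_integral_iff\<close>)

text \<open>Substituting r y for y produces \<open>r powr (- \<alpha>)\<close> from the weight, r
  from the measure and \<open>r\<^sup>2\<close> in the denominator; together they cancel
  \<open>r powr (\<alpha> + 1)\<close>.\<close>

lemma mass_fun_scale:
  assumes "0 < r"
  shows "mass_fun \<alpha> (complex_of_real r * z) = mass_fun \<alpha> z"
proof -
  let ?F = "\<lambda>c y. complex_of_real (\<bar>y\<bar> powr (- \<alpha>)) / (complex_of_real (y\<^sup>2) - c)"
  have "cauchy_int (\<lambda>y. \<bar>y\<bar> powr (- \<alpha>)) ((complex_of_real r * z)\<^sup>2)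
      = r *\<^sub>R (\<integral>y. ?F ((complex_of_real r * z)\<^sup>2) (0 + r * y) \<partial>lborel)"
    unfolding cauchy_int_def
    using lborel_integral_real_affine[of r "?F ((complex_of_real r * z)\<^sup>2)" 0] assms by simp
  also have "(\<lambda>y. ?F ((complex_of_real r * z)\<^sup>2) (0 + r * y))
      = (\<lambda>y. complex_of_real (r powr (- \<alpha>) / r\<^sup>2) * ?F (z\<^sup>2) y)"
  proof
    fix y
    have "complex_of_real ((0 + r * y)\<^sup>2) - (complex_of_real r * z)\<^sup>2
        = complex_of_real (r\<^sup>2) * (complex_of_real (y\<^sup>2) - z\<^sup>2)"
      by (simp add: power_mult_distrib algebra_simps)
    moreover have "\<bar>0 + r * y\<bar> powr (- \<alpha>) = r powr (- \<alpha>) * \<bar>y\<bar> powr (- \<alpha>)"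
      using assms by (simp add: abs_mult powr_mult)
    ultimately show "?F ((complex_of_real r * z)\<^sup>2) (0 + r * y) = complex_of_real (r powr (- \<alpha>) / r\<^sup>2) * ?F (z\<^sup>2) y"
      by simp
  qed
  finally have 0: "cauchy_int (\<lambda>y. \<bar>y\<bar> powr (- \<alpha>)) ((complex_of_real r * z)\<^sup>2)
      = r *\<^sub>R (\<integral>y. complex_of_real (r powr (- \<alpha>) / r\<^sup>2) * ?F (z\<^sup>2) y \<partial>lborel)" .
  have 1: "cauchy_int (\<lambda>y. \<bar>y\<bar> powr (- \<alpha>)) ((complex_of_real r * z)\<^sup>2)
      = complex_of_real (r powr (- \<alpha>) / r) * cauchy_int (\<lambda>y. \<bar>y\<bar> powr (- \<alpha>)) (z\<^sup>2)"
  proof -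
    note 0
    also have "\<dots> = complex_of_real (r * (r powr (- \<alpha>) / r\<^sup>2)) * (\<integral>y. ?F (z\<^sup>2) y \<partial>lborel)"
      by (simp only: integral_mult_right_zero scaleR_conv_of_real of_real_mult mult.assoc)
    also have "r * (r powr (- \<alpha>) / r\<^sup>2) = r powr (- \<alpha>) / r"
      using assms by (simp add: power2_eq_square)
    finally show ?thesis by (simp only: cauchy_int_def)
  qed
  have 2: "(complex_of_real r * z) powr complex_of_real (\<alpha> + 1)
      = complex_of_real (r powr (\<alpha> + 1)) * z powr complex_of_real (\<alpha> + 1)"
    using assms by (subst powr_times_real_left) (simp_all add: powr_of_real del: of_real_add)
  have "r powr (\<alpha> + 1) * (r powr (- \<alpha>) / r) = 1"
    using assms by (simp add: powr_add powr_minus)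
  then have 3: "complex_of_real (r powr (\<alpha> + 1)) * complex_of_real (r powr (- \<alpha>) / r) = 1"
    by (metis of_real_1 of_real_mult)
  show ?thesis
  proof -
    have e: "A * p * (B * q) = (A * B) * (p * q)" for A B p q :: complex by (simp only: mult_ac)
    show ?thesis unfolding mass_fun_def 1 2 by (subst e, subst 3) (rule mult_1)
  qed
qed

lemma i_powr: "\<i> powr complex_of_real (\<alpha> + 1) = Complex (- sin (pi * \<alpha> / 2)) (cos (pi * \<alpha> / 2))"
proof -
  have "\<i> powr complex_of_real (\<alpha> + 1) = exp (\<i> * complex_of_real ((\<alpha> + 1) * pi / 2))"
    by (simp add: powr_def Ln_ii algebra_simps)
  then have "\<i> powr complex_of_real (\<alpha> + 1) = cis ((\<alpha> + 1) * pi / 2)"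
    by (simp only: cis_conv_exp)
  moreover have "(\<alpha> + 1) * pi / 2 = pi / 2 + pi * \<alpha> / 2" by (simp add: field_simps)
  ultimately show ?thesis by (simp add: complex_eq_iff sin_add cos_add)
qed

text \<open>The integral is homogeneous of degree \<open>0\<close> and holomorphic, hence constant.\<close>

lemma Im_mass_fun:
  assumes "-1 < \<alpha>" "\<alpha> < 1" "0 < Im z"
  shows "Im (mass_fun \<alpha> z) = pi"
proof -
  have hol: "mass_fun \<alpha> holomorphic_on upper_halfplane" by (rule mass_fun_holomorphic[OF assms(1,2)])
  \<comment> \<open>The derivative along the ray through z is z times the complex derivative. It
    vanishes by homogeneity, hence so does the complex derivative.\<close>
  have d0: "(mass_fun \<alpha> has_field_derivative 0) (at z within upper_halfplane)" if "z \<in> upper_halfplane" for z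
  proof -
    have D: "(mass_fun \<alpha> has_field_derivative deriv (mass_fun \<alpha>) z) (at z)"
      by (rule holomorphic_derivI[OF hol open_upper_halfplane that])
    have e: "((\<lambda>r. complex_of_real r * z) has_vector_derivative z) (at 1)"
      by (auto intro!: derivative_eq_intros simp: has_vector_derivative_def scaleR_conv_of_real)
    have "((\<lambda>r. mass_fun \<alpha> (complex_of_real r * z)) has_vector_derivative z * deriv (mass_fun \<alpha>) z) (at 1)"
      using field_vector_diff_chain_at[OF e, of "mass_fun \<alpha>"] D by (simp add: o_def)
    moreover have "((\<lambda>r. mass_fun \<alpha> (complex_of_real r * z)) has_vector_derivative 0) (at 1)"
      by (rule has_vector_derivative_transform_within_open[where S = "{0<..}" and f = "\<lambda>_. mass_fun \<alpha> z"])
        (auto simp: mass_fun_scale)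
    ultimately have "z * deriv (mass_fun \<alpha>) z = 0"
      by (rule vector_derivative_unique_at)
    moreover have "z \<noteq> 0" using that by auto
    ultimately show ?thesis using D by (simp add: has_field_derivative_at_within)
  qed
  obtain c where c: "\<And>z. z \<in> upper_halfplane \<Longrightarrow> mass_fun \<alpha> z = c"
    using has_field_derivative_zero_constant[OF convex_halfspace_Im_gt d0] by blast
  \<comment> \<open>The constant is read off at z = i, where the denominator becomes 1 + y^2. The
    cosine in the weight integral cancels against the imaginary part of the power of i, leaving
    pi.\<close>
  have "cauchy_int (\<lambda>y. \<bar>y\<bar> powr (- \<alpha>)) (\<i>\<^sup>2) = complex_of_real (pi / cos (pi * \<alpha> / 2))"
  proof -
    have "cauchy_int (\<lambda>y. \<bar>y\<bar> powr (- \<alpha>)) (\<i>\<^sup>2)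
        = (\<integral>y. complex_of_real (\<bar>y\<bar> powr (- \<alpha>) / (1 + y\<^sup>2)) \<partial>lborel)"
      unfolding cauchy_int_def by (simp add: add.commute)
    also have "\<dots> = complex_of_real (pi / cos (pi * \<alpha> / 2))"
      using weight_integral[OF assms(1,2)] unfolding has_bochner_integral_iff
      by (simp only: integral_complex_of_real)
    finally show ?thesis .
  qed
  moreover have "Im (\<i> powr complex_of_real (\<alpha> + 1)) = cos (pi * \<alpha> / 2)"
    by (simp only: i_powr complex.sel)
  moreover have "cos (pi * \<alpha> / 2) > 0"
    using mult_strict_left_mono[OF assms(1) pi_gt_zero] mult_strict_left_mono[OF assms(2) pi_gt_zero]
    by (intro cos_gt_zero_pi) auto
  ultimately have "Im (mass_fun \<alpha> \<i>) = pi"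
    by (simp add: mass_fun_def del: of_real_divide of_real_add)
  then show ?thesis using c[of z] c[of \<i>] assms(3) by simp
qed

section \<open>Boundary values\<close>

lemma Im_of_real_mult: "Im (complex_of_real c * w) = c * Im w"
  by simp

text \<open>With r and \<theta> the modulus and argument of z, multiplication by the conjugate
  denominator leaves two terms: y^2 r^(\<alpha> + 1) sin ((\<alpha> + 1) \<theta>) and r^(\<alpha> +
  3) sin ((1 - \<alpha>) \<theta>). Both angles lie in [0, pi] because \<theta> \<le> pi / 2 in the
  closed right quadrant and -1 < \<alpha> < 1.\<close>

lemma Im_kernel_nonneg:
  assumes "-1 < \<alpha>" "\<alpha> < 1" "0 \<le> Re z" "0 < Im z"
  shows "0 \<le> Im (z powr complex_of_real (\<alpha> + 1) / (complex_of_real (y\<^sup>2) - z\<^sup>2))"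
proof -
  define L where "L = Ln z"
  define s where "s = complex_of_real (\<alpha> + 1)"
  have z0: "z \<noteq> 0" using assms by auto
  have zL: "z = exp L" using z0 by (simp add: L_def)
  have th: "0 < Im L" "Im L \<le> pi / 2"
    using Im_Ln_pos_lt[OF z0] Re_Ln_pos_le[OF z0] assms by (auto simp: L_def)
  have "(\<alpha> + 1) * Im L \<le> 2 * (pi / 2)" "(1 - \<alpha>) * Im L \<le> 2 * (pi / 2)"
    using assms th by (intro mult_mono; simp)+
  then have b: "0 \<le> (\<alpha> + 1) * Im L" "(\<alpha> + 1) * Im L \<le> pi" "0 \<le> (1 - \<alpha>) * Im L" "(1 - \<alpha>) * Im L \<le> pi"
    using assms th by auto
  have "z powr s * (complex_of_real (y\<^sup>2) - cnj (z\<^sup>2))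
      = complex_of_real (y\<^sup>2) * exp (s * L) - exp (s * L + 2 * cnj L)"
  proof -
    have "z powr s = exp (s * L)" using z0 by (simp add: powr_def L_def)
    moreover have "cnj (z\<^sup>2) = exp (2 * cnj L)" by (simp add: zL exp_cnj exp_double)
    ultimately show ?thesis by (simp only: exp_add right_diff_distrib mult.commute)
  qed
  then have "Im (z powr s * (complex_of_real (y\<^sup>2) - cnj (z\<^sup>2)))
      = y\<^sup>2 * (exp (Re (s * L)) * sin (Im (s * L))) - exp (Re (s * L + 2 * cnj L)) * sin (Im (s * L + 2 * cnj L))"
    by (simp only: minus_complex.sel Im_exp Im_of_real_mult)
  also have "Im (s * L) = (\<alpha> + 1) * Im L" by (simp add: s_def)
  also have "Im (s * L + 2 * cnj L) = - ((1 - \<alpha>) * Im L)" by (simp add: s_def algebra_simps)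
  also have "sin (- ((1 - \<alpha>) * Im L)) = - sin ((1 - \<alpha>) * Im L)" by simp
  finally have "0 \<le> Im (z powr s * (complex_of_real (y\<^sup>2) - cnj (z\<^sup>2)))"
    using sin_ge_zero[OF b(1,2)] sin_ge_zero[OF b(3,4)] by simp
  then have "0 \<le> Im (z powr s * cnj (complex_of_real (y\<^sup>2) - z\<^sup>2)) / (cmod (complex_of_real (y\<^sup>2) - z\<^sup>2))\<^sup>2"
    by simp
  then show ?thesis
    unfolding s_def[symmetric] complex_div_cnj[of "z powr s"]
    by (simp only: Im_divide_of_real flip: of_real_power)
qed

text \<open>The kernel is even in y, so only the even part of the datum contributes; it is
  holomorphic in z, although the solution takes it at \<open>\<bar>x\<bar> + i t\<close>.\<close>

definition even_part :: "real \<Rightarrow> (real \<Rightarrow> real) \<Rightarrow> complex \<Rightarrow> complex" where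
  "even_part \<alpha> v z = z powr complex_of_real (\<alpha> + 1) * cauchy_int (\<lambda>y. \<bar>y\<bar> powr (- \<alpha>) * v y) (z\<^sup>2)"

text \<open>The kernel y / (y^2 - z^2) is odd in y and sees only the odd part of the datum.\<close>

definition odd_part :: "(real \<Rightarrow> real) \<Rightarrow> complex \<Rightarrow> complex" where
  "odd_part v z = cauchy_int (\<lambda>y. y * v y) (z\<^sup>2)"

lemma weight_times_integrable:
  fixes v :: "real \<Rightarrow> real"
  assumes "-1 < \<alpha>" "\<alpha> < 1" and [measurable]: "v \<in> borel_measurable borel" and "\<And>y. \<bar>v y\<bar> \<le> B"
  shows "integrable lborel (\<lambda>y. \<bar>y\<bar> powr (- \<alpha>) * v y / (1 + y\<^sup>2))"
proof (rule Bochner_Integration.integrable_bound)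
  show "integrable lborel (\<lambda>y. B * (\<bar>y\<bar> powr (- \<alpha>) / (1 + y\<^sup>2)))"
    using weight_integral[OF assms(1,2)] by (intro integrable_mult_right) (simp add: has_bochner_integral_iff)
  have "0 \<le> B" using assms(4)[of 0] by linarith
  then show "AE y in lborel. norm (\<bar>y\<bar> powr (- \<alpha>) * v y / (1 + y\<^sup>2)) \<le> norm (B * (\<bar>y\<bar> powr (- \<alpha>) / (1 + y\<^sup>2)))"
    using assms(4) by (intro AE_I2) (auto simp: abs_mult add_nonneg_nonneg intro!: divide_right_mono mult_right_mono
        simp: mult.commute[of "_ powr _"])
qed measurable

lemma cauchy_int_add:
  assumes "w1 \<in> borel_measurable borel" "integrable lborel (\<lambda>y. w1 y / (1 + y\<^sup>2))"
    and "w2 \<in> borel_measurable borel" "integrable lborel (\<lambda>y. w2 y / (1 + y\<^sup>2))" and "c \<notin> \<real>\<^sub>\<ge>\<^sub>0"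
  shows "cauchy_int (\<lambda>y. w1 y + w2 y) c = cauchy_int w1 c + cauchy_int w2 c"
proof -
  obtain d where d: "0 < d" "\<And>y::real. d \<le> cmod (complex_of_real (y\<^sup>2) - c)"
    using nonneg_real_distance[OF assms(5)] by blast
  show ?thesis
    using cauchy_int_integrable[OF assms(1,2) d] cauchy_int_integrable[OF assms(3,4) d]
    by (simp add: cauchy_int_def add_divide_distrib)
qed

lemma cauchy_int_cmult: "cauchy_int (\<lambda>y. a * w y) c = of_real a * cauchy_int w c"
  by (simp add: cauchy_int_def flip: times_divide_eq_right)

lemma cauchy_int_reflect: "cauchy_int (\<lambda>y. w (- y)) c = cauchy_int w c"
  unfolding cauchy_int_def
  using lborel_integral_real_affine[of "-1" "\<lambda>y. complex_of_real (w y) / (complex_of_real (y\<^sup>2) - c)" 0]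
  by simp

lemma norm_powr_of_real: "z \<noteq> 0 \<Longrightarrow> cmod (z powr complex_of_real s) = cmod z powr s"
  by (simp add: powr_def)

abbreviation quadrant :: "complex set" where
  "quadrant \<equiv> {z. 0 \<le> Re z \<and> 0 < Im z}"

text \<open>The point 0 lies on the branch cut, where the continuity rule for complex powers does
  not apply; there the positive exponent forces the limit through the modulus alone.\<close>

lemma powr_tendsto_boundary:
  assumes "0 \<le> x0" "0 < s"
  shows "((\<lambda>z. z powr complex_of_real s) \<longlongrightarrow> complex_of_real (x0 powr s)) (at (complex_of_real x0) within quadrant)"
proof (cases "x0 = 0")
  case True
  have "((\<lambda>z::complex. cmod z powr s) \<longlongrightarrow> cmod 0 powr s) (at 0 within quadrant)"
    using assms(2) by (intro tendsto_powr' tendsto_intros) auto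
  moreover have "\<forall>\<^sub>F z in at 0 within quadrant. cmod z powr s = cmod (z powr complex_of_real s)"
    by (auto simp: eventually_at_filter norm_powr_of_real)
  ultimately have "((\<lambda>z. cmod (z powr complex_of_real s)) \<longlongrightarrow> 0) (at 0 within quadrant)"
    by (auto intro: Lim_transform_eventually)
  then show ?thesis using True by (simp add: tendsto_norm_zero_iff)
next
  case False
  then have "((\<lambda>z. z powr complex_of_real s) \<longlongrightarrow> complex_of_real x0 powr complex_of_real s)
      (at (complex_of_real x0) within quadrant)"
    using assms by (intro tendsto_powr_complex tendsto_intros) (auto simp: complex_nonpos_Reals_iff)
  then show ?thesis using assms by (simp add: powr_of_real)
qed

text \<open>An approximate identity argument in which the mass is exactly pi, so that
  \<open>pi * v x0\<close> splits off without error. Near x0 the positive kernel integrates an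
  oscillation of at most e' to at most e' pi. Away from x0 the Cauchy integral extends continuously
  to the boundary point and is real there, so its imaginary contribution tends to 0.\<close>

lemma Im_even_part_tendsto:
  fixes v :: "real \<Rightarrow> real"
  assumes \<alpha>: "-1 < \<alpha>" "\<alpha> < 1" and x0: "0 \<le> x0"
    and cont: "continuous_on UNIV v" and even: "\<And>y. v (- y) = v y" and B: "\<And>y. \<bar>v y\<bar> \<le> B"
  shows "((\<lambda>z. Im (even_part \<alpha> v z)) \<longlongrightarrow> pi * v x0) (at (complex_of_real x0) within quadrant)"
proof (rule tendstoI)
  fix e :: real assume "0 < e"
  define e' where "e' = e / (2 * pi)"
  have e': "0 < e'" "e' * pi = e / 2" using \<open>0 < e\<close> by (auto simp: e'_def)
  have [measurable]: "v \<in> borel_measurable borel" by (rule borel_measurable_continuous_onI[OF cont])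
  have "isCont v x0" using cont by (simp add: continuous_on_eq_continuous_at)
  then obtain h where h: "0 < h" "\<And>y. \<bar>y - x0\<bar> < h \<Longrightarrow> \<bar>v y - v x0\<bar> < e'"
    using e'(1) unfolding continuous_at_eps_delta dist_real_def by metis
  have vabs: "v \<bar>y\<bar> = v y" for y using even[of y] by (cases "0 \<le> y") auto
  \<comment> \<open>The kernel concentrates at both x0 and -x0, so the near set is symmetric.
    Evenness of v makes v y - v x0 small on all of it.\<close>
  define S where "S = {y. \<bar>\<bar>y\<bar> - x0\<bar> < h}"
  have [measurable]: "S \<in> sets borel" unfolding S_def by measurable
  define w1 where "w1 y = \<bar>y\<bar> powr (- \<alpha>) * (indicator S y * (v y - v x0))" for y
  define w2 where "w2 y = \<bar>y\<bar> powr (- \<alpha>) * (indicator (- S) y * (v y - v x0))" for y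
  have [measurable]: "w1 \<in> borel_measurable borel" "w2 \<in> borel_measurable borel"
    unfolding w1_def[abs_def] w2_def[abs_def] by measurable
  have vB: "\<bar>v y - v x0\<bar> \<le> 2 * B" for y using B[of y] B[of x0] by linarith
  have B0: "0 \<le> B" using B[of 0] by linarith
  have i1: "integrable lborel (\<lambda>y. w1 y / (1 + y\<^sup>2))" unfolding w1_def
    by (rule weight_times_integrable[OF \<alpha>, where B = "2 * B"]) (use vB B0 in \<open>auto simp: indicator_def\<close>)
  have i2: "integrable lborel (\<lambda>y. w2 y / (1 + y\<^sup>2))" unfolding w2_def
    by (rule weight_times_integrable[OF \<alpha>, where B = "2 * B"]) (use vB B0 in \<open>auto simp: indicator_def\<close>)
  have i0: "integrable lborel (\<lambda>y. \<bar>y\<bar> powr (- \<alpha>) / (1 + y\<^sup>2))"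
    using weight_integral[OF \<alpha>] by (simp add: has_bochner_integral_iff)
  have i3: "integrable lborel (\<lambda>y. v x0 * \<bar>y\<bar> powr (- \<alpha>) / (1 + y\<^sup>2))"
    using integrable_mult_right[OF i0, of "v x0"] by simp
  let ?s = "complex_of_real (\<alpha> + 1)"
  have split: "Im (even_part \<alpha> v z) = Im (z powr ?s * cauchy_int w1 (z\<^sup>2))
      + Im (z powr ?s * cauchy_int w2 (z\<^sup>2)) + pi * v x0" if "z \<in> quadrant" for z
  proof -
    have z2: "z\<^sup>2 \<notin> \<real>\<^sub>\<ge>\<^sub>0" using square_notin_nonneg_Reals that by auto
    have i12: "integrable lborel (\<lambda>y. (w1 y + w2 y) / (1 + y\<^sup>2))"
      using i1 i2 by (simp add: add_divide_distrib)
    have "(\<lambda>y. \<bar>y\<bar> powr (- \<alpha>) * v y) = (\<lambda>y. (w1 y + w2 y) + v x0 * \<bar>y\<bar> powr (- \<alpha>))"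
      by (auto simp: w1_def w2_def indicator_def algebra_simps)
    then have "cauchy_int (\<lambda>y. \<bar>y\<bar> powr (- \<alpha>) * v y) (z\<^sup>2)
        = cauchy_int w1 (z\<^sup>2) + cauchy_int w2 (z\<^sup>2) + v x0 * cauchy_int (\<lambda>y. \<bar>y\<bar> powr (- \<alpha>)) (z\<^sup>2)"
      using cauchy_int_add[OF _ i12 _ i3 z2] cauchy_int_add[OF _ i1 _ i2 z2]
      by (simp add: cauchy_int_cmult)
    then have "even_part \<alpha> v z = z powr ?s * cauchy_int w1 (z\<^sup>2) + z powr ?s * cauchy_int w2 (z\<^sup>2)
        + of_real (v x0) * mass_fun \<alpha> z"
      by (simp add: even_part_def mass_fun_def algebra_simps)
    then show ?thesis using Im_mass_fun[OF \<alpha>, of z] that by simp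
  qed
  have near: "\<bar>Im (z powr ?s * cauchy_int w1 (z\<^sup>2))\<bar> \<le> e / 2" if "z \<in> quadrant" for z
  proof -
    let ?k = "\<lambda>y. z powr ?s / (complex_of_real (y\<^sup>2) - z\<^sup>2)"
    have "z\<^sup>2 \<notin> \<real>\<^sub>\<ge>\<^sub>0" using square_notin_nonneg_Reals that by auto
    then obtain d where d: "0 < d" "\<And>y::real. d \<le> cmod (complex_of_real (y\<^sup>2) - z\<^sup>2)"
      using nonneg_real_distance by blast
    have I1: "integrable lborel (\<lambda>y. w1 y *\<^sub>R ?k y)"
      using integrable_mult_right[OF cauchy_int_integrable[OF _ i1 d], of "z powr ?s"]
      by (simp add: scaleR_conv_of_real mult_ac)
    have I0: "integrable lborel (\<lambda>y. (\<bar>y\<bar> powr (- \<alpha>)) *\<^sub>R ?k y)"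
      using integrable_mult_right[OF cauchy_int_integrable[OF _ i0 d], of "z powr ?s"]
      by (simp add: scaleR_conv_of_real mult_ac)
    have "z powr ?s * cauchy_int w1 (z\<^sup>2) = (\<integral>y. w1 y *\<^sub>R ?k y \<partial>lborel)"
      unfolding cauchy_int_def integral_mult_right_zero[symmetric]
      by (simp add: scaleR_conv_of_real mult_ac)
    then have "Im (z powr ?s * cauchy_int w1 (z\<^sup>2)) = (\<integral>y. w1 y * Im (?k y) \<partial>lborel)"
      using integral_Im[OF I1] by simp
    also have "\<bar>\<dots>\<bar> \<le> (\<integral>y. e' * (\<bar>y\<bar> powr (- \<alpha>) * Im (?k y)) \<partial>lborel)"
    proof -
      have "norm (\<integral>y. w1 y * Im (?k y) \<partial>lborel) \<le> (\<integral>y. e' * (\<bar>y\<bar> powr (- \<alpha>) * Im (?k y)) \<partial>lborel)"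
      proof (rule Bochner_Integration.integral_norm_bound_integral)
        show "integrable lborel (\<lambda>y. w1 y * Im (?k y))" using integrable_Im[OF I1] by simp
        show "integrable lborel (\<lambda>y. e' * (\<bar>y\<bar> powr (- \<alpha>) * Im (?k y)))"
          using integrable_mult_right[OF integrable_Im[OF I0], of e'] by simp
        fix y
        have "\<bar>indicator S y * (v y - v x0)\<bar> \<le> e'"
          using h(2)[of "\<bar>y\<bar>"] e'(1) vabs[of y] by (auto simp: S_def indicator_def)
        then have "(\<bar>y\<bar> powr (- \<alpha>) * Im (?k y)) * \<bar>indicator S y * (v y - v x0)\<bar> \<le> (\<bar>y\<bar> powr (- \<alpha>) * Im (?k y)) * e'"
          using Im_kernel_nonneg[OF \<alpha>, of z y] that by (intro mult_left_mono) auto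
        then show "norm (w1 y * Im (?k y)) \<le> e' * (\<bar>y\<bar> powr (- \<alpha>) * Im (?k y))"
          using Im_kernel_nonneg[OF \<alpha>, of z y] that by (simp add: w1_def abs_mult mult_ac)
      qed
      then show ?thesis by simp
    qed
    also have "\<dots> = e' * Im (\<integral>y. (\<bar>y\<bar> powr (- \<alpha>)) *\<^sub>R ?k y \<partial>lborel)"
      using integral_Im[OF I0] by simp
    also have "(\<integral>y. (\<bar>y\<bar> powr (- \<alpha>)) *\<^sub>R ?k y \<partial>lborel) = mass_fun \<alpha> z"
      unfolding mass_fun_def cauchy_int_def integral_mult_right_zero[symmetric]
      by (simp add: scaleR_conv_of_real mult_ac)
    finally show ?thesis using Im_mass_fun[OF \<alpha>, of z] that e'(2) by simp
  qed
  have far: "((\<lambda>z. Im (z powr ?s * cauchy_int w2 (z\<^sup>2))) \<longlongrightarrow> 0) (at (complex_of_real x0) within quadrant)"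
  proof -
    have d: "h\<^sup>2 \<le> cmod (complex_of_real (y\<^sup>2) - complex_of_real (x0\<^sup>2))" if "w2 y \<noteq> 0" for y
    proof -
      have y: "h \<le> \<bar>\<bar>y\<bar> - x0\<bar>" using that by (auto simp: w2_def S_def indicator_def split: if_splits)
      have "h * h \<le> \<bar>\<bar>y\<bar> - x0\<bar> * \<bar>\<bar>y\<bar> + x0\<bar>"
        using y x0 h(1) by (intro mult_mono) auto
      also have "\<dots> = \<bar>y\<^sup>2 - x0\<^sup>2\<bar>"
        by (simp add: abs_mult[symmetric] power2_eq_square algebra_simps)
      finally show ?thesis by (simp only: power2_eq_square[of h] norm_of_real flip: of_real_diff)
    qed
    have "isCont (cauchy_int w2) (complex_of_real (x0\<^sup>2))"
      by (rule DERIV_isCont[OF cauchy_int_has_field_derivative[OF _ i2, where d = "h\<^sup>2"]]) (use d h in auto)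
    moreover have "((\<lambda>z. z\<^sup>2) \<longlongrightarrow> complex_of_real (x0\<^sup>2)) (at (complex_of_real x0) within quadrant)"
      by (auto intro!: tendsto_eq_intros)
    ultimately have "((\<lambda>z. cauchy_int w2 (z\<^sup>2)) \<longlongrightarrow> cauchy_int w2 (complex_of_real (x0\<^sup>2)))
        (at (complex_of_real x0) within quadrant)"
      by (rule isCont_tendsto_compose)
    then have "((\<lambda>z. Im (z powr ?s * cauchy_int w2 (z\<^sup>2))) \<longlongrightarrow>
        Im (complex_of_real (x0 powr (\<alpha> + 1)) * cauchy_int w2 (complex_of_real (x0\<^sup>2))))
        (at (complex_of_real x0) within quadrant)"
      using \<alpha> x0 by (intro tendsto_Im tendsto_mult powr_tendsto_boundary) auto
    moreover have "Im (cauchy_int w2 (complex_of_real (x0\<^sup>2))) = 0"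
      using cauchy_int_cnj[of w2 "complex_of_real (x0\<^sup>2)"] by (simp add: complex_eq_iff)
    ultimately show ?thesis by simp
  qed
  have "\<forall>\<^sub>F z in at (complex_of_real x0) within quadrant. dist (Im (z powr ?s * cauchy_int w2 (z\<^sup>2))) 0 < e / 2"
    using tendstoD[OF far, of "e / 2"] \<open>0 < e\<close> by simp
  moreover have "\<forall>\<^sub>F z in at (complex_of_real x0) within quadrant. z \<in> quadrant"
    by (simp add: eventually_at_filter)
  ultimately show "\<forall>\<^sub>F z in at (complex_of_real x0) within quadrant. dist (Im (even_part \<alpha> v z)) (pi * v x0) < e"
  proof eventually_elim
    case (elim z)
    show ?case
      using elim(1) near[OF elim(2)] split[OF elim(2)] unfolding dist_real_def by linarith
  qed
qed

lemma cauchy_int_symmetrize: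
  assumes [measurable]: "w \<in> borel_measurable borel"
    and i: "integrable lborel (\<lambda>y. w y / (1 + y\<^sup>2))" and c: "c \<notin> \<real>\<^sub>\<ge>\<^sub>0"
  shows "cauchy_int w c = cauchy_int (\<lambda>y. (w y + w (- y)) / 2) c"
proof -
  have i': "integrable lborel (\<lambda>y. w (- y) / (1 + y\<^sup>2))"
    using lborel_integrable_real_affine[OF i, of "-1" 0] by simp
  have "cauchy_int (\<lambda>y. (1 / 2) * w y + (1 / 2) * w (- y)) c
      = cauchy_int (\<lambda>y. (1 / 2) * w y) c + cauchy_int (\<lambda>y. (1 / 2) * w (- y)) c"
    using integrable_mult_right[OF i, of "1 / 2"] integrable_mult_right[OF i', of "1 / 2"]
    by (intro cauchy_int_add c) auto
  also have "\<dots> = cauchy_int w c"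
    unfolding cauchy_int_cmult cauchy_int_reflect by simp
  finally show ?thesis by (simp add: add_divide_distrib)
qed

lemma continuous_compact_support_integrable:
  fixes w :: "real \<Rightarrow> real"
  assumes "continuous_on UNIV w" "\<And>y. R < \<bar>y\<bar> \<Longrightarrow> w y = 0"
  shows "integrable lborel w"
proof -
  have "integrable lborel (\<lambda>y. indicator {- R..R} y *\<^sub>R w y)"
    by (rule borel_integrable_compact) (auto intro: continuous_on_subset[OF assms(1)])
  moreover have "(\<lambda>y. indicator {- R..R} y *\<^sub>R w y) = w"
    using assms(2) by (force simp: indicator_def abs_le_iff)
  ultimately show ?thesis by simp
qed

lemma compact_support_bounded:
  fixes w :: "real \<Rightarrow> real"
  assumes "continuous_on UNIV w" "\<And>y. R < \<bar>y\<bar> \<Longrightarrow> w y = 0"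
  obtains B where "\<And>y. \<bar>w y\<bar> \<le> B"
proof -
  have "compact (w ` {- R..R})"
    by (intro compact_continuous_image continuous_on_subset[OF assms(1)]) auto
  then obtain B where B: "\<And>y. y \<in> {- R..R} \<Longrightarrow> \<bar>w y\<bar> \<le> B"
    using compact_imp_bounded by (fastforce simp: bounded_iff)
  show ?thesis
  proof (rule that)
    show "\<bar>w y\<bar> \<le> max B 0" for y
    proof (cases "R < \<bar>y\<bar>")
      case False
      then have "y \<in> {- R..R}" by auto
      then show ?thesis using B[of y] by simp
    qed (simp add: assms(2))
  qed
qed

text \<open>The last condition dominates the comparison of the odd kernel with the even one near \<open>y = 0\<close>.\<close>

definition datum :: "(real \<Rightarrow> real) \<Rightarrow> bool" where
  "datum u \<longleftrightarrow> continuous_on UNIV u \<and> (\<exists>R. \<forall>y. R < \<bar>y\<bar> \<longrightarrow> u y = 0) \<and>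
     (\<exists>L. \<forall>y. \<bar>u y - u (- y)\<bar> \<le> L * \<bar>y\<bar>)"

lemma datumE:
  assumes "datum u"
  obtains R L B where "continuous_on UNIV u" "0 < R" "\<And>y. R < \<bar>y\<bar> \<Longrightarrow> u y = 0"
    "\<And>y. \<bar>u y - u (- y)\<bar> \<le> L * \<bar>y\<bar>" "\<And>y. \<bar>u y\<bar> \<le> B" "u \<in> borel_measurable borel"
proof -
  obtain R L where R: "\<And>y. R < \<bar>y\<bar> \<Longrightarrow> u y = 0" and L: "\<And>y. \<bar>u y - u (- y)\<bar> \<le> L * \<bar>y\<bar>"
    and c: "continuous_on UNIV u"
    using assms unfolding datum_def by blast
  obtain B where "\<And>y. \<bar>u y\<bar> \<le> B" using compact_support_bounded[OF c R] by blast
  with c R L show ?thesis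
    by (intro that[of "max R 1" L B]) (auto intro: borel_measurable_continuous_onI)
qed

lemma weight_times_datum_integrable:
  assumes "-1 < \<alpha>" "\<alpha> < 1" "datum u"
  shows "integrable lborel (\<lambda>y. \<bar>y\<bar> powr (- \<alpha>) * u y)"
    "integrable lborel (\<lambda>y. \<bar>y\<bar> powr (- \<alpha>) * u y / (1 + y\<^sup>2))"
proof -
  obtain R L B where u: "continuous_on UNIV u" "0 < R" "\<And>y. R < \<bar>y\<bar> \<Longrightarrow> u y = 0"
    "\<And>y. \<bar>u y\<bar> \<le> B" and [measurable]: "u \<in> borel_measurable borel"
    using datumE[OF assms(3)] by metis
  show i: "integrable lborel (\<lambda>y. \<bar>y\<bar> powr (- \<alpha>) * u y / (1 + y\<^sup>2))"
    using u by (intro weight_times_integrable assms) auto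
  show "integrable lborel (\<lambda>y. \<bar>y\<bar> powr (- \<alpha>) * u y)"
  proof (rule Bochner_Integration.integrable_bound)
    show "integrable lborel (\<lambda>y. (1 + R\<^sup>2) * (\<bar>y\<bar> powr (- \<alpha>) * u y / (1 + y\<^sup>2)))"
      by (rule integrable_mult_right[OF i])
    show "AE y in lborel. norm (\<bar>y\<bar> powr (- \<alpha>) * u y)
        \<le> norm ((1 + R\<^sup>2) * (\<bar>y\<bar> powr (- \<alpha>) * u y / (1 + y\<^sup>2)))"
    proof (rule AE_I2)
      fix y
      show "norm (\<bar>y\<bar> powr (- \<alpha>) * u y) \<le> norm ((1 + R\<^sup>2) * (\<bar>y\<bar> powr (- \<alpha>) * u y / (1 + y\<^sup>2)))"
      proof (cases "R < \<bar>y\<bar>")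
        case False
        then have "1 + y\<^sup>2 \<le> 1 + R\<^sup>2" using u(2) by (simp add: abs_le_square_iff[symmetric])
        moreover have "0 < 1 + y\<^sup>2" by (simp add: add_pos_nonneg)
        ultimately have "1 \<le> (1 + R\<^sup>2) / (1 + y\<^sup>2)" by simp
        then have "\<bar>\<bar>y\<bar> powr (- \<alpha>) * u y\<bar> * 1 \<le> \<bar>\<bar>y\<bar> powr (- \<alpha>) * u y\<bar> * ((1 + R\<^sup>2) / (1 + y\<^sup>2))"
          by (intro mult_left_mono) auto
        then show ?thesis by (simp add: abs_mult add_nonneg_nonneg mult_ac)
      qed (use u(3) in simp)
    qed
  qed measurable
qed

lemma mult_datum_integrable:
  assumes "datum u"
  shows "integrable lborel (\<lambda>y. y * u y)" "integrable lborel (\<lambda>y. y * u y / (1 + y\<^sup>2))"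
proof -
  obtain R where u: "continuous_on UNIV u" "\<And>y. R < \<bar>y\<bar> \<Longrightarrow> u y = 0"
    using datumE[OF assms] by metis
  have "1 + y\<^sup>2 \<noteq> 0" for y :: real using zero_le_power2[of y] by linarith
  then show "integrable lborel (\<lambda>y. y * u y)" "integrable lborel (\<lambda>y. y * u y / (1 + y\<^sup>2))"
    by (auto intro!: continuous_compact_support_integrable[where R = R] continuous_intros u(1) simp: u(2))
qed

lemma datum_measurable:
  assumes "datum u"
  shows "u \<in> borel_measurable borel" "(\<lambda>y. y * u y) \<in> borel_measurable borel"
    "(\<lambda>y. \<bar>y\<bar> powr (- \<alpha>) * u y) \<in> borel_measurable borel"
proof -
  show [measurable]: "u \<in> borel_measurable borel" using datumE[OF assms] by metis
  show "(\<lambda>y. y * u y) \<in> borel_measurable borel" by measurable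
  show "(\<lambda>y. \<bar>y\<bar> powr (- \<alpha>) * u y) \<in> borel_measurable borel" by measurable
qed

lemma Im_even_part_tendsto_datum:
  assumes \<alpha>: "-1 < \<alpha>" "\<alpha> < 1" and x0: "0 \<le> x0" and "datum u"
  shows "((\<lambda>z. Im (even_part \<alpha> u z)) \<longlongrightarrow> pi * ((u x0 + u (- x0)) / 2)) (at (complex_of_real x0) within quadrant)"
proof -
  obtain R B where u: "continuous_on UNIV u" "\<And>y. R < \<bar>y\<bar> \<Longrightarrow> u y = 0"
    "\<And>y. \<bar>u y\<bar> \<le> B" "u \<in> borel_measurable borel"
    using datumE[OF assms(4)] by metis
  define v where "v y = (u y + u (- y)) / 2" for y
  have cv: "continuous_on UNIV v"
    unfolding v_def by (intro continuous_intros continuous_on_compose2[OF u(1)]) auto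
  have "\<bar>v y\<bar> \<le> B" for y using u(3)[of y] u(3)[of "- y"] by (auto simp: v_def abs_le_iff)
  then have *: "((\<lambda>z. Im (even_part \<alpha> v z)) \<longlongrightarrow> pi * v x0) (at (complex_of_real x0) within quadrant)"
    by (intro Im_even_part_tendsto[OF \<alpha> x0 cv]) (auto simp: v_def add.commute)
  have "even_part \<alpha> v z = even_part \<alpha> u z" if "z \<in> quadrant" for z
  proof -
    have z2: "z\<^sup>2 \<notin> \<real>\<^sub>\<ge>\<^sub>0" using square_notin_nonneg_Reals that by auto
    show ?thesis
      using cauchy_int_symmetrize[OF datum_measurable(3)[OF assms(4)] weight_times_datum_integrable(2)[OF \<alpha> assms(4)] z2]
      by (simp add: even_part_def v_def algebra_simps)
  qed
  then have "\<forall>\<^sub>F z in at (complex_of_real x0) within quadrant. Im (even_part \<alpha> v z) = Im (even_part \<alpha> u z)"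
    by (simp add: eventually_at_filter)
  from Lim_transform_eventually[OF * this] show ?thesis by (simp add: v_def)
qed

text \<open>The odd kernel differs from the even one with exponent \<open>0\<close> by
  \<open>Im (1 / (\<bar>y\<bar> + z))\<close>, which is harmless near the real axis.\<close>

lemma Im_odd_part_tendsto_datum:
  assumes x0: "0 \<le> x0" and "datum u"
  shows "((\<lambda>z. Im (odd_part u z)) \<longlongrightarrow> pi * ((u x0 - u (- x0)) / 2)) (at (complex_of_real x0) within quadrant)"
proof -
  obtain R B L where u: "continuous_on UNIV u" "\<And>y. R < \<bar>y\<bar> \<Longrightarrow> u y = 0" "0 < R"
    "\<And>y. \<bar>u y\<bar> \<le> B" and [measurable]: "u \<in> borel_measurable borel" and L: "\<And>y. \<bar>u y - u (- y)\<bar> \<le> L * \<bar>y\<bar>"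
    using datumE[OF assms(2)] by metis
  \<comment> \<open>The odd part of u, reflected into an even function: symmetrising y u(y) gives
    \<open>\<bar>y\<bar> * v y\<close>, to which the boundary limit for even functions with exponent
    0 can be compared.\<close>
  define v where "v y = (u \<bar>y\<bar> - u (- \<bar>y\<bar>)) / 2" for y
  have cv: "continuous_on UNIV v"
    unfolding v_def by (intro continuous_intros continuous_on_compose2[OF u(1)]) auto
  have [measurable]: "v \<in> borel_measurable borel" by (rule borel_measurable_continuous_onI[OF cv])
  have vB: "\<bar>v y\<bar> \<le> B" for y using u(4)[of "\<bar>y\<bar>"] u(4)[of "- \<bar>y\<bar>"] by (auto simp: v_def abs_le_iff)
  have vL: "\<bar>v y\<bar> \<le> L * \<bar>y\<bar>" for y
    using L[of "\<bar>y\<bar>"] unfolding v_def by (simp add: abs_le_iff)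
  have v0: "v y = 0" if "R < \<bar>y\<bar>" for y using u(2)[of "\<bar>y\<bar>"] u(2)[of "- \<bar>y\<bar>"] that by (simp add: v_def)
  have even: "((\<lambda>z. Im (even_part 0 v z)) \<longlongrightarrow> pi * v x0) (at (complex_of_real x0) within quadrant)"
    by (intro Im_even_part_tendsto[OF _ _ x0 cv]) (use vB in \<open>auto simp: v_def\<close>)
  define E where "E z = (\<integral>y. complex_of_real (v y) / (complex_of_real \<bar>y\<bar> + z) \<partial>lborel)" for z
  have "L \<ge> 0" using L[of 1] by linarith
  have dom: "cmod (complex_of_real (v y) / (complex_of_real \<bar>y\<bar> + z)) \<le> L * indicator {- R..R} y"
    if "0 \<le> Re z" for y z
  proof (cases "v y = 0")
    case False
    then have "\<not> R < \<bar>y\<bar>" using v0[of y] by blast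
    moreover have "0 < \<bar>y\<bar>" using vL[of y] False by auto
    ultimately have y: "y \<in> {- R..R}" "0 < \<bar>y\<bar>" by auto
    have "\<bar>y\<bar> \<le> cmod (complex_of_real \<bar>y\<bar> + z)"
      using abs_Re_le_cmod[of "complex_of_real \<bar>y\<bar> + z"] that by simp
    then have "\<bar>v y\<bar> / cmod (complex_of_real \<bar>y\<bar> + z) \<le> (L * \<bar>y\<bar>) / \<bar>y\<bar>"
      using y(2) vL[of y] \<open>L \<ge> 0\<close> by (intro frac_le) auto
    then show ?thesis using y by (simp add: norm_divide)
  qed (use \<open>L \<ge> 0\<close> in \<open>simp add: indicator_def\<close>)
  have intL: "integrable lborel (\<lambda>y. L * indicator {- R..R} y :: real)"
    using u(3) by (intro integrable_mult_right) (simp add: integrable_indicator_iff)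
  have split: "Im (odd_part u z) = Im (even_part 0 v z) + Im (E z)" if "z \<in> quadrant" for z
  proof -
    have z2: "z\<^sup>2 \<notin> \<real>\<^sub>\<ge>\<^sub>0" using square_notin_nonneg_Reals that by auto
    then obtain d where d: "0 < d" "\<And>y::real. d \<le> cmod (complex_of_real (y\<^sup>2) - z\<^sup>2)"
      using nonneg_real_distance by blast
    have "(y * u y + (- y) * u (- y)) / 2 = \<bar>y\<bar> * v y" for y
      by (cases "0 \<le> y") (auto simp: v_def algebra_simps)
    then have "odd_part u z = cauchy_int (\<lambda>y. \<bar>y\<bar> * v y) (z\<^sup>2)"
      using cauchy_int_symmetrize[OF datum_measurable(2)[OF assms(2)] mult_datum_integrable(2)[OF assms(2)] z2]
      by (simp add: odd_part_def)
    moreover have "even_part 0 v z = z * cauchy_int v (z\<^sup>2)"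
    proof -
      have "(\<lambda>y. \<bar>y\<bar> powr (- 0) * v y) = v" by (auto simp: v_def)
      then show ?thesis using that by (auto simp: even_part_def)
    qed
    \<comment> \<open>Partial fractions with a = \<bar>y\<bar>: a / (a^2 - z^2) = z / (a^2 - z^2) +
      1 / (a + z).\<close>
    moreover have "cauchy_int (\<lambda>y. \<bar>y\<bar> * v y) (z\<^sup>2) = z * cauchy_int v (z\<^sup>2) + E z"
    proof -
      have n1: "1 + y\<^sup>2 \<noteq> 0" for y :: real using zero_le_power2[of y] by linarith
      have iv: "integrable lborel (\<lambda>y. v y / (1 + y\<^sup>2))"
        by (rule continuous_compact_support_integrable[where R = R])
          (use n1 in \<open>auto intro!: continuous_intros cv simp: v0\<close>)
      have I1: "integrable lborel (\<lambda>y. complex_of_real (v y) / (complex_of_real (y\<^sup>2) - z\<^sup>2))"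
        using d by (intro cauchy_int_integrable[OF _ iv]) auto
      have I2: "integrable lborel (\<lambda>y. complex_of_real (v y) / (complex_of_real \<bar>y\<bar> + z))"
        by (rule Bochner_Integration.integrable_bound[OF intL]) (use dom[of z] that in \<open>auto intro!: AE_I2 order_trans[OF _ abs_ge_self]\<close>)
      have "z * cauchy_int v (z\<^sup>2) + E z = (\<integral>y. z * (complex_of_real (v y) / (complex_of_real (y\<^sup>2) - z\<^sup>2))
          + complex_of_real (v y) / (complex_of_real \<bar>y\<bar> + z) \<partial>lborel)"
        unfolding cauchy_int_def E_def integral_mult_right_zero[symmetric]
        by (rule Bochner_Integration.integral_add[symmetric]) (intro integrable_mult_right I1 I2)+
      also have "\<dots> = cauchy_int (\<lambda>y. \<bar>y\<bar> * v y) (z\<^sup>2)"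
        unfolding cauchy_int_def
      proof (rule Bochner_Integration.integral_cong[OF refl])
        fix y
        define a where "a = complex_of_real \<bar>y\<bar>"
        have a: "complex_of_real (y\<^sup>2) = a\<^sup>2" unfolding a_def by (simp flip: of_real_power)
        have nz: "a\<^sup>2 - z\<^sup>2 \<noteq> 0" using d(1) d(2)[of y] unfolding a by auto
        have f: "a\<^sup>2 - z\<^sup>2 = (a - z) * (a + z)" by (simp add: power2_eq_square algebra_simps)
        have "a + z \<noteq> 0" "a - z \<noteq> 0" using nz unfolding f by auto
        then have "c / (a + z) = (c * (a - z)) / ((a - z) * (a + z))" for c by simp
        then have "z * (c / ((a - z) * (a + z))) + c / (a + z) = (z * c + c * (a - z)) / ((a - z) * (a + z))" for c
          by (simp only: add_divide_distrib times_divide_eq_right)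
        moreover have "z * c + c * (a - z) = a * c" for c by (simp add: algebra_simps)
        ultimately have "z * (c / ((a - z) * (a + z))) + c / (a + z) = (a * c) / ((a - z) * (a + z))" for c
          by (simp only:)
        then show "z * (complex_of_real (v y) / (complex_of_real (y\<^sup>2) - z\<^sup>2)) + complex_of_real (v y) / (complex_of_real \<bar>y\<bar> + z)
          = complex_of_real (\<bar>y\<bar> * v y) / (complex_of_real (y\<^sup>2) - z\<^sup>2)"
          unfolding a f of_real_mult a_def[symmetric] .
      qed
      finally show ?thesis by simp
    qed
    ultimately show ?thesis by simp
  qed
  have "(E \<longlongrightarrow> E (complex_of_real x0)) (at (complex_of_real x0) within quadrant)"
    unfolding tendsto_at_iff_sequentially o_def
  proof (intro allI impI)
    fix X assume X: "\<forall>i. X i \<in> quadrant - {complex_of_real x0}" "X \<longlonglongrightarrow> complex_of_real x0"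
    show "(\<lambda>i. E (X i)) \<longlonglongrightarrow> E (complex_of_real x0)"
      unfolding E_def
    proof (rule integral_dominated_convergence[OF _ _ intL])
      show "AE y in lborel. (\<lambda>i. complex_of_real (v y) / (complex_of_real \<bar>y\<bar> + X i))
          \<longlonglongrightarrow> complex_of_real (v y) / (complex_of_real \<bar>y\<bar> + complex_of_real x0)"
      proof (rule AE_I2)
        fix y
        show "(\<lambda>i. complex_of_real (v y) / (complex_of_real \<bar>y\<bar> + X i))
          \<longlonglongrightarrow> complex_of_real (v y) / (complex_of_real \<bar>y\<bar> + complex_of_real x0)"
        proof (cases "y = 0")
          case False
          then have "complex_of_real \<bar>y\<bar> + complex_of_real x0 \<noteq> 0"
            using x0 by (simp flip: of_real_add)
          then show ?thesis by (intro tendsto_intros X(2))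
        qed (simp add: v_def)
      qed
      show "AE y in lborel. cmod (complex_of_real (v y) / (complex_of_real \<bar>y\<bar> + X i)) \<le> L * indicator {- R..R} y" for i
        using dom[of "X i"] X(1) by (intro AE_I2) auto
    qed auto
  qed
  then have "((\<lambda>z. Im (E z)) \<longlongrightarrow> Im (E (complex_of_real x0))) (at (complex_of_real x0) within quadrant)"
    by (rule tendsto_Im)
  moreover have "Im (E (complex_of_real x0)) = 0"
  proof -
    have "E (complex_of_real x0) = (\<integral>y. complex_of_real (v y / (\<bar>y\<bar> + x0)) \<partial>lborel)"
      unfolding E_def by simp
    then show ?thesis by (simp only: integral_complex_of_real Im_complex_of_real)
  qed
  ultimately have "((\<lambda>z. Im (even_part 0 v z) + Im (E z)) \<longlongrightarrow> pi * v x0 + 0) (at (complex_of_real x0) within quadrant)"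
    using even by (intro tendsto_add) auto
  moreover have "\<forall>\<^sub>F z in at (complex_of_real x0) within quadrant. Im (even_part 0 v z) + Im (E z) = Im (odd_part u z)"
    using split by (simp add: eventually_at_filter)
  ultimately show ?thesis
    using x0 by (auto simp: v_def intro: Lim_transform_eventually)
qed

text \<open>The work is done with this representation by two holomorphic functions; only
  \<open>kernel_integral\<close>, near the end, identifies it with the kernel integral divided by
  pi.\<close>

definition sol :: "real \<Rightarrow> (real \<Rightarrow> real) \<Rightarrow> real \<times> real \<Rightarrow> real" where
  "sol \<alpha> u p = (Im (even_part \<alpha> u (Complex \<bar>snd p\<bar> (fst p))) + Im (odd_part u (Complex (snd p) (fst p)))) / pi"

text \<open>Reflection in x conjugates the square of z, hence the Cauchy integral. On the axis that
  square is real, so the imaginary part vanishes, in agreement with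
  \<open>sgn 0 = 0\<close>.\<close>

lemma Im_odd_part_sgn: "Im (odd_part u (Complex x t)) = sgn x * Im (odd_part u (Complex \<bar>x\<bar> t))"
proof -
  consider "x < 0" | "x = 0" | "x > 0" by linarith
  then show ?thesis
  proof cases
    case 1
    have "(Complex x t)\<^sup>2 = cnj ((Complex \<bar>x\<bar> t)\<^sup>2)"
      using 1 by (simp add: complex_eq_iff power2_eq_square)
    then have "odd_part u (Complex x t) = cnj (odd_part u (Complex \<bar>x\<bar> t))"
      by (simp only: odd_part_def cauchy_int_cnj)
    then show ?thesis using 1 by simp
  next
    case 2
    have "(Complex x t)\<^sup>2 = cnj ((Complex x t)\<^sup>2)"
      using 2 by (simp add: complex_eq_iff power2_eq_square)
    then have "odd_part u (Complex x t) = cnj (odd_part u (Complex x t))"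
      unfolding odd_part_def by (metis cauchy_int_cnj)
    from arg_cong[OF this, of Im] show ?thesis using 2 by simp
  qed simp
qed

lemma sol_tendsto_boundary:
  assumes \<alpha>: "-1 < \<alpha>" "\<alpha> < 1" and "datum u"
  shows "(sol \<alpha> u \<longlongrightarrow> u x0) (at (0, x0) within halfplane)"
proof -
  let ?F = "at (0, x0) within halfplane"
  have "((\<lambda>p. Complex \<bar>snd p\<bar> (fst p)) \<longlongrightarrow> Complex \<bar>x0\<bar> 0) ?F"
    by (intro tendsto_Complex tendsto_rabs) (auto intro!: tendsto_eq_intros)
  then have lim: "filterlim (\<lambda>p. Complex \<bar>snd p\<bar> (fst p)) (at (complex_of_real \<bar>x0\<bar>) within quadrant) ?F"
    unfolding filterlim_at by (auto simp: eventually_at_filter complex_eq_iff complex_of_real_def)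
  have e: "((\<lambda>p. Im (even_part \<alpha> u (Complex \<bar>snd p\<bar> (fst p)))) \<longlongrightarrow> pi * ((u \<bar>x0\<bar> + u (- \<bar>x0\<bar>)) / 2)) ?F"
    by (rule filterlim_compose[OF Im_even_part_tendsto_datum[OF \<alpha> _ assms(3)] lim]) simp
  have o: "((\<lambda>p. Im (odd_part u (Complex \<bar>snd p\<bar> (fst p)))) \<longlongrightarrow> pi * ((u \<bar>x0\<bar> - u (- \<bar>x0\<bar>)) / 2)) ?F"
    by (rule filterlim_compose[OF Im_odd_part_tendsto_datum[OF _ assms(3)] lim]) simp
  have "((\<lambda>p. sgn (snd p) * Im (odd_part u (Complex \<bar>snd p\<bar> (fst p))))
      \<longlongrightarrow> sgn x0 * (pi * ((u \<bar>x0\<bar> - u (- \<bar>x0\<bar>)) / 2))) ?F"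
  proof (cases "x0 = 0")
    case True
    \<comment> \<open>The sign jumps at 0, but the other factor tends to pi (u 0 - u 0) / 2 =
      0.\<close>
    have "((\<lambda>p. sgn (snd p) * Im (odd_part u (Complex \<bar>snd p\<bar> (fst p)))) \<longlongrightarrow> 0) ?F"
    proof (rule Lim_null_comparison)
      show "\<forall>\<^sub>F p in ?F. norm (sgn (snd p) * Im (odd_part u (Complex \<bar>snd p\<bar> (fst p))))
          \<le> \<bar>Im (odd_part u (Complex \<bar>snd p\<bar> (fst p)))\<bar>"
        by (intro always_eventually) (auto simp: abs_mult sgn_if)
      show "((\<lambda>p. \<bar>Im (odd_part u (Complex \<bar>snd p\<bar> (fst p)))\<bar>) \<longlongrightarrow> 0) ?F"
        using tendsto_rabs[OF o] True by simp
    qed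
    then show ?thesis using True by simp
  next
    case False
    have "((\<lambda>p. sgn (snd p)) \<longlongrightarrow> sgn x0) ?F"
      by (rule tendsto_sgn[OF _ False]) (auto intro!: tendsto_eq_intros)
    then show ?thesis by (intro tendsto_mult o)
  qed
  from tendsto_divide[OF tendsto_add[OF e this] tendsto_const[of pi]]
  have "(sol \<alpha> u \<longlongrightarrow> (pi * ((u \<bar>x0\<bar> + u (- \<bar>x0\<bar>)) / 2) + sgn x0 * (pi * ((u \<bar>x0\<bar> - u (- \<bar>x0\<bar>)) / 2))) / pi) ?F"
    by (simp add: sol_def[abs_def] Im_odd_part_sgn[of u "snd _"])
  moreover have "(pi * ((u \<bar>x0\<bar> + u (- \<bar>x0\<bar>)) / 2) + sgn x0 * (pi * ((u \<bar>x0\<bar> - u (- \<bar>x0\<bar>)) / 2))) / pi = u x0"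
    by (cases "x0 = 0"; cases "x0 < 0") (auto simp: field_simps)
  ultimately show ?thesis by simp
qed

lemma cmod_cauchy_int_le:
  assumes "integrable lborel w" "\<And>y. R < \<bar>y\<bar> \<Longrightarrow> w y = 0" "0 < R" "R < r" "cmod z = r"
  shows "cmod (cauchy_int w (z\<^sup>2)) \<le> (\<integral>y. \<bar>w y\<bar> \<partial>lborel) / (r\<^sup>2 - R\<^sup>2)"
proof -
  have p: "0 < r\<^sup>2 - R\<^sup>2" using assms by (simp add: power_strict_mono)
  have [measurable]: "w \<in> borel_measurable borel" using assms(1) by simp
  have b: "cmod (complex_of_real (w y) / (complex_of_real (y\<^sup>2) - z\<^sup>2)) \<le> \<bar>w y\<bar> / (r\<^sup>2 - R\<^sup>2)" for y
  proof (cases "R < \<bar>y\<bar>")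
    case False
    then have "y\<^sup>2 \<le> R\<^sup>2" using assms(3) by (simp add: abs_le_square_iff[symmetric])
    moreover have "cmod (z\<^sup>2) \<le> cmod (complex_of_real (y\<^sup>2) - z\<^sup>2) + cmod (complex_of_real (y\<^sup>2))"
      by (metis norm_minus_commute norm_triangle_sub add.commute)
    moreover have "cmod (z\<^sup>2) = r\<^sup>2" "cmod (complex_of_real (y\<^sup>2)) = y\<^sup>2"
      using assms(5) by (simp_all add: norm_power flip: of_real_power)
    ultimately have "r\<^sup>2 - R\<^sup>2 \<le> cmod (complex_of_real (y\<^sup>2) - z\<^sup>2)" by linarith
    then have "\<bar>w y\<bar> / cmod (complex_of_real (y\<^sup>2) - z\<^sup>2) \<le> \<bar>w y\<bar> / (r\<^sup>2 - R\<^sup>2)"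
      using p by (intro frac_le) auto
    then show ?thesis by (simp add: norm_divide)
  qed (simp add: assms(2))
  have i: "integrable lborel (\<lambda>y. \<bar>w y\<bar> / (r\<^sup>2 - R\<^sup>2))" using assms(1) by simp
  have "integrable lborel (\<lambda>y. complex_of_real (w y) / (complex_of_real (y\<^sup>2) - z\<^sup>2))"
    by (rule Bochner_Integration.integrable_bound[OF i]) (use b p in \<open>auto intro!: AE_I2\<close>)
  from Bochner_Integration.integral_norm_bound_integral[OF this i b] show ?thesis
    by (simp add: cauchy_int_def)
qed

text \<open>Let the datum vanish beyond R and let r \<ge> 2 R be the modulus of z. The denominators
  are then at least r^2 / 2, so the even part is of order r^(\<alpha> - 1) and the odd part of order
  r^(-2). The first tends to 0 because \<alpha> < 1.\<close>

lemma sol_vanishes_at_infinity: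
  assumes \<alpha>: "-1 < \<alpha>" "\<alpha> < 1" and "datum u" and "0 < e"
  obtains M where "\<And>p. p \<in> halfplane \<Longrightarrow> M \<le> norm p \<Longrightarrow> \<bar>sol \<alpha> u p\<bar> < e"
proof -
  obtain R where u: "\<And>y. R < \<bar>y\<bar> \<Longrightarrow> u y = 0" "0 < R"
    using datumE[OF assms(3)] by metis
  define C1 where "C1 = (\<integral>y. \<bar>\<bar>y\<bar> powr (- \<alpha>) * u y\<bar> \<partial>lborel)"
  define C2 where "C2 = (\<integral>y. \<bar>y * u y\<bar> \<partial>lborel)"
  have C: "0 \<le> C1" "0 \<le> C2" by (simp_all add: C1_def C2_def)
  have "((\<lambda>r::real. (C1 * (2 * r powr (\<alpha> - 1)) + C2 * (2 * inverse r powr 2)) / pi) \<longlongrightarrow>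
      (C1 * (2 * 0) + C2 * (2 * 0)) / pi) at_top"
    using \<alpha> by (intro tendsto_intros tendsto_neg_powr filterlim_ident
        tendsto_eq_rhs[OF tendsto_powr'[OF tendsto_inverse_0_at_top[OF filterlim_ident] tendsto_const]]) auto
  then have "\<forall>\<^sub>F r in at_top. (C1 * (2 * r powr (\<alpha> - 1)) + C2 * (2 * inverse r powr 2)) / pi < e"
    using order_tendstoD(2)[of _ 0 at_top e] assms(4) by simp
  then obtain M where M: "\<And>r. M \<le> r \<Longrightarrow> (C1 * (2 * r powr (\<alpha> - 1)) + C2 * (2 * inverse r powr 2)) / pi < e"
    by (auto simp: eventually_at_top_linorder)
  show ?thesis
  proof (rule that[of "max M (2 * R)"])
    fix p assume p: "p \<in> halfplane" "max M (2 * R) \<le> norm p"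
    define r where "r = norm p"
    have r: "M \<le> r" "2 * R \<le> r" "R < r" "0 < r" using p u(2) by (auto simp: r_def)
    have nz: "cmod (Complex \<bar>snd p\<bar> (fst p)) = r" "cmod (Complex (snd p) (fst p)) = r"
      by (simp_all add: r_def norm_prod_def cmod_def add.commute)
    have "4 * R\<^sup>2 \<le> r\<^sup>2"
      using power_mono[OF r(2), of 2] u(2) by (simp add: power_mult_distrib)
    then have "r\<^sup>2 / 2 \<le> r\<^sup>2 - R\<^sup>2" using zero_le_power2[of R] by linarith
    moreover have "0 < r\<^sup>2 / 2" using r by simp
    ultimately have i: "1 / (r\<^sup>2 - R\<^sup>2) \<le> 2 / r\<^sup>2" using frac_le[of 1 1 "r\<^sup>2 / 2" "r\<^sup>2 - R\<^sup>2"] by simp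
    have "cmod (even_part \<alpha> u (Complex \<bar>snd p\<bar> (fst p))) \<le> r powr (\<alpha> + 1) * (C1 * (1 / (r\<^sup>2 - R\<^sup>2)))"
    proof -
      have "Complex \<bar>snd p\<bar> (fst p) \<noteq> 0" using nz r by auto
      then have "cmod (even_part \<alpha> u (Complex \<bar>snd p\<bar> (fst p))) = r powr (\<alpha> + 1) *
          cmod (cauchy_int (\<lambda>y. \<bar>y\<bar> powr - \<alpha> * u y) ((Complex \<bar>snd p\<bar> (fst p))\<^sup>2))"
        by (simp add: even_part_def norm_mult norm_powr_of_real nz del: of_real_add)
      moreover have "cmod (cauchy_int (\<lambda>y. \<bar>y\<bar> powr - \<alpha> * u y) ((Complex \<bar>snd p\<bar> (fst p))\<^sup>2))
          \<le> C1 * (1 / (r\<^sup>2 - R\<^sup>2))"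
        using cmod_cauchy_int_le[OF weight_times_datum_integrable(1)[OF \<alpha> assms(3)] _ u(2) r(3) nz(1)]
        by (simp add: C1_def u(1))
      ultimately show ?thesis by (simp only: mult_left_mono powr_ge_zero)
    qed
    also have "\<dots> \<le> r powr (\<alpha> + 1) * (C1 * (2 / r\<^sup>2))"
      using i C by (intro mult_left_mono) auto
    also have "\<dots> = C1 * (2 * r powr (\<alpha> - 1))"
    proof -
      have "r powr (\<alpha> + 1) = r powr (\<alpha> - 1) * r\<^sup>2"
        using r(4) powr_add[of r "\<alpha> - 1" 2] by (simp add: add.commute)
      then show ?thesis using r(4) by simp
    qed
    finally have 1: "\<bar>Im (even_part \<alpha> u (Complex \<bar>snd p\<bar> (fst p)))\<bar> \<le> C1 * (2 * r powr (\<alpha> - 1))"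
      using abs_Im_le_cmod order_trans by blast
    have "cmod (odd_part u (Complex (snd p) (fst p))) \<le> C2 * (1 / (r\<^sup>2 - R\<^sup>2))"
      using cmod_cauchy_int_le[OF mult_datum_integrable(1)[OF assms(3)] _ u(2) r(3) nz(2)]
      by (simp add: odd_part_def C2_def u(1))
    also have "\<dots> \<le> C2 * (2 / r\<^sup>2)"
      using i C by (intro mult_left_mono) auto
    also have "\<dots> = C2 * (2 * inverse r powr 2)" using r(4) by (simp add: divide_inverse power_inverse)
    finally have 2: "\<bar>Im (odd_part u (Complex (snd p) (fst p)))\<bar> \<le> C2 * (2 * inverse r powr 2)"
      using abs_Im_le_cmod order_trans by blast
    have "\<bar>sol \<alpha> u p\<bar> \<le> (C1 * (2 * r powr (\<alpha> - 1)) + C2 * (2 * inverse r powr 2)) / pi"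
      unfolding sol_def using 1 2 by (auto simp: abs_divide intro!: divide_right_mono)
    also have "\<dots> < e" by (rule M[OF r(1)])
    finally show "\<bar>sol \<alpha> u p\<bar> < e" .
  qed
qed

section \<open>The space \<open>Hdot10\<close>\<close>

abbreviation lebH :: "(real \<times> real) measure" where
  "lebH \<equiv> lebesgue_on halfplane"

lemma halfplane_measurable: "halfplane \<in> sets lebesgue" "halfplane \<in> sets borel"
  using open_halfplane by (auto intro: lebesgue_openin)

section \<open>Pointwise algebra of the form and square integrable fields\<close>

lemma norm_vec2_power2: "(norm (v :: complex ^ 2))\<^sup>2 = (cmod (v $ 1))\<^sup>2 + (cmod (v $ 2))\<^sup>2"
  by (simp add: norm_vec_def L2_set_def sum_2 real_sqrt_pow2)

lemma norm_vec2_le: "cmod ((v :: complex ^ 2) $ i) \<le> norm v"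
  by (rule Finite_Cartesian_Product.norm_nth_le)

lemma vec2_eq_iff: "(v :: complex ^ 2) = w \<longleftrightarrow> v $ 1 = w $ 1 \<and> v $ 2 = w $ 2"
  by (simp add: vec_eq_iff forall_2)

lemma norm_vec2_le_sum: "norm (v :: complex ^ 2) \<le> cmod (v $ 1) + cmod (v $ 2)"
  using L2_set_le_sum[of "UNIV :: 2 set" "\<lambda>i. norm (v $ i)"]
  by (simp add: norm_vec_def sum_2)

lemma norm_smult_vec2: "norm (c *s (v :: complex ^ 2)) = cmod c * norm v"
proof -
  have "(norm (c *s v))\<^sup>2 = (cmod c * norm v)\<^sup>2"
    by (simp add: norm_vec2_power2 norm_mult power_mult_distrib algebra_simps)
  then show ?thesis by (simp add: power2_eq_iff_nonneg)
qed

lemma hermitian_A_coeff: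
  "hermitian (A_coeff k x *v G) H =
    (G $ 1 + of_real (k * sgn x) * G $ 2) * cnj (H $ 1) + (G $ 2 - of_real (k * sgn x) * G $ 1) * cnj (H $ 2)"
  by (simp add: hermitian_def A_coeff_def matrix_vector_mult_def sum_2 algebra_simps)

lemma hermitian_A_coeff_bound:
  "cmod (hermitian (A_coeff k x *v G) H) \<le> 2 * (1 + \<bar>k\<bar>) * (norm G * norm H)"
proof -
  have k: "cmod (of_real (k * sgn x)) \<le> \<bar>k\<bar>"
    by (simp add: norm_mult abs_mult sgn_if)
  have *: "cmod (a + of_real (k * sgn x) * b) \<le> (1 + \<bar>k\<bar>) * norm G"
    "cmod (a - of_real (k * sgn x) * b) \<le> (1 + \<bar>k\<bar>) * norm G"
    if "cmod a \<le> norm G" "cmod b \<le> norm G" for a b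
  proof -
    have "cmod (of_real (k * sgn x) * b) \<le> \<bar>k\<bar> * norm G"
      unfolding norm_mult by (intro mult_mono k that) auto
    then show "cmod (a + of_real (k * sgn x) * b) \<le> (1 + \<bar>k\<bar>) * norm G"
      "cmod (a - of_real (k * sgn x) * b) \<le> (1 + \<bar>k\<bar>) * norm G"
      using that(1) norm_triangle_ineq[of a "of_real (k * sgn x) * b"] norm_triangle_ineq4[of a "of_real (k * sgn x) * b"]
      by (simp_all add: distrib_right)
  qed
  have "cmod (hermitian (A_coeff k x *v G) H)
      \<le> (1 + \<bar>k\<bar>) * norm G * norm H + (1 + \<bar>k\<bar>) * norm G * norm H"
    unfolding hermitian_A_coeff
    by (intro order_trans[OF norm_triangle_ineq] add_mono)
      (simp_all only: norm_mult complex_mod_cnj, (intro mult_mono * norm_vec2_le; simp)+)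
  then show ?thesis by (simp add: algebra_simps)
qed

text \<open>With s = k sgn x the antisymmetric part contributes s times the difference of
  \<open>G $ 2 * cnj (G $ 1)\<close> and its conjugate, which is purely imaginary. The form is
  therefore coercive with constant 1 for every k.\<close>

lemma Re_hermitian_A_coeff_self: "Re (hermitian (A_coeff k x *v G) G) = (norm G)\<^sup>2"
  unfolding hermitian_A_coeff norm_vec2_power2
  by (simp add: cmod_power2) (simp add: power2_eq_square algebra_simps)

lemma measurable_vec_nth [measurable]:
  "G \<in> borel_measurable M \<Longrightarrow> (\<lambda>p. (G p :: complex ^ 2) $ i) \<in> borel_measurable M"
  by (rule borel_measurable_continuous_on[where f = "\<lambda>v. v $ i"]) (auto intro: continuous_intros)

lemma borel_imp_lebH: "f \<in> borel_measurable borel \<Longrightarrow> f \<in> borel_measurable lebH"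
  by (intro measurable_restrict_space1 measurable_completion) simp

lemma measurable_cnj [measurable]: "cnj \<in> borel_measurable borel"
  by (intro borel_measurable_continuous_onI continuous_intros)

lemma hermitian_A_measurable:
  assumes [measurable]: "G \<in> borel_measurable lebH" "H \<in> borel_measurable lebH"
  shows "(\<lambda>p. hermitian (A_coeff k (snd p) *v G p) (H p)) \<in> borel_measurable lebH"
proof -
  define s where "s p = complex_of_real (k * sgn (snd p))" for p :: "real \<times> real"
  have "s \<in> borel_measurable borel" unfolding s_def[abs_def] borel_prod[symmetric] by measurable
  then have [measurable]: "s \<in> borel_measurable lebH" by (rule borel_imp_lebH)
  show ?thesis
    unfolding hermitian_A_coeff s_def[symmetric] by measurable
qed

definition square_integrable :: "(real \<times> real \<Rightarrow> complex ^ 2) \<Rightarrow> bool" where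
  "square_integrable G \<longleftrightarrow> G \<in> borel_measurable lebH \<and> integrable lebH (\<lambda>p. (norm (G p))\<^sup>2)"

lemma square_integrable_iff_nn:
  "square_integrable G \<longleftrightarrow> G \<in> borel_measurable lebH \<and> (\<integral>\<^sup>+p. ennreal ((norm (G p))\<^sup>2) \<partial>lebH) < \<infinity>"
  unfolding square_integrable_def integrable_iff_bounded by auto

lemma norm_add_power2_le: "(norm (a + b :: 'a::real_normed_vector))\<^sup>2 \<le> 2 * (norm a)\<^sup>2 + 2 * (norm b)\<^sup>2"
proof -
  have "(norm (a + b))\<^sup>2 \<le> (norm a + norm b)\<^sup>2"
    by (intro power_mono norm_triangle_ineq) auto
  also have "\<dots> \<le> 2 * (norm a)\<^sup>2 + 2 * (norm b)\<^sup>2"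
    using sum_squares_ge_zero[of "norm a - norm b" 0] by (simp add: power2_eq_square algebra_simps)
  finally show ?thesis .
qed

lemma square_integrable_add:
  assumes "square_integrable G" "square_integrable H"
  shows "square_integrable (\<lambda>p. G p + H p)"
proof -
  have [measurable]: "G \<in> borel_measurable lebH" "H \<in> borel_measurable lebH"
    using assms by (auto simp: square_integrable_def)
  have "integrable lebH (\<lambda>p. (norm (G p + H p))\<^sup>2)"
  proof (rule Bochner_Integration.integrable_bound)
    show "integrable lebH (\<lambda>p. 2 * (norm (G p))\<^sup>2 + 2 * (norm (H p))\<^sup>2)"
      using assms by (auto simp: square_integrable_def)
  qed (auto intro!: AE_I2 norm_add_power2_le)
  then show ?thesis by (simp add: square_integrable_def)
qed

lemma square_integrable_smult:
  assumes "square_integrable G"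
  shows "square_integrable (\<lambda>p. c *s G p)"
proof -
  have [measurable]: "G \<in> borel_measurable lebH"
    using assms by (auto simp: square_integrable_def)
  have "(\<lambda>p. c *s G p) \<in> borel_measurable lebH"
    by (rule borel_measurable_continuous_on[where f = "\<lambda>v. c *s v"])
      (auto simp: vector_scalar_mult_def intro!: continuous_intros)
  then show ?thesis
    using assms by (simp add: square_integrable_def norm_smult_vec2 power_mult_distrib)
qed

lemma square_integrable_diff:
  assumes "square_integrable G" "square_integrable H"
  shows "square_integrable (\<lambda>p. G p - H p)"
  using square_integrable_add[OF assms(1) square_integrable_smult[OF assms(2), of "- 1"]] by simp

lemma norm_mult_integrable:
  assumes "square_integrable G" "square_integrable H"
  shows "integrable lebH (\<lambda>p. norm (G p) * norm (H p))"
proof (rule Bochner_Integration.integrable_bound)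
  show "integrable lebH (\<lambda>p. (norm (G p))\<^sup>2 + (norm (H p))\<^sup>2)"
    using assms by (auto simp: square_integrable_def)
  show "AE p in lebH. norm (norm (G p) * norm (H p)) \<le> norm ((norm (G p))\<^sup>2 + (norm (H p))\<^sup>2)"
  proof (rule AE_I2)
    fix p
    have "2 * (norm (G p) * norm (H p)) \<le> (norm (G p))\<^sup>2 + (norm (H p))\<^sup>2"
      using sum_squares_bound[of "norm (G p)" "norm (H p)"] by (simp add: mult.assoc)
    then have "norm (G p) * norm (H p) \<le> (norm (G p))\<^sup>2 + (norm (H p))\<^sup>2"
      using mult_nonneg_nonneg[OF norm_ge_zero norm_ge_zero, of "G p" "H p"] by linarith
    then show "norm (norm (G p) * norm (H p)) \<le> norm ((norm (G p))\<^sup>2 + (norm (H p))\<^sup>2)"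
      by simp
  qed
  show "(\<lambda>p. norm (G p) * norm (H p)) \<in> borel_measurable lebH"
    using assms by (auto simp: square_integrable_def)
qed

lemma hermitian_A_integrable:
  assumes "square_integrable G" "square_integrable H"
  shows "integrable lebH (\<lambda>p. hermitian (A_coeff k (snd p) *v G p) (H p))"
proof (rule Bochner_Integration.integrable_bound)
  show "integrable lebH (\<lambda>p. 2 * (1 + \<bar>k\<bar>) * (norm (G p) * norm (H p)))"
    by (intro integrable_mult_right norm_mult_integrable assms)
  show "AE p in lebH. norm (hermitian (A_coeff k (snd p) *v G p) (H p)) \<le> norm (2 * (1 + \<bar>k\<bar>) * (norm (G p) * norm (H p)))"
    using hermitian_A_coeff_bound by (intro AE_I2) (simp add: abs_mult)
  show "(\<lambda>p. hermitian (A_coeff k (snd p) *v G p) (H p)) \<in> borel_measurable lebH"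
    using assms by (intro hermitian_A_measurable) (auto simp: square_integrable_def)
qed

lemma A_form_add_left:
  assumes "square_integrable G" "square_integrable G'" "square_integrable H"
  shows "A_form k (\<lambda>p. G p + c *s G' p) H = A_form k G H + c * A_form k G' H"
proof -
  have "A_form k (\<lambda>p. G p + c *s G' p) H = (\<integral>p. hermitian (A_coeff k (snd p) *v G p) (H p)
      + c * hermitian (A_coeff k (snd p) *v G' p) (H p) \<partial>lebH)"
    unfolding A_form_def hermitian_A_coeff
    by (intro Bochner_Integration.integral_cong refl) (simp add: algebra_simps)
  then show ?thesis
    using hermitian_A_integrable[OF assms(1,3)] hermitian_A_integrable[OF assms(2,3)]
    by (simp add: A_form_def)
qed

lemma A_form_diff_right:
  assumes "square_integrable G" "square_integrable H" "square_integrable H'"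
  shows "A_form k G (\<lambda>p. H p - H' p) = A_form k G H - A_form k G H'"
proof -
  have "A_form k G (\<lambda>p. H p - H' p) = (\<integral>p. hermitian (A_coeff k (snd p) *v G p) (H p)
      - hermitian (A_coeff k (snd p) *v G p) (H' p) \<partial>lebH)"
    unfolding A_form_def hermitian_A_coeff
    by (intro Bochner_Integration.integral_cong refl) (simp add: algebra_simps)
  then show ?thesis
    using hermitian_A_integrable[OF assms(1,2)] hermitian_A_integrable[OF assms(1,3)]
    by (simp add: A_form_def)
qed

text \<open>Young's inequality with a free weight e. Letting e tend to 0 more slowly than the second
  energy gives continuity in the second argument.\<close>

lemma A_form_bound:
  assumes "square_integrable G" "square_integrable H" "0 < e"
  shows "cmod (A_form k G H)
    \<le> (1 + \<bar>k\<bar>) * (e * (\<integral>p. (norm (G p))\<^sup>2 \<partial>lebH) + (\<integral>p. (norm (H p))\<^sup>2 \<partial>lebH) / e)"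
proof -
  have i: "integrable lebH (\<lambda>p. (norm (G p))\<^sup>2)" "integrable lebH (\<lambda>p. (norm (H p))\<^sup>2)"
    using assms by (auto simp: square_integrable_def)
  have "cmod (A_form k G H) \<le> (\<integral>p. (1 + \<bar>k\<bar>) * (e * (norm (G p))\<^sup>2 + (norm (H p))\<^sup>2 / e) \<partial>lebH)"
    unfolding A_form_def
  proof (rule Bochner_Integration.integral_norm_bound_integral)
    show "cmod (hermitian (A_coeff k (snd p) *v G p) (H p)) \<le> (1 + \<bar>k\<bar>) * (e * (norm (G p))\<^sup>2 + (norm (H p))\<^sup>2 / e)" for p
    proof -
      have "2 * (norm (G p) * norm (H p)) \<le> e * (norm (G p))\<^sup>2 + (norm (H p))\<^sup>2 / e"
      proof -
        have "0 \<le> (e * norm (G p) - norm (H p))\<^sup>2 / e" using assms(3) by simp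
        also have "\<dots> = e * (norm (G p))\<^sup>2 + (norm (H p))\<^sup>2 / e - 2 * (norm (G p) * norm (H p))"
          using assms(3) by (simp add: power2_eq_square field_simps)
        finally show ?thesis by simp
      qed
      then have "(1 + \<bar>k\<bar>) * (2 * (norm (G p) * norm (H p))) \<le> (1 + \<bar>k\<bar>) * (e * (norm (G p))\<^sup>2 + (norm (H p))\<^sup>2 / e)"
        by (intro mult_left_mono) auto
      then show ?thesis
        using hermitian_A_coeff_bound[of k "snd p" "G p" "H p"] by linarith
    qed
  qed (use i assms in \<open>auto intro!: hermitian_A_integrable\<close>)
  also have "\<dots> = (1 + \<bar>k\<bar>) * (e * (\<integral>p. (norm (G p))\<^sup>2 \<partial>lebH) + (\<integral>p. (norm (H p))\<^sup>2 \<partial>lebH) / e)"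
    using i by simp
  finally show ?thesis .
qed

lemma A_form_tendsto:
  assumes "square_integrable G" "square_integrable H" "\<And>n. square_integrable (Hs n)"
    and "(\<lambda>n. \<integral>p. (norm (Hs n p - H p))\<^sup>2 \<partial>lebH) \<longlonglongrightarrow> 0"
  shows "(\<lambda>n. A_form k G (Hs n)) \<longlonglongrightarrow> A_form k G H"
proof -
  define d where "d n = (\<integral>p. (norm (Hs n p - H p))\<^sup>2 \<partial>lebH)" for n
  \<comment> \<open>The weight dominates the square root of d, so that d / e \<le> e; the second
    summand keeps it positive when d vanishes.\<close>
  define e where "e n = sqrt (d n) + inverse (real (Suc n))" for n
  have d: "0 \<le> d n" for n by (simp add: d_def)
  have e: "0 < e n" "d n / e n \<le> e n" for n
  proof -
    show "0 < e n" using d[of n] by (auto simp: e_def intro!: add_nonneg_pos)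
    have "sqrt (d n) \<le> e n" by (simp add: e_def)
    then have "(sqrt (d n))\<^sup>2 \<le> (e n)\<^sup>2" using d by (intro power_mono) auto
    then show "d n / e n \<le> e n" using \<open>0 < e n\<close> d by (simp add: field_simps power2_eq_square)
  qed
  have "e \<longlonglongrightarrow> sqrt 0 + 0"
    unfolding e_def[abs_def] using assms(4)
    by (intro tendsto_add LIMSEQ_inverse_real_of_nat tendsto_real_sqrt) (simp add: d_def[abs_def])
  then have e0: "e \<longlonglongrightarrow> 0" by simp
  define C where "C = (\<integral>p. (norm (G p))\<^sup>2 \<partial>lebH)"
  have "(\<lambda>n. A_form k G (Hs n) - A_form k G H) \<longlonglongrightarrow> 0"
  proof (rule Lim_null_comparison)
    show "\<forall>\<^sub>F n in sequentially. norm (A_form k G (Hs n) - A_form k G H) \<le> (1 + \<bar>k\<bar>) * (e n * C + e n)"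
    proof (rule always_eventually, rule allI)
      fix n
      have "cmod (A_form k G (\<lambda>p. Hs n p - H p)) \<le> (1 + \<bar>k\<bar>) * (e n * C + d n / e n)"
        unfolding C_def d_def by (intro A_form_bound square_integrable_diff assms e)
      also have "\<dots> \<le> (1 + \<bar>k\<bar>) * (e n * C + e n)"
        using e(2)[of n] by (intro mult_left_mono) auto
      finally show "norm (A_form k G (Hs n) - A_form k G H) \<le> (1 + \<bar>k\<bar>) * (e n * C + e n)"
        using A_form_diff_right[OF assms(1) assms(3) assms(2)] by simp
    qed
    have "(\<lambda>n. (1 + \<bar>k\<bar>) * (e n * C + e n)) \<longlonglongrightarrow> (1 + \<bar>k\<bar>) * (0 * C + 0)"
      by (intro tendsto_intros e0)
    then show "(\<lambda>n. (1 + \<bar>k\<bar>) * (e n * C + e n)) \<longlonglongrightarrow> 0" by simp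
  qed
  then show ?thesis by (simp add: LIM_zero_iff)
qed

section \<open>Gradients of test functions and limits of approximating sequences\<close>

lemma grad_nth: "grad f p $ 1 = frechet_derivative f (at p) (1, 0)" "grad f p $ 2 = frechet_derivative f (at p) (0, 1)"
  by (simp_all add: grad_def)

lemma grad_continuous:
  assumes "smooth_on UNIV f"
  shows "continuous_on S (grad f)"
proof -
  have "continuous_on UNIV (\<lambda>p. frechet_derivative f (at p) b)" if "b \<in> Basis" for b
    using smooth_on_imp_continuous_on[OF smooth_on_frechet_derivative[OF assms that]] .
  then have "continuous_on UNIV (\<lambda>p. frechet_derivative f (at p) (1, 0))"
    "continuous_on UNIV (\<lambda>p. frechet_derivative f (at p) (0, 1))"
    by (auto simp: Basis_prod_def)
  then have c: "continuous_on UNIV (\<lambda>p. if i = 1 then frechet_derivative f (at p) (1, 0)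
      else frechet_derivative f (at p) (0, 1))" for i :: 2
    by (cases "i = 1") simp_all
  have "continuous_on UNIV (\<lambda>p. (\<chi> i. if i = 1 then frechet_derivative f (at p) (1, 0)
      else frechet_derivative f (at p) (0, 1)) :: complex ^ 2)"
    by (intro continuous_on_vec_lambda c)
  moreover have "grad f = (\<lambda>p. \<chi> i. if i = 1 then frechet_derivative f (at p) (1, 0)
      else frechet_derivative f (at p) (0, 1))"
    by (rule ext) (simp add: vec2_eq_iff grad_nth)
  ultimately have "continuous_on UNIV (grad f)" by simp
  then show ?thesis by (rule continuous_on_subset) auto
qed

lemma grad_eq_0:
  assumes "closed K" "\<And>q. q \<notin> K \<Longrightarrow> f q = 0" "p \<notin> K"
  shows "grad f p = 0"
proof -
  have "((\<lambda>_. 0) has_derivative (\<lambda>_. 0)) (at p)" by simp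
  then have "(f has_derivative (\<lambda>_. 0)) (at p)"
    by (rule has_derivative_transform_within_open[where s = "- K"]) (use assms in auto)
  then have "frechet_derivative f (at p) = (\<lambda>_. 0)"
    by (rule frechet_derivative_at[symmetric])
  then show ?thesis by (simp add: vec2_eq_iff grad_nth)
qed

lemma continuous_compact_bounded:
  fixes f :: "real \<times> real \<Rightarrow> 'b::real_normed_vector"
  assumes "continuous_on UNIV f" "compact K"
  obtains C where "\<And>p. p \<in> K \<Longrightarrow> norm (f p) \<le> C"
proof -
  have "compact (f ` K)" by (intro compact_continuous_image continuous_on_subset[OF assms(1)] assms(2)) auto
  then show ?thesis using that compact_imp_bounded by (force simp: bounded_iff)
qed

lemma continuous_measurable_lebH:
  "continuous_on UNIV f \<Longrightarrow> (f :: real \<times> real \<Rightarrow> 'b::real_normed_vector) \<in> borel_measurable lebH"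
  by (rule continuous_imp_measurable_on_sets_lebesgue[OF continuous_on_subset halfplane_measurable(1)]) auto

lemma compact_indicator_integrable:
  assumes "compact K" "K \<subseteq> halfplane"
  shows "integrable lebH (\<lambda>p. C * indicator K p :: real)"
proof (rule integrable_mult_right)
  have "integrable lebesgue (indicator K :: real \<times> real \<Rightarrow> real)"
    using lmeasurable_compact[OF assms(1)] by (auto simp: fmeasurable_def intro!: integrable_real_indicator)
  then have "set_integrable lebesgue halfplane (indicator K :: real \<times> real \<Rightarrow> real)"
    unfolding set_integrable_def by (rule integrable_mult_indicator[OF halfplane_measurable(1)])
  then show "integrable lebH (indicator K :: real \<times> real \<Rightarrow> real)"
    using halfplane_measurable by (simp add: set_integrable_def integrable_restrict_space)
qed

lemma grad_square_integrable:
  assumes "test_function \<Omega> f"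
  shows "square_integrable (grad f)"
proof -
  obtain K where f: "smooth_on UNIV f" "compact K" "\<And>p. p \<notin> K \<Longrightarrow> f p = 0"
    using test_functionE[OF assms] by metis
  obtain C where C: "\<And>p. p \<in> K \<Longrightarrow> norm (grad f p) \<le> C"
    using continuous_compact_bounded[OF grad_continuous[OF f(1)] f(2)] by blast
  have [measurable]: "grad f \<in> borel_measurable lebH"
    by (rule continuous_measurable_lebH[OF grad_continuous[OF f(1)]])
  have "integrable lebesgue (indicator K :: real \<times> real \<Rightarrow> real)"
    using lmeasurable_compact[OF f(2)] by (auto simp: fmeasurable_def intro!: integrable_real_indicator)
  then have "set_integrable lebesgue halfplane (indicator K :: real \<times> real \<Rightarrow> real)"
    unfolding set_integrable_def by (rule integrable_mult_indicator[OF halfplane_measurable(1)])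
  then have i: "integrable lebH (\<lambda>p. C\<^sup>2 * indicator K p :: real)"
    using halfplane_measurable by (intro integrable_mult_right) (simp add: set_integrable_def integrable_restrict_space)
  have "integrable lebH (\<lambda>p. (norm (grad f p))\<^sup>2)"
  proof (rule Bochner_Integration.integrable_bound[OF i])
    show "AE p in lebH. norm ((norm (grad f p))\<^sup>2) \<le> norm (C\<^sup>2 * indicator K p :: real)"
      using C grad_eq_0[OF compact_imp_closed[OF f(2)] f(3)]
      by (intro AE_I2) (auto simp: indicator_def intro!: power_mono)
  qed measurable
  then show ?thesis by (simp add: square_integrable_def)
qed

text \<open>Square integrability of G is a consequence of the approximation: for some n the gradient
  of the approximant has finite energy and differs from G by a field of finite energy. After that
  the nonnegative integrals can be replaced by real ones.\<close>

lemma Hdot10D: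
  assumes "Hdot10 V G"
  obtains \<phi> where "square_integrable G" "\<And>n. test_function halfplane (\<phi> n)"
    "(\<lambda>n. \<integral>p. (norm (grad (\<phi> n) p - G p))\<^sup>2 \<partial>lebH) \<longlonglongrightarrow> 0"
    "(\<lambda>n. \<integral>\<^sup>+p. ennreal ((norm (grad (\<phi> n) p - G p))\<^sup>2) \<partial>lebH) \<longlonglongrightarrow> 0"
    "\<And>K. compact K \<Longrightarrow> K \<subseteq> halfplane \<Longrightarrow>
      (\<lambda>n. \<integral>\<^sup>+p. ennreal ((norm (\<phi> n p - V p))\<^sup>2) \<partial>(lebesgue_on K)) \<longlonglongrightarrow> 0"
proof -
  obtain \<phi> where [measurable]: "G \<in> borel_measurable lebH" and t: "\<And>n. test_function halfplane (\<phi> n)"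
    and l: "(\<lambda>n. \<integral>\<^sup>+p. ennreal ((norm (grad (\<phi> n) p - G p))\<^sup>2) \<partial>lebH) \<longlonglongrightarrow> 0"
    and K: "\<And>K. compact K \<Longrightarrow> K \<subseteq> halfplane \<Longrightarrow>
      (\<lambda>n. \<integral>\<^sup>+p. ennreal ((norm (\<phi> n p - V p))\<^sup>2) \<partial>(lebesgue_on K)) \<longlonglongrightarrow> 0"
    using assms unfolding Hdot10_def by blast
  have [measurable]: "grad (\<phi> n) \<in> borel_measurable lebH" for n
    using grad_square_integrable[OF t] by (auto simp: square_integrable_def)
  have "\<forall>\<^sub>F n in sequentially. (\<integral>\<^sup>+p. ennreal ((norm (grad (\<phi> n) p - G p))\<^sup>2) \<partial>lebH) < 1"
    using order_tendstoD(2)[OF l, of 1] by simp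
  then obtain n where "(\<integral>\<^sup>+p. ennreal ((norm (grad (\<phi> n) p - G p))\<^sup>2) \<partial>lebH) < 1"
    by (auto simp: eventually_sequentially)
  then have "square_integrable (\<lambda>p. grad (\<phi> n) p - G p)"
    unfolding square_integrable_iff_nn by (auto elim!: order.strict_trans)
  from square_integrable_diff[OF grad_square_integrable[OF t[of n]] this]
  have G: "square_integrable G" by simp
  have eq: "(\<integral>\<^sup>+p. ennreal ((norm (grad (\<phi> n) p - G p))\<^sup>2) \<partial>lebH)
      = ennreal (\<integral>p. (norm (grad (\<phi> n) p - G p))\<^sup>2 \<partial>lebH)" for n
    using square_integrable_diff[OF grad_square_integrable[OF t[of n]] G]
    by (intro nn_integral_eq_integral) (auto simp: square_integrable_def)
  have "(\<lambda>n. ennreal (\<integral>p. (norm (grad (\<phi> n) p - G p))\<^sup>2 \<partial>lebH)) \<longlonglongrightarrow> ennreal 0"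
    using l unfolding eq by simp
  then have "(\<lambda>n. \<integral>p. (norm (grad (\<phi> n) p - G p))\<^sup>2 \<partial>lebH) \<longlonglongrightarrow> 0"
    by (subst (asm) tendsto_ennreal_iff) auto
  with G t l K show ?thesis using that by blast
qed

text \<open>Density of the test functions, by continuity of the form; here the field must already be
  known to have finite energy.\<close>

lemma A_form_Hdot10_eq:
  assumes "square_integrable G" "\<And>\<phi>. test_function halfplane \<phi> \<Longrightarrow> A_form k G (grad \<phi>) = 0" "Hdot10 V H"
  shows "A_form k G H = 0"
proof -
  obtain \<phi> where *: "square_integrable H" "\<And>n. test_function halfplane (\<phi> n)"
    "(\<lambda>n. \<integral>p. (norm (grad (\<phi> n) p - H p))\<^sup>2 \<partial>lebH) \<longlonglongrightarrow> 0"
    by (rule Hdot10D[OF assms(3)]; rule that; assumption)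
  have "(\<lambda>n. A_form k G (grad (\<phi> n))) \<longlonglongrightarrow> A_form k G H"
    using A_form_tendsto[OF assms(1) *(1) grad_square_integrable[OF *(2)] *(3)] .
  then have "(\<lambda>n. 0 :: complex) \<longlonglongrightarrow> A_form k G H"
    using assms(2)[OF *(2)] by (simp only:)
  then show ?thesis by (simp add: LIMSEQ_const_iff)
qed

lemma Hdot10_measurable:
  assumes "Hdot10 V G"
  shows "V \<in> borel_measurable lebH" "G \<in> borel_measurable lebH"
  using assms by (auto simp: Hdot10_def)

lemma test_function_smooth_on: "test_function \<Omega> f \<Longrightarrow> smooth_on UNIV f"
  by (simp add: test_function_def smooth_eq_smooth_on)

lemma test_function_has_derivative:
  "test_function \<Omega> f \<Longrightarrow> (f has_derivative frechet_derivative f (at p)) (at p)"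
  using smooth_on_has_derivative test_function_smooth_on by blast

lemma test_function_lincomb:
  fixes f g :: "real \<times> real \<Rightarrow> complex"
  assumes "test_function \<Omega> f" "test_function \<Omega> g"
  shows "test_function \<Omega> (\<lambda>p. f p + c * g p)"
    and "grad (\<lambda>p. f p + c * g p) = (\<lambda>p. grad f p + c *s grad g p)"
proof -
  obtain K where f: "smooth_on UNIV f" "compact K" "K \<subseteq> \<Omega>" "\<And>p. p \<notin> K \<Longrightarrow> f p = 0"
    using test_functionE[OF assms(1)] by metis
  obtain K' where g: "smooth_on UNIV g" "compact K'" "K' \<subseteq> \<Omega>" "\<And>p. p \<notin> K' \<Longrightarrow> g p = 0"
    using test_functionE[OF assms(2)] by metis
  have s: "smooth_on UNIV (\<lambda>p. f p + c * g p)"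
    by (intro smooth_on_add smooth_on_mult smooth_on_const f g) auto
  have "test_function UNIV (\<lambda>p. f p + c * g p)"
    by (rule test_functionI[OF s, where K = "K \<union> K'"]) (use f g in auto)
  moreover have "closure {p. f p + c * g p \<noteq> 0} \<subseteq> K \<union> K'"
  proof (rule closure_minimal)
    show "{p. f p + c * g p \<noteq> 0} \<subseteq> K \<union> K'" using f(4) g(4) by fastforce
    show "closed (K \<union> K')" by (intro closed_Un compact_imp_closed f(2) g(2))
  qed
  ultimately show "test_function \<Omega> (\<lambda>p. f p + c * g p)"
    using f(3) g(3) by (auto simp: test_function_def)
  show "grad (\<lambda>p. f p + c * g p) = (\<lambda>p. grad f p + c *s grad g p)"
  proof
    fix p
    have "((\<lambda>p. f p + c * g p) has_derivative
        (\<lambda>h. frechet_derivative f (at p) h + c * frechet_derivative g (at p) h)) (at p)"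
      using test_function_has_derivative[OF assms(1)] test_function_has_derivative[OF assms(2)]
      by (intro has_derivative_add has_derivative_mult_right) auto
    from frechet_derivative_at[OF this, symmetric]
    show "grad (\<lambda>p. f p + c * g p) p = grad f p + c *s grad g p"
      by (simp add: vec2_eq_iff grad_nth)
  qed
qed

lemma nn_norm_lincomb_le:
  fixes f g :: "_ \<Rightarrow> 'b::real_normed_vector"
  assumes [measurable]: "(\<lambda>p. norm (f p)) \<in> borel_measurable M" "(\<lambda>p. norm (g p)) \<in> borel_measurable M"
    and "\<And>p. p \<in> space M \<Longrightarrow> norm (h p) \<le> norm (f p) + c * norm (g p)" "0 \<le> c"
  shows "(\<integral>\<^sup>+p. ennreal ((norm (h p :: 'b))\<^sup>2) \<partial>M)
    \<le> 2 * (\<integral>\<^sup>+p. ennreal ((norm (f p))\<^sup>2) \<partial>M) + ennreal (2 * c\<^sup>2) * (\<integral>\<^sup>+p. ennreal ((norm (g p))\<^sup>2) \<partial>M)"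
proof -
  have "(\<integral>\<^sup>+p. ennreal ((norm (h p))\<^sup>2) \<partial>M)
      \<le> (\<integral>\<^sup>+p. 2 * ennreal ((norm (f p))\<^sup>2) + ennreal (2 * c\<^sup>2) * ennreal ((norm (g p))\<^sup>2) \<partial>M)"
  proof (rule nn_integral_mono)
    fix p assume "p \<in> space M"
    have "(norm (h p))\<^sup>2 \<le> (norm (f p) + c * norm (g p))\<^sup>2"
      using assms(3)[OF \<open>p \<in> space M\<close>] by (intro power_mono) auto
    also have "\<dots> \<le> 2 * (norm (f p))\<^sup>2 + 2 * (c * norm (g p))\<^sup>2"
      using norm_add_power2_le[of "norm (f p)" "c * norm (g p)"] assms(4) by simp
    finally have "(norm (h p))\<^sup>2 \<le> 2 * (norm (f p))\<^sup>2 + 2 * c\<^sup>2 * (norm (g p))\<^sup>2"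
      by (simp add: power_mult_distrib)
    then have "ennreal ((norm (h p))\<^sup>2) \<le> ennreal (2 * (norm (f p))\<^sup>2 + 2 * c\<^sup>2 * (norm (g p))\<^sup>2)"
      by (rule ennreal_leI)
    also have "\<dots> = 2 * ennreal ((norm (f p))\<^sup>2) + ennreal (2 * c\<^sup>2) * ennreal ((norm (g p))\<^sup>2)"
      by (simp add: ennreal_mult'' flip: ennreal_numeral)
    finally show "ennreal ((norm (h p))\<^sup>2) \<le> 2 * ennreal ((norm (f p))\<^sup>2) + ennreal (2 * c\<^sup>2) * ennreal ((norm (g p))\<^sup>2)" .
  qed
  also have "\<dots> = 2 * (\<integral>\<^sup>+p. ennreal ((norm (f p))\<^sup>2) \<partial>M) + ennreal (2 * c\<^sup>2) * (\<integral>\<^sup>+p. ennreal ((norm (g p))\<^sup>2) \<partial>M)"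
    by (subst nn_integral_add) (auto simp: nn_integral_cmult)
  finally show ?thesis .
qed

lemma lebesgue_on_mono_measurable:
  assumes "f \<in> borel_measurable (lebesgue_on S)" "T \<subseteq> S" "S \<in> sets lebesgue"
  shows "f \<in> borel_measurable (lebesgue_on T)"
  using measurable_restrict_mono[OF assms(1,2)] .

lemma ennreal_squeeze_0:
  fixes f g :: "nat \<Rightarrow> ennreal"
  assumes "g \<longlonglongrightarrow> 0" "\<forall>\<^sub>F n in sequentially. f n \<le> g n"
  shows "f \<longlonglongrightarrow> 0"
  by (rule tendsto_sandwich[OF _ assms(2) tendsto_const assms(1)]) auto

lemma tendsto_ennreal_lincomb_0:
  fixes f g :: "nat \<Rightarrow> ennreal"
  assumes "f \<longlonglongrightarrow> 0" "g \<longlonglongrightarrow> 0"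
  shows "(\<lambda>n. 2 * f n + ennreal c * g n) \<longlonglongrightarrow> 0"
proof -
  have "(\<lambda>n. 2 * f n + ennreal c * g n) \<longlonglongrightarrow> 2 * 0 + ennreal c * 0"
    by (intro tendsto_add ennreal_tendsto_cmult assms) auto
  then show ?thesis by simp
qed

lemma Hdot10_lincomb:
  assumes "Hdot10 V G" "Hdot10 V' G'"
  shows "Hdot10 (\<lambda>p. V p + c * V' p) (\<lambda>p. G p + c *s G' p)"
proof -
  obtain \<phi> where 1: "square_integrable G" "\<And>n. test_function halfplane (\<phi> n)"
    "(\<lambda>n. \<integral>\<^sup>+p. ennreal ((norm (grad (\<phi> n) p - G p))\<^sup>2) \<partial>lebH) \<longlonglongrightarrow> 0"
    "\<And>K. compact K \<Longrightarrow> K \<subseteq> halfplane \<Longrightarrow>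
      (\<lambda>n. \<integral>\<^sup>+p. ennreal ((norm (\<phi> n p - V p))\<^sup>2) \<partial>(lebesgue_on K)) \<longlonglongrightarrow> 0"
    by (rule Hdot10D[OF assms(1)]; rule that; assumption)
  obtain \<phi>' where 2: "square_integrable G'" "\<And>n. test_function halfplane (\<phi>' n)"
    "(\<lambda>n. \<integral>\<^sup>+p. ennreal ((norm (grad (\<phi>' n) p - G' p))\<^sup>2) \<partial>lebH) \<longlonglongrightarrow> 0"
    "\<And>K. compact K \<Longrightarrow> K \<subseteq> halfplane \<Longrightarrow>
      (\<lambda>n. \<integral>\<^sup>+p. ennreal ((norm (\<phi>' n p - V' p))\<^sup>2) \<partial>(lebesgue_on K)) \<longlonglongrightarrow> 0"
    by (rule Hdot10D[OF assms(2)]; rule that; assumption)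
  note [measurable] = Hdot10_measurable[OF assms(1)] Hdot10_measurable[OF assms(2)]
  have [measurable]: "grad (\<phi> n) \<in> borel_measurable lebH" "grad (\<phi>' n) \<in> borel_measurable lebH" for n
    using grad_square_integrable[OF 1(2)] grad_square_integrable[OF 2(2)] by (auto simp: square_integrable_def)
  have mm [measurable]: "\<phi> n \<in> borel_measurable lebH" "\<phi>' n \<in> borel_measurable lebH" for n
    using smooth_on_imp_continuous_on test_function_smooth_on 1(2) 2(2) by (blast intro: continuous_measurable_lebH)+
  let ?\<phi> = "\<lambda>n p. \<phi> n p + c * \<phi>' n p"
  note t = test_function_lincomb[OF 1(2) 2(2)]
  show ?thesis
    unfolding Hdot10_def
  proof (intro conjI exI[of _ ?\<phi>] allI impI)
    show "(\<lambda>p. V p + c * V' p) \<in> borel_measurable lebH" by measurable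
    have "square_integrable (\<lambda>p. G p + c *s G' p)"
      by (intro square_integrable_add square_integrable_smult 1 2)
    then show "(\<lambda>p. G p + c *s G' p) \<in> borel_measurable lebH" by (simp add: square_integrable_def)
    show "test_function halfplane (?\<phi> n)" for n by (rule t(1))
    show "(\<lambda>n. \<integral>\<^sup>+p. ennreal ((norm (grad (?\<phi> n) p - (G p + c *s G' p)))\<^sup>2) \<partial>lebH) \<longlonglongrightarrow> 0"
    proof (rule ennreal_squeeze_0[OF tendsto_ennreal_lincomb_0[OF 1(3) 2(3), of "2 * (cmod c)\<^sup>2"]], intro always_eventually allI)
      fix n
      have e: "grad (?\<phi> n) p - (G p + c *s G' p) = (grad (\<phi> n) p - G p) + c *s (grad (\<phi>' n) p - G' p)" for p
        unfolding t(2) by (simp add: vec2_eq_iff algebra_simps)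
      show "(\<integral>\<^sup>+p. ennreal ((norm (grad (?\<phi> n) p - (G p + c *s G' p)))\<^sup>2) \<partial>lebH)
          \<le> 2 * (\<integral>\<^sup>+p. ennreal ((norm (grad (\<phi> n) p - G p))\<^sup>2) \<partial>lebH)
            + ennreal (2 * (cmod c)\<^sup>2) * (\<integral>\<^sup>+p. ennreal ((norm (grad (\<phi>' n) p - G' p))\<^sup>2) \<partial>lebH)"
        unfolding e
      proof (rule nn_norm_lincomb_le)
        show "norm (grad (\<phi> n) p - G p + c *s (grad (\<phi>' n) p - G' p))
            \<le> norm (grad (\<phi> n) p - G p) + cmod c * norm (grad (\<phi>' n) p - G' p)" for p
          using norm_triangle_ineq[of "grad (\<phi> n) p - G p" "c *s (grad (\<phi>' n) p - G' p)"]
          by (simp only: norm_smult_vec2)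
      qed auto
    qed
    fix K :: "(real \<times> real) set" assume "compact K \<and> K \<subseteq> halfplane"
    then have K: "compact K" "K \<subseteq> halfplane" by auto
    note m = lebesgue_on_mono_measurable[OF _ K(2) halfplane_measurable(1)]
    have [measurable]: "V \<in> borel_measurable (lebesgue_on K)" "V' \<in> borel_measurable (lebesgue_on K)"
      "\<phi> n \<in> borel_measurable (lebesgue_on K)" "\<phi>' n \<in> borel_measurable (lebesgue_on K)" for n
      using m Hdot10_measurable[OF assms(1)] Hdot10_measurable[OF assms(2)] mm by blast+
    show "(\<lambda>n. \<integral>\<^sup>+p. ennreal ((norm (?\<phi> n p - (V p + c * V' p)))\<^sup>2) \<partial>(lebesgue_on K)) \<longlonglongrightarrow> 0"
    proof (rule ennreal_squeeze_0[OF tendsto_ennreal_lincomb_0[OF 1(4)[OF K] 2(4)[OF K], of "2 * (cmod c)\<^sup>2"]], intro always_eventually allI)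
      fix n
      have e: "?\<phi> n p - (V p + c * V' p) = (\<phi> n p - V p) + c * (\<phi>' n p - V' p)" for p
        by (simp add: algebra_simps)
      show "(\<integral>\<^sup>+p. ennreal ((norm (?\<phi> n p - (V p + c * V' p)))\<^sup>2) \<partial>(lebesgue_on K))
          \<le> 2 * (\<integral>\<^sup>+p. ennreal ((norm (\<phi> n p - V p))\<^sup>2) \<partial>(lebesgue_on K))
            + ennreal (2 * (cmod c)\<^sup>2) * (\<integral>\<^sup>+p. ennreal ((norm (\<phi>' n p - V' p))\<^sup>2) \<partial>(lebesgue_on K))"
        unfolding e by (rule nn_norm_lincomb_le) (auto intro!: order_trans[OF norm_triangle_ineq] simp: norm_mult)
    qed
  qed
qed

lemma nn_integral_lebesgue_on_mono:
  assumes "K \<subseteq> L" "K \<in> sets lebesgue" "L \<in> sets lebesgue"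
  shows "(\<integral>\<^sup>+p. f p \<partial>(lebesgue_on K)) \<le> (\<integral>\<^sup>+p. f p \<partial>(lebesgue_on L))"
  using assms by (simp add: nn_integral_restrict_space) (auto intro!: nn_integral_mono simp: indicator_def)

lemma compact_emeasure_lebesgue_on_finite:
  assumes "compact (K :: (real \<times> real) set)"
  shows "emeasure (lebesgue_on K) (space (lebesgue_on K)) < \<infinity>"
proof -
  have K: "K \<in> lmeasurable" by (rule lmeasurable_compact[OF assms])
  then have "emeasure (lebesgue_on K) K = emeasure lebesgue K"
    by (intro emeasure_restrict_space) (auto simp: fmeasurable_def)
  moreover have "space (lebesgue_on K) = K" by simp
  ultimately show ?thesis
    using K by (metis fmeasurableD2 infinity_ennreal_def less_top)
qed

text \<open>Completeness: a diagonal sequence of test functions approximates the limit.\<close>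

lemma Hdot10_closed:
  assumes H: "\<And>m. Hdot10 (V m) (G m)"
    and [measurable]: "W \<in> borel_measurable lebH" "F \<in> borel_measurable lebH"
    and G: "(\<lambda>m. \<integral>\<^sup>+p. ennreal ((norm (G m p - F p))\<^sup>2) \<partial>lebH) \<longlonglongrightarrow> 0"
    and V: "\<And>m p. p \<in> halfplane \<Longrightarrow> norm (V m p - W p) \<le> \<epsilon> m" and e0: "\<epsilon> \<longlonglongrightarrow> 0"
  shows "Hdot10 W F"
proof -
  \<comment> \<open>The local error is measured on rectangles that grow with m, so a single diagonal
    sequence serves all compact sets.\<close>
  define P where "P m \<phi> \<longleftrightarrow> test_function halfplane \<phi> \<and> (\<integral>\<^sup>+p. ennreal ((norm (grad \<phi> p - G m p))\<^sup>2) \<partial>lebH) \<le> ennreal (inverse (real (Suc m)))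
      \<and> (\<integral>\<^sup>+p. ennreal ((norm (\<phi> p - V m p))\<^sup>2) \<partial>(lebesgue_on (rect (real (Suc m))))) \<le> ennreal (inverse (real (Suc m)))" for m \<phi>
  have ex: "\<exists>\<phi>. P m \<phi>" for m
  proof -
    obtain \<phi> where 1: "\<And>n. test_function halfplane (\<phi> n)"
      "(\<lambda>n. \<integral>\<^sup>+p. ennreal ((norm (grad (\<phi> n) p - G m p))\<^sup>2) \<partial>lebH) \<longlonglongrightarrow> 0"
      "\<And>K. compact K \<Longrightarrow> K \<subseteq> halfplane \<Longrightarrow>
        (\<lambda>n. \<integral>\<^sup>+p. ennreal ((norm (\<phi> n p - V m p))\<^sup>2) \<partial>(lebesgue_on K)) \<longlonglongrightarrow> 0"
      by (rule Hdot10D[OF H[of m]]; rule that; assumption)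
    have p: "0 < ennreal (inverse (real (Suc m)))" by simp
    have "\<forall>\<^sub>F n in sequentially. (\<integral>\<^sup>+p. ennreal ((norm (grad (\<phi> n) p - G m p))\<^sup>2) \<partial>lebH) < ennreal (inverse (real (Suc m)))
      \<and> (\<integral>\<^sup>+p. ennreal ((norm (\<phi> n p - V m p))\<^sup>2) \<partial>(lebesgue_on (rect (real (Suc m))))) < ennreal (inverse (real (Suc m)))"
      by (intro eventually_conj order_tendstoD(2)[OF 1(2) p] order_tendstoD(2)[OF 1(3) p] compact_rect rect_subset_halfplane) simp
    then have "\<exists>n. (\<integral>\<^sup>+p. ennreal ((norm (grad (\<phi> n) p - G m p))\<^sup>2) \<partial>lebH) < ennreal (inverse (real (Suc m)))
      \<and> (\<integral>\<^sup>+p. ennreal ((norm (\<phi> n p - V m p))\<^sup>2) \<partial>(lebesgue_on (rect (real (Suc m))))) < ennreal (inverse (real (Suc m)))"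
      by (rule eventually_happens'[OF sequentially_bot])
    then obtain n where "(\<integral>\<^sup>+p. ennreal ((norm (grad (\<phi> n) p - G m p))\<^sup>2) \<partial>lebH) \<le> ennreal (inverse (real (Suc m)))"
      "(\<integral>\<^sup>+p. ennreal ((norm (\<phi> n p - V m p))\<^sup>2) \<partial>(lebesgue_on (rect (real (Suc m))))) \<le> ennreal (inverse (real (Suc m)))"
      by (auto intro: less_imp_le)
    with 1(1)[of n] show ?thesis unfolding P_def by (intro exI[of _ "\<phi> n"] conjI)
  qed
  then obtain \<phi> where "\<And>m. P m (\<phi> m)" by metis
  then have \<phi>: "\<And>m. test_function halfplane (\<phi> m)"
    "\<And>m. (\<integral>\<^sup>+p. ennreal ((norm (grad (\<phi> m) p - G m p))\<^sup>2) \<partial>lebH) \<le> ennreal (inverse (real (Suc m)))"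
    "\<And>m. (\<integral>\<^sup>+p. ennreal ((norm (\<phi> m p - V m p))\<^sup>2) \<partial>(lebesgue_on (rect (real (Suc m))))) \<le> ennreal (inverse (real (Suc m)))"
    unfolding P_def by auto
  have inv0: "(\<lambda>m. ennreal (inverse (real (Suc m)))) \<longlonglongrightarrow> 0"
    using tendsto_ennrealI[OF LIMSEQ_inverse_real_of_nat] by simp
  note [measurable] = Hdot10_measurable[OF H]
  have mm [measurable]: "grad (\<phi> n) \<in> borel_measurable lebH" "\<phi> n \<in> borel_measurable lebH" for n
    using grad_square_integrable[OF \<phi>(1)] smooth_on_imp_continuous_on[OF test_function_smooth_on[OF \<phi>(1)]]
    by (auto simp: square_integrable_def intro: continuous_measurable_lebH)
  show ?thesis
    unfolding Hdot10_def
  proof (intro conjI exI[of _ \<phi>] allI impI)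
    show "(\<lambda>m. \<integral>\<^sup>+p. ennreal ((norm (grad (\<phi> m) p - F p))\<^sup>2) \<partial>lebH) \<longlonglongrightarrow> 0"
    proof (rule ennreal_squeeze_0[OF tendsto_ennreal_lincomb_0[OF inv0 G, of 2]], intro always_eventually allI)
      fix m
      have "(\<integral>\<^sup>+p. ennreal ((norm (grad (\<phi> m) p - F p))\<^sup>2) \<partial>lebH)
        \<le> 2 * (\<integral>\<^sup>+p. ennreal ((norm (grad (\<phi> m) p - G m p))\<^sup>2) \<partial>lebH)
          + ennreal (2 * 1\<^sup>2) * (\<integral>\<^sup>+p. ennreal ((norm (G m p - F p))\<^sup>2) \<partial>lebH)"
        by (rule nn_norm_lincomb_le) (auto intro: norm_diff_triangle_le)
      also have "\<dots> \<le> 2 * ennreal (inverse (real (Suc m))) + ennreal 2 * (\<integral>\<^sup>+p. ennreal ((norm (G m p - F p))\<^sup>2) \<partial>lebH)"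
        by (intro add_mono mult_left_mono \<phi>(2)) auto
      finally show "(\<integral>\<^sup>+p. ennreal ((norm (grad (\<phi> m) p - F p))\<^sup>2) \<partial>lebH)
        \<le> 2 * ennreal (inverse (real (Suc m))) + ennreal 2 * (\<integral>\<^sup>+p. ennreal ((norm (G m p - F p))\<^sup>2) \<partial>lebH)" .
    qed
    fix K :: "(real \<times> real) set" assume "compact K \<and> K \<subseteq> halfplane"
    then have K: "compact K" "K \<subseteq> halfplane" by auto
    obtain R where R: "1 \<le> R" "K \<subseteq> rect R" using compact_subset_rect[OF K] by blast
    define c where "c = emeasure (lebesgue_on K) (space (lebesgue_on K))"
    have c: "c < \<infinity>" unfolding c_def by (rule compact_emeasure_lebesgue_on_finite[OF K(1)])
    note m = lebesgue_on_mono_measurable[OF _ K(2) halfplane_measurable(1)]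
    have [measurable]: "V n \<in> borel_measurable (lebesgue_on K)" "W \<in> borel_measurable (lebesgue_on K)"
      "\<phi> n \<in> borel_measurable (lebesgue_on K)" for n
      using m Hdot10_measurable[OF H] mm assms(2) by blast+
    have "(\<lambda>m. ennreal ((\<epsilon> m)\<^sup>2) * c) \<longlonglongrightarrow> 0"
    proof -
      have "(\<lambda>m. ennreal ((\<epsilon> m)\<^sup>2)) \<longlonglongrightarrow> ennreal (0\<^sup>2)"
        by (intro tendsto_ennrealI tendsto_power e0)
      then have "(\<lambda>m. c * ennreal ((\<epsilon> m)\<^sup>2)) \<longlonglongrightarrow> c * 0"
        using c by (intro ennreal_tendsto_cmult) auto
      then show ?thesis by (simp add: mult.commute)
    qed
    then have V0: "(\<lambda>m. \<integral>\<^sup>+p. ennreal ((norm (V m p - W p))\<^sup>2) \<partial>(lebesgue_on K)) \<longlonglongrightarrow> 0"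
    proof (rule ennreal_squeeze_0, intro always_eventually allI)
      fix m
      have "(\<integral>\<^sup>+p. ennreal ((norm (V m p - W p))\<^sup>2) \<partial>(lebesgue_on K)) \<le> (\<integral>\<^sup>+p. ennreal ((\<epsilon> m)\<^sup>2) \<partial>(lebesgue_on K))"
        using V K(2) by (intro nn_integral_mono ennreal_leI power_mono) auto
      then show "(\<integral>\<^sup>+p. ennreal ((norm (V m p - W p))\<^sup>2) \<partial>(lebesgue_on K)) \<le> ennreal ((\<epsilon> m)\<^sup>2) * c"
        by (simp add: c_def)
    qed
    obtain N :: nat where N: "R \<le> real N" using real_arch_simple by blast
    show "(\<lambda>m. \<integral>\<^sup>+p. ennreal ((norm (\<phi> m p - W p))\<^sup>2) \<partial>(lebesgue_on K)) \<longlonglongrightarrow> 0"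
    proof (rule ennreal_squeeze_0[OF tendsto_ennreal_lincomb_0[OF inv0 V0, of 2]])
      show "\<forall>\<^sub>F m in sequentially. (\<integral>\<^sup>+p. ennreal ((norm (\<phi> m p - W p))\<^sup>2) \<partial>(lebesgue_on K))
        \<le> 2 * ennreal (inverse (real (Suc m))) + ennreal 2 * (\<integral>\<^sup>+p. ennreal ((norm (V m p - W p))\<^sup>2) \<partial>(lebesgue_on K))"
        using eventually_ge_at_top[of N]
      proof eventually_elim
        case (elim m)
        have "K \<subseteq> rect (real (Suc m))"
          using R N elim rect_mono[of R "real (Suc m)"] by auto
        then have "(\<integral>\<^sup>+p. ennreal ((norm (\<phi> m p - V m p))\<^sup>2) \<partial>(lebesgue_on K))
            \<le> (\<integral>\<^sup>+p. ennreal ((norm (\<phi> m p - V m p))\<^sup>2) \<partial>(lebesgue_on (rect (real (Suc m)))))"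
          using lmeasurable_compact[OF K(1)] lmeasurable_compact[OF compact_rect]
          by (intro nn_integral_lebesgue_on_mono) (auto simp: fmeasurable_def)
        also note \<phi>(3)
        finally have *: "(\<integral>\<^sup>+p. ennreal ((norm (\<phi> m p - V m p))\<^sup>2) \<partial>(lebesgue_on K)) \<le> ennreal (inverse (real (Suc m)))" .
        have "(\<integral>\<^sup>+p. ennreal ((norm (\<phi> m p - W p))\<^sup>2) \<partial>(lebesgue_on K))
          \<le> 2 * (\<integral>\<^sup>+p. ennreal ((norm (\<phi> m p - V m p))\<^sup>2) \<partial>(lebesgue_on K))
            + ennreal (2 * 1\<^sup>2) * (\<integral>\<^sup>+p. ennreal ((norm (V m p - W p))\<^sup>2) \<partial>(lebesgue_on K))"
          by (rule nn_norm_lincomb_le) (auto intro: norm_diff_triangle_le)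
        also have "\<dots> \<le> 2 * ennreal (inverse (real (Suc m))) + ennreal 2 * (\<integral>\<^sup>+p. ennreal ((norm (V m p - W p))\<^sup>2) \<partial>(lebesgue_on K))"
          by (intro add_mono mult_left_mono *) auto
        finally show ?case .
      qed
    qed
  qed (use \<phi> in auto)
qed

text \<open>A common compact support and a common bound make a multiple of the indicator of K a
  dominating function, so convergence almost everywhere is enough. In the second conclusion the
  field G0 is only bounded on K; this permits testing an equation before its field is known to have
  finite energy.\<close>

lemma Hdot10_of_bounded_limit:
  assumes t: "\<And>n. test_function halfplane (\<phi> n)"
    and K: "compact K" "K \<subseteq> halfplane" "\<And>n p. p \<notin> K \<Longrightarrow> \<phi> n p = 0"
    and C: "\<And>n p. p \<in> K \<Longrightarrow> norm (\<phi> n p) \<le> C" "\<And>n p. p \<in> K \<Longrightarrow> norm (grad (\<phi> n) p) \<le> C"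
    and [measurable]: "V \<in> borel_measurable lebH" "G \<in> borel_measurable lebH"
    and V: "AE p in lebH. (\<lambda>n. \<phi> n p) \<longlonglongrightarrow> V p" and G: "AE p in lebH. (\<lambda>n. grad (\<phi> n) p) \<longlonglongrightarrow> G p"
  shows "Hdot10 V G"
    and "\<And>k G0 B. G0 \<in> borel_measurable lebH \<Longrightarrow> (\<And>p. p \<in> K \<Longrightarrow> norm (G0 p) \<le> B) \<Longrightarrow>
      (\<lambda>n. A_form k G0 (grad (\<phi> n))) \<longlonglongrightarrow> A_form k G0 G"
proof -
  have [measurable]: "grad (\<phi> n) \<in> borel_measurable lebH" "\<phi> n \<in> borel_measurable lebH" for n
    using grad_square_integrable[OF t] smooth_on_imp_continuous_on[OF test_function_smooth_on[OF t]]
    by (auto simp: square_integrable_def intro: continuous_measurable_lebH)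
  have C0: "p \<in> K \<Longrightarrow> 0 \<le> C" for p using C(1)[of p 0] norm_ge_zero order_trans by blast
  have g0: "grad (\<phi> n) p = 0" if "p \<notin> K" for n p
    by (rule grad_eq_0[OF compact_imp_closed[OF K(1)]]) (use K(3) that in auto)
  have b: "norm (\<phi> n p) \<le> \<bar>C\<bar> * indicator K p" "norm (grad (\<phi> n) p) \<le> \<bar>C\<bar> * indicator K p" for n p
    using C[of p n] K(3)[of p n] g0[of p n]
    by (auto simp: indicator_def)
  have *: "(\<lambda>n. \<integral>\<^sup>+p. ennreal ((norm (f n p - F p))\<^sup>2) \<partial>lebH) \<longlonglongrightarrow> 0"
    if [measurable]: "\<And>n. f n \<in> borel_measurable lebH" "F \<in> borel_measurable lebH"
      and lim: "AE p in lebH. (\<lambda>n. f n p) \<longlonglongrightarrow> F p" and fb: "\<And>n p. norm (f n p) \<le> \<bar>C\<bar> * indicator K p"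
    for f :: "nat \<Rightarrow> real \<times> real \<Rightarrow> 'b::euclidean_space" and F
  proof -
    have "(\<lambda>n. \<integral>\<^sup>+p. ennreal ((norm (f n p - F p))\<^sup>2) \<partial>lebH) \<longlonglongrightarrow> (\<integral>\<^sup>+p. 0 \<partial>lebH)"
    proof (rule nn_integral_dominated_convergence[where w = "\<lambda>p. ennreal (4 * C\<^sup>2 * indicator K p)"])
      show "AE p in lebH. ennreal ((norm (f n p - F p))\<^sup>2) \<le> ennreal (4 * C\<^sup>2 * indicator K p)" for n
        using lim
      proof eventually_elim
        case (elim p)
        have "norm (F p) \<le> \<bar>C\<bar> * indicator K p"
          by (rule LIMSEQ_le_const2[OF tendsto_norm[OF elim]]) (use fb in auto)
        then have "norm (f n p - F p) \<le> 2 * \<bar>C\<bar> * indicator K p"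
          using fb[of n p] norm_triangle_ineq4[of "f n p" "F p"] by linarith
        then have "(norm (f n p - F p))\<^sup>2 \<le> (2 * \<bar>C\<bar> * indicator K p)\<^sup>2"
          by (intro power_mono) auto
        also have "\<dots> = 4 * C\<^sup>2 * indicator K p" by (simp add: power_mult_distrib indicator_def)
        finally show ?case by (rule ennreal_leI)
      qed
      show "(\<integral>\<^sup>+p. ennreal (4 * C\<^sup>2 * indicator K p) \<partial>lebH) < \<infinity>"
        by (subst nn_integral_eq_integral[OF compact_indicator_integrable[OF K(1,2), of "4 * C\<^sup>2"]])
          (auto simp: less_top[symmetric])
      show "AE p in lebH. (\<lambda>n. ennreal ((norm (f n p - F p))\<^sup>2)) \<longlonglongrightarrow> 0"
        using lim
      proof eventually_elim
        case (elim p)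
        have "(\<lambda>n. (norm (f n p - F p))\<^sup>2) \<longlonglongrightarrow> (norm (F p - F p))\<^sup>2"
          by (intro tendsto_intros elim)
        from tendsto_ennrealI[OF this] show ?case by simp
      qed
      show "(\<lambda>p. ennreal (4 * C\<^sup>2 * indicator K p)) \<in> borel_measurable lebH"
        using compact_indicator_integrable[OF K(1,2), of "4 * C\<^sup>2"] by measurable
    qed auto
    then show ?thesis by simp
  qed
  show "Hdot10 V G"
    unfolding Hdot10_def
  proof (intro conjI exI[of _ \<phi>] allI impI)
    show "(\<lambda>n. \<integral>\<^sup>+p. ennreal ((norm (grad (\<phi> n) p - G p))\<^sup>2) \<partial>lebH) \<longlonglongrightarrow> 0"
      by (rule *) (use b G in auto)
    have V0: "(\<lambda>n. \<integral>\<^sup>+p. ennreal ((norm (\<phi> n p - V p))\<^sup>2) \<partial>lebH) \<longlonglongrightarrow> 0"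
      by (rule *) (use b V in auto)
    fix L :: "(real \<times> real) set" assume "compact L \<and> L \<subseteq> halfplane"
    then show "(\<lambda>n. \<integral>\<^sup>+p. ennreal ((norm (\<phi> n p - V p))\<^sup>2) \<partial>(lebesgue_on L)) \<longlonglongrightarrow> 0"
      using lmeasurable_compact[of L] halfplane_measurable(1)
      by (intro ennreal_squeeze_0[OF V0] always_eventually allI nn_integral_lebesgue_on_mono)
        (auto simp: fmeasurable_def)
  qed (use t in auto)
  fix k B and G0 :: "real \<times> real \<Rightarrow> complex ^ 2" assume [measurable]: "G0 \<in> borel_measurable lebH" and B: "\<And>p. p \<in> K \<Longrightarrow> norm (G0 p) \<le> B"
  show "(\<lambda>n. A_form k G0 (grad (\<phi> n))) \<longlonglongrightarrow> A_form k G0 G"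
    unfolding A_form_def
  proof (rule integral_dominated_convergence[where w = "\<lambda>p. (2 * (1 + \<bar>k\<bar>) * (\<bar>B\<bar> * \<bar>C\<bar>)) * indicator K p"])
    show "AE p in lebH. norm (hermitian (A_coeff k (snd p) *v G0 p) (grad (\<phi> n) p))
        \<le> (2 * (1 + \<bar>k\<bar>) * (\<bar>B\<bar> * \<bar>C\<bar>)) * indicator K p" for n
    proof (rule AE_I2)
      fix p
      have "norm (G0 p) * norm (grad (\<phi> n) p) \<le> (\<bar>B\<bar> * \<bar>C\<bar>) * indicator K p"
      proof (cases "p \<in> K")
        case True
        then show ?thesis using B[OF True] b(2)[of n p] by (auto intro!: mult_mono)
      next
        case False
        then show ?thesis using b(2)[of n p] by simp
      qed
      then have "2 * (1 + \<bar>k\<bar>) * (norm (G0 p) * norm (grad (\<phi> n) p)) \<le> 2 * (1 + \<bar>k\<bar>) * ((\<bar>B\<bar> * \<bar>C\<bar>) * indicator K p)"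
        by (intro mult_left_mono) auto
      then show "norm (hermitian (A_coeff k (snd p) *v G0 p) (grad (\<phi> n) p))
        \<le> (2 * (1 + \<bar>k\<bar>) * (\<bar>B\<bar> * \<bar>C\<bar>)) * indicator K p"
        using hermitian_A_coeff_bound[of k "snd p" "G0 p" "grad (\<phi> n) p"] by (simp add: mult.assoc)
    qed
    show "AE p in lebH. (\<lambda>n. hermitian (A_coeff k (snd p) *v G0 p) (grad (\<phi> n) p))
        \<longlonglongrightarrow> hermitian (A_coeff k (snd p) *v G0 p) (G p)"
      using G
    proof eventually_elim
      case (elim p)
      then show ?case unfolding hermitian_A_coeff
        by (intro tendsto_intros)
    qed
    show "integrable lebH (\<lambda>p. (2 * (1 + \<bar>k\<bar>) * (\<bar>B\<bar> * \<bar>C\<bar>)) * indicator K p)"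
      by (rule compact_indicator_integrable[OF K(1,2)])
  qed (intro hermitian_A_measurable; measurable)+
qed

section \<open>Integration by parts\<close>

text \<open>The finite exceptional set accommodates a kink: the fundamental theorem needs only
  continuity of f there.\<close>

lemma integral_derivative_compact_support:
  fixes f g :: "real \<Rightarrow> 'a::euclidean_space"
  assumes "integrable lborel g" "continuous_on UNIV f" "finite S"
    and "\<And>x. x \<notin> S \<Longrightarrow> (f has_vector_derivative g x) (at x)"
    and "\<And>x. r < \<bar>x\<bar> \<Longrightarrow> f x = 0" "\<And>x. r < \<bar>x\<bar> \<Longrightarrow> g x = 0"
  shows "(\<integral>x. g x \<partial>lborel) = 0"
proof -
  define a where "a = max r 0 + 1"
  have a: "0 < a" "r < a" by (auto simp: a_def)
  have "(g has_integral (f a - f (- a))) {- a..a}"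
    by (rule fundamental_theorem_of_calculus_interior_strong[OF assms(3)])
      (use a assms in \<open>auto intro: continuous_on_subset\<close>)
  moreover have "f a = 0" "f (- a) = 0" using assms(5) a by auto
  ultimately have "(g has_integral 0) {- a..a}" by simp
  then have "(g has_integral 0) UNIV"
    by (rule has_integral_on_superset) (use a assms(6) in auto)
  then show ?thesis
    using has_integral_integral_lborel[OF assms(1)] has_integral_unique by blast
qed

lemma integral_fst_derivative_compact_support:
  fixes f g :: "real \<times> real \<Rightarrow> 'a::euclidean_space"
  assumes int: "integrable lborel g"
    and der: "\<And>t x. ((\<lambda>t. f (t, x)) has_vector_derivative g (t, x)) (at t)"
    and "\<And>t x. r < \<bar>t\<bar> \<Longrightarrow> f (t, x) = 0" "\<And>t x. r < \<bar>t\<bar> \<Longrightarrow> g (t, x) = 0"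
  shows "(\<integral>p. g p \<partial>lborel) = 0"
proof -
  have i: "integrable (lborel \<Otimes>\<^sub>M lborel) (\<lambda>(t, x). g (t, x))"
    using int by (simp add: lborel_prod)
  have "(\<integral>p. g p \<partial>lborel) = (\<integral>x. (\<integral>t. g (t, x) \<partial>lborel) \<partial>lborel)"
    using lborel_pair.integral_snd[OF i] by (simp add: lborel_prod)
  also have "\<dots> = (\<integral>x. 0 \<partial>(lborel :: real measure))"
  proof (rule integral_cong_AE)
    show "AE x in lborel. (\<integral>t. g (t, x) \<partial>lborel) = 0"
      using lborel_pair.AE_integrable_snd[OF i]
    proof eventually_elim
      case (elim x)
      have "continuous_on UNIV (\<lambda>t. f (t, x))"
        using der by (auto intro!: continuous_at_imp_continuous_on has_vector_derivative_continuous)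
      then show ?case
        by (intro integral_derivative_compact_support[where S = "{}" and r = r and f = "\<lambda>t. f (t, x)"])
          (use elim der assms(3,4) in auto)
    qed
    show "(\<lambda>x. \<integral>t. g (t, x) \<partial>lborel) \<in> borel_measurable lborel"
      using lborel_pair.integrable_snd[OF i] by (rule borel_measurable_integrable)
  qed auto
  finally show ?thesis by simp
qed

lemma integral_snd_derivative_compact_support:
  fixes f g :: "real \<times> real \<Rightarrow> 'a::euclidean_space"
  assumes int: "integrable lborel g" and cont: "\<And>t. continuous_on UNIV (\<lambda>x. f (t, x))"
    and der: "\<And>t x. x \<noteq> 0 \<Longrightarrow> ((\<lambda>x. f (t, x)) has_vector_derivative g (t, x)) (at x)"
    and "\<And>t x. r < \<bar>x\<bar> \<Longrightarrow> f (t, x) = 0" "\<And>t x. r < \<bar>x\<bar> \<Longrightarrow> g (t, x) = 0"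
  shows "(\<integral>p. g p \<partial>lborel) = 0"
proof -
  have i: "integrable (lborel \<Otimes>\<^sub>M lborel) (\<lambda>(t, x). g (t, x))"
    using int by (simp add: lborel_prod)
  have "(\<integral>p. g p \<partial>lborel) = (\<integral>t. (\<integral>x. g (t, x) \<partial>lborel) \<partial>lborel)"
    using lborel_pair.integral_fst[OF i] by (simp add: lborel_prod)
  also have "\<dots> = (\<integral>t. 0 \<partial>(lborel :: real measure))"
  proof (rule integral_cong_AE)
    show "AE t in lborel. (\<integral>x. g (t, x) \<partial>lborel) = 0"
      using lborel_pair.AE_integrable_fst[OF i]
    proof eventually_elim
      case (elim t)
      show ?case
        by (rule integral_derivative_compact_support[where S = "{0}" and r = r and f = "\<lambda>x. f (t, x)"])
          (use elim der assms(4,5) cont in auto)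
    qed
    show "(\<lambda>t. \<integral>x. g (t, x) \<partial>lborel) \<in> borel_measurable lborel"
      using lborel_pair.integrable_fst[OF i] by (rule borel_measurable_integrable)
  qed auto
  finally show ?thesis by simp
qed

text \<open>The class of coefficients used for integration: closed under sums and products, and wide
  enough for the jump of \<open>sgn\<close> at x = 0, which continuity would exclude. The indicator
  makes values outside the half-plane irrelevant.\<close>

definition loc_bdd :: "(real \<times> real \<Rightarrow> real) \<Rightarrow> bool" where
  "loc_bdd f \<longleftrightarrow> (\<lambda>p. indicator halfplane p * f p) \<in> borel_measurable borel \<and>
     (\<forall>R\<ge>1. \<exists>C. \<forall>p\<in>rect R. \<bar>f p\<bar> \<le> C)"

lemma loc_bddE:
  assumes "loc_bdd f" "1 \<le> R"
  obtains C where "0 \<le> C" "\<And>p. p \<in> rect R \<Longrightarrow> \<bar>f p\<bar> \<le> C"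
proof -
  obtain C where C: "\<And>p. p \<in> rect R \<Longrightarrow> \<bar>f p\<bar> \<le> C" using assms unfolding loc_bdd_def by blast
  show ?thesis by (rule that[of "\<bar>C\<bar>"]) (use C in force)+
qed

lemma loc_bdd_continuous:
  assumes "continuous_on halfplane f"
  shows "loc_bdd f"
  unfolding loc_bdd_def
proof (intro conjI allI impI)
  show "(\<lambda>p. indicator halfplane p * f p) \<in> borel_measurable borel"
    using borel_measurable_continuous_on_indicator[OF halfplane_measurable(2) assms] by simp
  fix R :: real assume "1 \<le> R"
  then have "compact (f ` rect R)"
    by (intro compact_continuous_image continuous_on_subset[OF assms] compact_rect rect_subset_halfplane) auto
  then show "\<exists>C. \<forall>p\<in>rect R. \<bar>f p\<bar> \<le> C"
    using compact_imp_bounded by (fastforce simp: bounded_iff)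
qed

lemma loc_bdd_sgn: "loc_bdd (\<lambda>p. sgn (snd p))"
  unfolding loc_bdd_def
proof (intro conjI allI impI)
  show "(\<lambda>p. indicator halfplane p * sgn (snd p)) \<in> borel_measurable borel"
  proof (rule borel_measurable_times)
    show "(\<lambda>p. indicator halfplane p :: real) \<in> borel_measurable borel"
      using halfplane_measurable by simp
    show "(\<lambda>p::real \<times> real. sgn (snd p)) \<in> borel_measurable borel"
      unfolding borel_prod[symmetric] by measurable
  qed
  show "\<exists>C. \<forall>p\<in>rect R. \<bar>sgn (snd p)\<bar> \<le> C" for R
    by (rule exI[of _ 1]) (auto simp: sgn_if)
qed

lemma loc_bdd_const: "loc_bdd (\<lambda>p. c)"
  by (rule loc_bdd_continuous) auto

lemma loc_bdd_add:
  assumes "loc_bdd f" "loc_bdd g"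
  shows "loc_bdd (\<lambda>p. f p + g p)"
  unfolding loc_bdd_def
proof (intro conjI allI impI)
  show "(\<lambda>p. indicator halfplane p * (f p + g p)) \<in> borel_measurable borel"
    unfolding distrib_left
  proof (rule borel_measurable_add)
    show "(\<lambda>p. indicator halfplane p * f p) \<in> borel_measurable borel"
      "(\<lambda>p. indicator halfplane p * g p) \<in> borel_measurable borel"
      using assms unfolding loc_bdd_def by blast+
  qed
  fix R :: real assume R: "1 \<le> R"
  obtain C D where "\<And>p. p \<in> rect R \<Longrightarrow> \<bar>f p\<bar> \<le> C" "\<And>p. p \<in> rect R \<Longrightarrow> \<bar>g p\<bar> \<le> D"
    using loc_bddE[OF assms(1) R] loc_bddE[OF assms(2) R] by metis
  then show "\<exists>C. \<forall>p\<in>rect R. \<bar>f p + g p\<bar> \<le> C"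
    by (intro exI[of _ "C + D"]) (force intro: order_trans[OF abs_triangle_ineq] add_mono)
qed

lemma loc_bdd_mult:
  assumes "loc_bdd f" "loc_bdd g"
  shows "loc_bdd (\<lambda>p. f p * g p)"
  unfolding loc_bdd_def
proof (intro conjI allI impI)
  have "(\<lambda>p. (indicator halfplane p * f p) * (indicator halfplane p * g p)) \<in> borel_measurable borel"
    using assms unfolding loc_bdd_def by (intro borel_measurable_times[of "\<lambda>p. indicator halfplane p * f p"]) blast+
  moreover have "(indicator halfplane p * f p) * (indicator halfplane p * g p) = indicator halfplane p * (f p * g p)" for p
    by (simp add: indicator_def)
  ultimately show "(\<lambda>p. indicator halfplane p * (f p * g p)) \<in> borel_measurable borel" by simp
  fix R :: real assume R: "1 \<le> R"
  obtain C D where "0 \<le> C" "\<And>p. p \<in> rect R \<Longrightarrow> \<bar>f p\<bar> \<le> C" "\<And>p. p \<in> rect R \<Longrightarrow> \<bar>g p\<bar> \<le> D"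
    using loc_bddE[OF assms(1) R] loc_bddE[OF assms(2) R] by metis
  then show "\<exists>C. \<forall>p\<in>rect R. \<bar>f p * g p\<bar> \<le> C"
    by (intro exI[of _ "C * D"]) (auto simp: abs_mult intro!: mult_mono)
qed

lemma loc_bdd_diff:
  assumes "loc_bdd f" "loc_bdd g"
  shows "loc_bdd (\<lambda>p. f p - g p)"
  using loc_bdd_add[OF assms(1) loc_bdd_mult[OF loc_bdd_const[of "- 1"] assms(2)]] by simp

lemma loc_bdd_lebH:
  assumes "loc_bdd f"
  shows "f \<in> borel_measurable lebH"
proof -
  have "(\<lambda>p. indicator halfplane p * f p) \<in> borel_measurable lebH"
    using assms by (intro borel_imp_lebH) (simp add: loc_bdd_def)
  then show ?thesis
    by (rule measurable_cong[THEN iffD1, rotated]) (simp add: indicator_def)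
qed

lemma loc_bdd_integrable:
  fixes h :: "real \<times> real \<Rightarrow> complex"
  assumes f: "loc_bdd f" and h: "continuous_on UNIV h" and K: "compact K" "K \<subseteq> halfplane" "\<And>p. p \<notin> K \<Longrightarrow> h p = 0"
  shows "integrable lborel (\<lambda>p. f p *\<^sub>R h p)"
proof -
  obtain R where R: "1 \<le> R" "K \<subseteq> rect R" using compact_subset_rect[OF K(1,2)] by blast
  obtain C where C: "0 \<le> C" "\<And>p. p \<in> rect R \<Longrightarrow> \<bar>f p\<bar> \<le> C" using loc_bddE[OF f R(1)] by metis
  obtain D where D: "\<And>p. p \<in> K \<Longrightarrow> norm (h p) \<le> D" using continuous_compact_bounded[OF h K(1)] by blast
  have [measurable]: "(\<lambda>p. indicator halfplane p * f p) \<in> borel_measurable borel" "h \<in> borel_measurable borel"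
    using f borel_measurable_continuous_onI[OF h] by (auto simp: loc_bdd_def)
  have eq: "f p *\<^sub>R h p = (indicator halfplane p * f p) *\<^sub>R h p" for p
    using K(2,3) by (cases "p \<in> K") (auto simp: indicator_def)
  have m: "(\<lambda>p. f p *\<^sub>R h p) \<in> borel_measurable lborel"
    unfolding eq by (intro borel_measurable_scaleR) auto
  show ?thesis
  proof (rule Bochner_Integration.integrable_bound[OF _ m])
    show "integrable lborel (\<lambda>p. (C * \<bar>D\<bar>) * indicator K p :: real)"
      using emeasure_compact_finite[OF K(1)] K(1)
      by (intro integrable_mult_right integrable_real_indicator) (auto intro: borel_compact)
    show "AE p in lborel. norm (f p *\<^sub>R h p) \<le> norm ((C * \<bar>D\<bar>) * indicator K p :: real)"
    proof (rule AE_I2)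
      fix p
      show "norm (f p *\<^sub>R h p) \<le> norm ((C * \<bar>D\<bar>) * indicator K p :: real)"
      proof (cases "p \<in> K")
        case True
        then have "\<bar>f p\<bar> \<le> C" using C(2) R(2) by blast
        moreover have "norm (h p) \<le> \<bar>D\<bar>" using D[OF True] by linarith
        ultimately have "\<bar>f p\<bar> * norm (h p) \<le> C * \<bar>D\<bar>"
          using C(1) by (intro mult_mono) auto
        then show ?thesis using True C(1) by (simp add: abs_mult)
      qed (simp add: K(3))
    qed
  qed
qed

lemma integral_lebH_lborel:
  fixes h :: "real \<times> real \<Rightarrow> 'a::euclidean_space"
  assumes "h \<in> borel_measurable borel" "\<And>p. p \<notin> halfplane \<Longrightarrow> h p = 0"
  shows "(\<integral>p. h p \<partial>lebH) = (\<integral>p. h p \<partial>lborel)"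
proof -
  have "(\<lambda>p. indicator halfplane p *\<^sub>R h p) = h" using assms(2) by (force simp: indicator_def)
  then have "(\<integral>p. h p \<partial>lebH) = (\<integral>p. h p \<partial>lebesgue)"
    using halfplane_measurable by (simp add: integral_restrict_space)
  also have "\<dots> = (\<integral>p. h p \<partial>lborel)" using assms(1) by (intro integral_completion) simp
  finally show ?thesis .
qed

lemma test_function_partials:
  fixes \<phi> :: "real \<times> real \<Rightarrow> 'b::real_normed_vector"
  assumes "test_function \<Omega> \<phi>"
  shows "((\<lambda>t. \<phi> (t, x)) has_vector_derivative frechet_derivative \<phi> (at (t, x)) (1, 0)) (at t)"
    "((\<lambda>x. \<phi> (t, x)) has_vector_derivative frechet_derivative \<phi> (at (t, x)) (0, 1)) (at x)"
proof -
  have D: "(\<phi> has_derivative frechet_derivative \<phi> (at (t, x))) (at (t, x))"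
    using assms smooth_on_has_derivative[of UNIV \<phi>] by (simp add: test_function_def smooth_eq_smooth_on)
  have lin: "linear (frechet_derivative \<phi> (at (t, x)))"
    using D has_derivative_linear by blast
  have "((\<lambda>t. (t, x)) has_derivative (\<lambda>h. (h, 0))) (at t)" by (auto intro!: derivative_eq_intros)
  then have "((\<lambda>t. \<phi> (t, x)) has_derivative (\<lambda>h. frechet_derivative \<phi> (at (t, x)) (h, 0))) (at t)"
    by (rule has_derivative_compose) (rule D)
  moreover have "(\<lambda>h. frechet_derivative \<phi> (at (t, x)) (h, 0)) = (\<lambda>h. h *\<^sub>R frechet_derivative \<phi> (at (t, x)) (1, 0))"
  proof
    fix h
    have "(h, 0) = h *\<^sub>R ((1, 0) :: real \<times> real)" by simp
    then show "frechet_derivative \<phi> (at (t, x)) (h, 0) = h *\<^sub>R frechet_derivative \<phi> (at (t, x)) (1, 0)"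
      using linear_scale[OF lin, of h "(1, 0)"] by (simp only:)
  qed
  ultimately show "((\<lambda>t. \<phi> (t, x)) has_vector_derivative frechet_derivative \<phi> (at (t, x)) (1, 0)) (at t)"
    unfolding has_vector_derivative_def by (simp only:)
  have "((\<lambda>x. (t, x)) has_derivative (\<lambda>h. (0, h))) (at x)" by (auto intro!: derivative_eq_intros)
  then have "((\<lambda>x. \<phi> (t, x)) has_derivative (\<lambda>h. frechet_derivative \<phi> (at (t, x)) (0, h))) (at x)"
    by (rule has_derivative_compose) (rule D)
  moreover have "(\<lambda>h. frechet_derivative \<phi> (at (t, x)) (0, h)) = (\<lambda>h. h *\<^sub>R frechet_derivative \<phi> (at (t, x)) (0, 1))"
  proof
    fix h
    have "(0, h) = h *\<^sub>R ((0, 1) :: real \<times> real)" by simp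
    then show "frechet_derivative \<phi> (at (t, x)) (0, h) = h *\<^sub>R frechet_derivative \<phi> (at (t, x)) (0, 1)"
      using linear_scale[OF lin, of h "(0, 1)"] by (simp only:)
  qed
  ultimately show "((\<lambda>x. \<phi> (t, x)) has_vector_derivative frechet_derivative \<phi> (at (t, x)) (0, 1)) (at x)"
    unfolding has_vector_derivative_def by (simp only:)
qed

lemma vector_derivative_zero_outside:
  assumes "closed K" "\<And>p. p \<notin> K \<Longrightarrow> f p = 0" "q s \<notin> K" "continuous_on UNIV (q :: real \<Rightarrow> real \<times> real)"
  shows "((\<lambda>s. f (q s) :: 'a::real_normed_vector) has_vector_derivative 0) (at s)"
proof (rule has_vector_derivative_transform_within_open)
  show "open (q -` (- K))" by (rule open_vimage) (use assms in auto)
qed (use assms in auto)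

text \<open>Since the field and not \<open>\<psi>\<close> is differentiated, no symmetry of second derivatives is needed.\<close>

lemma divergence_free_weak:
  fixes \<psi> :: "real \<times> real \<Rightarrow> complex"
  assumes B: "loc_bdd B1" "loc_bdd B2" "loc_bdd m"
    and cont: "\<And>t. 0 < t \<Longrightarrow> continuous_on UNIV (\<lambda>x. B2 (t, x))"
    and d1: "\<And>t x. 0 < t \<Longrightarrow> ((\<lambda>t. B1 (t, x)) has_real_derivative m (t, x)) (at t)"
    and d2: "\<And>t x. 0 < t \<Longrightarrow> x \<noteq> 0 \<Longrightarrow> ((\<lambda>x. B2 (t, x)) has_real_derivative - m (t, x)) (at x)"
    and \<psi>: "test_function halfplane \<psi>"
  shows "(\<integral>p. B1 p *\<^sub>R frechet_derivative \<psi> (at p) (1, 0) + B2 p *\<^sub>R frechet_derivative \<psi> (at p) (0, 1) \<partial>lebH) = 0"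
proof -
  obtain K where s: "smooth_on UNIV \<psi>" and K: "compact K" "K \<subseteq> halfplane" "\<And>p. p \<notin> K \<Longrightarrow> \<psi> p = 0"
    using test_functionE[OF \<psi>] by metis
  define \<psi>t \<psi>x where "\<psi>t p = frechet_derivative \<psi> (at p) (1, 0)" and "\<psi>x p = frechet_derivative \<psi> (at p) (0, 1)" for p
  have c: "continuous_on UNIV \<psi>" "continuous_on UNIV \<psi>t" "continuous_on UNIV \<psi>x"
    using smooth_on_imp_continuous_on[OF s] smooth_on_imp_continuous_on[OF smooth_on_frechet_derivative[OF s]]
    by (auto simp: \<psi>t_def[abs_def] \<psi>x_def[abs_def] Basis_prod_def)
  have z: "\<psi>t p = 0" "\<psi>x p = 0" if "p \<notin> K" for p
    using grad_eq_0[OF compact_imp_closed[OF K(1)] K(3) that] grad_nth[of \<psi> p]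
    by (simp_all add: \<psi>t_def \<psi>x_def)
  note int = loc_bdd_integrable[OF _ _ K(1,2)]
  have i: "integrable lborel (\<lambda>p. m p *\<^sub>R \<psi> p)" "integrable lborel (\<lambda>p. B1 p *\<^sub>R \<psi>t p)" "integrable lborel (\<lambda>p. B2 p *\<^sub>R \<psi>x p)"
    using int[OF B(3) c(1) K(3)] int[OF B(1) c(2) z(1)] int[OF B(2) c(3) z(2)] by auto
  obtain r where r: "\<And>p. p \<in> K \<Longrightarrow> norm p \<le> r" using compact_imp_bounded[OF K(1)] by (auto simp: bounded_iff)
  have out: "(t, x) \<notin> K" if "r < \<bar>t\<bar> \<or> r < \<bar>x\<bar>" for t x
    using r[of "(t, x)"] norm_fst_le[of t x] norm_snd_le[of x t] that by auto
  note zo = vector_derivative_zero_outside[OF compact_imp_closed[OF K(1)]]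
  have 1: "(\<integral>p. m p *\<^sub>R \<psi> p + B1 p *\<^sub>R \<psi>t p \<partial>lborel) = 0"
  proof (rule integral_fst_derivative_compact_support[where f = "\<lambda>p. B1 p *\<^sub>R \<psi> p" and r = r])
    show "((\<lambda>t. B1 (t, x) *\<^sub>R \<psi> (t, x)) has_vector_derivative m (t, x) *\<^sub>R \<psi> (t, x) + B1 (t, x) *\<^sub>R \<psi>t (t, x)) (at t)" for t x
    proof (cases "(t, x) \<in> K")
      case True
      then have "0 < t" using K(2) by auto
      from has_vector_derivative_scaleR[OF d1[OF this] test_function_partials(1)[OF \<psi>]]
      show ?thesis by (simp add: \<psi>t_def add.commute)
    next
      case False
      then show ?thesis
        using zo[of "\<lambda>p. B1 p *\<^sub>R \<psi> p" "\<lambda>t. (t, x)" t] by (simp add: K(3) z continuous_on_Pair)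
    qed
  qed (use i out K(3) z in auto)
  have 2: "(\<integral>p. - (m p *\<^sub>R \<psi> p) + B2 p *\<^sub>R \<psi>x p \<partial>lborel) = 0"
  proof (rule integral_snd_derivative_compact_support[where f = "\<lambda>p. B2 p *\<^sub>R \<psi> p" and r = r])
    show "((\<lambda>x. B2 (t, x) *\<^sub>R \<psi> (t, x)) has_vector_derivative - (m (t, x) *\<^sub>R \<psi> (t, x)) + B2 (t, x) *\<^sub>R \<psi>x (t, x)) (at x)"
      if "x \<noteq> 0" for t x
    proof (cases "(t, x) \<in> K")
      case True
      then have "0 < t" using K(2) by auto
      from has_vector_derivative_scaleR[OF d2[OF this that] test_function_partials(2)[OF \<psi>]]
      show ?thesis by (simp add: \<psi>x_def add.commute)
    next
      case False
      then show ?thesis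
        using zo[of "\<lambda>p. B2 p *\<^sub>R \<psi> p" "\<lambda>x. (t, x)" x] by (simp add: K(3) z continuous_on_Pair)
    qed
    show "continuous_on UNIV (\<lambda>x. B2 (t, x) *\<^sub>R \<psi> (t, x))" for t
    proof (cases "0 < t")
      case True
      then show ?thesis
        by (intro continuous_intros cont continuous_on_compose2[OF c(1)]) auto
    next
      case False
      then have "(t, x) \<notin> K" for x using K(2) mem_halfplane(1)[of t x] by blast
      then have "\<psi> (t, x) = 0" for x by (rule K(3))
      then show ?thesis by simp
    qed
  qed (use i out K(3) z in auto)
  \<comment> \<open>The terms with m cancel, since m is the t-derivative of B1 and minus the
    x-derivative of B2.\<close>
  have "(\<integral>p. (m p *\<^sub>R \<psi> p + B1 p *\<^sub>R \<psi>t p) + (- (m p *\<^sub>R \<psi> p) + B2 p *\<^sub>R \<psi>x p) \<partial>lborel) = 0"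
    using 1 2 i by (subst Bochner_Integration.integral_add) auto
  then have "(\<integral>p. B1 p *\<^sub>R \<psi>t p + B2 p *\<^sub>R \<psi>x p \<partial>lborel) = 0" by (simp add: add_ac)
  moreover have "(\<integral>p. B1 p *\<^sub>R \<psi>t p + B2 p *\<^sub>R \<psi>x p \<partial>lebH) = (\<integral>p. B1 p *\<^sub>R \<psi>t p + B2 p *\<^sub>R \<psi>x p \<partial>lborel)"
  proof (rule integral_lebH_lborel)
    show "(\<lambda>p. B1 p *\<^sub>R \<psi>t p + B2 p *\<^sub>R \<psi>x p) \<in> borel_measurable borel"
      using borel_measurable_integrable[OF Bochner_Integration.integrable_add[OF i(2,3)]] by simp
    show "B1 p *\<^sub>R \<psi>t p + B2 p *\<^sub>R \<psi>x p = 0" if "p \<notin> halfplane" for p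
    proof -
      have "p \<notin> K" using that K(2) by blast
      then show ?thesis using z[of p] by simp
    qed
  qed
  ultimately show ?thesis by (simp add: \<psi>t_def \<psi>x_def)
qed

section \<open>Functions that vanish at the boundary and at infinity\<close>

lemma isolated_imp_countable:
  fixes A :: "'a::second_countable_topology set"
  assumes "\<And>a. a \<in> A \<Longrightarrow> \<exists>T. open T \<and> A \<inter> T = {a}"
  shows "countable A"
proof -
  obtain B :: "'a set set" where B: "countable B" "topological_basis B"
    using ex_countable_basis by blast
  have "\<exists>b. b \<in> B \<and> A \<inter> b = {a}" if "a \<in> A" for a
  proof -
    obtain T where T: "open T" "A \<inter> T = {a}" using assms \<open>a \<in> A\<close> by blast
    then have "a \<in> T" by blast
    then obtain b where "b \<in> B" "a \<in> b" "b \<subseteq> T" using topological_basisE[OF B(2) T(1)] by metis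
    then show ?thesis using T(2) \<open>a \<in> A\<close> by blast
  qed
  then obtain F where F: "\<And>a. a \<in> A \<Longrightarrow> F a \<in> B \<and> A \<inter> F a = {a}" by metis
  have "inj_on F A" by (rule inj_onI) (metis F singleton_inject)
  moreover have "countable (F ` A)" using F by (intro countable_subset[OF _ B(1)]) auto
  ultimately show ?thesis by (rule countable_image_inj_on[rotated])
qed

text \<open>A nonzero derivative keeps the difference quotient away from 0 nearby, so such a zero is
  isolated.\<close>

lemma simple_zeros_countable:
  fixes f g :: "real \<Rightarrow> real"
  assumes "open D" "\<And>x. x \<in> D \<Longrightarrow> (f has_real_derivative g x) (at x)"
  shows "countable {x \<in> D. f x = 0 \<and> g x \<noteq> 0}"
proof (rule isolated_imp_countable)
  fix a assume a: "a \<in> {x \<in> D. f x = 0 \<and> g x \<noteq> 0}"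
  then have "((\<lambda>y. (f y - f a) / (y - a)) \<longlongrightarrow> g a) (at a)"
    using assms(2)[of a] by (simp add: has_field_derivative_iff)
  then have "\<forall>\<^sub>F y in at a. (f y - f a) / (y - a) \<noteq> 0"
    using a by (intro tendsto_imp_eventually_ne) auto
  then obtain T where "open T" "a \<in> T" "\<And>y. y \<in> T \<Longrightarrow> y \<noteq> a \<Longrightarrow> (f y - f a) / (y - a) \<noteq> 0"
    unfolding eventually_at_topological by blast
  then show "\<exists>T. open T \<and> {x \<in> D. f x = 0 \<and> g x \<noteq> 0} \<inter> T = {a}"
    using a by (intro exI[of _ T]) auto
qed

lemma AE_lborel_imp_lebH: "AE p in lborel. P p \<Longrightarrow> AE p in lebH. P p"
  using halfplane_measurable by (subst AE_restrict_space_iff) (auto dest: AE_completion)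

lemma AE_snd_nonzero: "AE p in lebH. snd p \<noteq> 0"
proof -
  have "negligible {p :: real \<times> real. p \<bullet> (0, 1) = 0}"
    by (rule negligible_standard_hyperplane) (simp add: Basis_prod_def)
  then have "{p :: real \<times> real. snd p = 0} \<in> null_sets lebesgue"
    by (simp add: negligible_iff_null_sets inner_prod_def case_prod_unfold)
  from AE_not_in[OF this] show ?thesis
    using halfplane_measurable by (subst AE_restrict_space_iff) auto
qed

text \<open>On every line parallel to an axis, apart from x = 0, the zeros of w with nonzero
  derivative along that line are countable, hence null. Fubini makes the exceptional set null in the
  plane, once for each partial derivative.\<close>

lemma AE_gradient_zero:
  assumes w: "loc_bdd w" and g: "loc_bdd g1" "loc_bdd g2"
    and d1: "\<And>t x. 0 < t \<Longrightarrow> x \<noteq> 0 \<Longrightarrow> ((\<lambda>t. w (t, x)) has_real_derivative g1 (t, x)) (at t)"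
    and d2: "\<And>t x. 0 < t \<Longrightarrow> x \<noteq> 0 \<Longrightarrow> ((\<lambda>x. w (t, x)) has_real_derivative g2 (t, x)) (at x)"
  shows "AE p in lebH. w p = 0 \<longrightarrow> g1 p = 0 \<and> g2 p = 0"
proof -
  define I where "I f p = indicator halfplane p * f p" for f :: "real \<times> real \<Rightarrow> real" and p
  have Im: "I w \<in> borel_measurable borel" "I g1 \<in> borel_measurable borel" "I g2 \<in> borel_measurable borel"
    using w g unfolding loc_bdd_def I_def[abs_def] by blast+
  have Hm: "halfplane \<in> sets borel" by (rule halfplane_measurable)
  define N where "N f = {p. p \<in> halfplane \<and> snd p \<noteq> 0 \<and> I w p = 0 \<and> I f p \<noteq> 0}" for f
  have Nm: "{p \<in> space (lborel \<Otimes>\<^sub>M lborel). p \<notin> N f} \<in> sets (lborel \<Otimes>\<^sub>M lborel)"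
    if "I f \<in> borel_measurable borel" for f
  proof -
    have sm: "snd \<in> borel_measurable (borel :: (real \<times> real) measure)"
      by (intro borel_measurable_continuous_onI continuous_intros)
    have "N f = halfplane \<inter> ((snd -` (- {0}) \<inter> space borel)
        \<inter> ((I w -` {0} \<inter> space borel) \<inter> (I f -` (- {0}) \<inter> space borel)))"
      by (auto simp: N_def)
    also have "\<dots> \<in> sets borel"
      by (intro sets.Int Hm measurable_sets[OF sm] measurable_sets[OF Im(1)] measurable_sets[OF that]) auto
    finally have "- N f \<in> sets borel" by (rule borel_comp)
    moreover have "{p \<in> space (lborel \<Otimes>\<^sub>M lborel). p \<notin> N f} = - N f"
      by (auto simp: space_pair_measure)
    ultimately show ?thesis by (simp only: lborel_prod sets_lborel)
  qed
  have "AE p in (lborel \<Otimes>\<^sub>M lborel). p \<notin> N g2"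
  proof (rule lborel_pair.AE_pair_measure[OF Nm[OF Im(3)]], rule AE_I2)
    fix t
    show "AE x in lborel. (t, x) \<notin> N g2"
    proof (cases "0 < t")
      case True
      then have "countable {x \<in> - {0}. w (t, x) = 0 \<and> g2 (t, x) \<noteq> 0}"
        by (intro simple_zeros_countable) (auto intro: d2)
      from AE_not_in[OF countable_imp_null_set_lborel[OF this]]
      show ?thesis by eventually_elim (auto simp: N_def I_def)
    qed (simp add: N_def)
  qed
  then have 2: "AE p in lborel. p \<notin> N g2" by (simp only: lborel_prod)
  have "AE x in lborel. AE t in lborel. (t, x) \<notin> N g1"
  proof (rule AE_I2)
    fix x :: real
    show "AE t in lborel. (t, x) \<notin> N g1"
    proof (cases "x = 0")
      case False
      then have "countable {t \<in> {0<..}. w (t, x) = 0 \<and> g1 (t, x) \<noteq> 0}"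
        by (intro simple_zeros_countable) (auto intro: d1)
      from AE_not_in[OF countable_imp_null_set_lborel[OF this]]
      show ?thesis by eventually_elim (auto simp: N_def I_def)
    qed (simp add: N_def)
  qed
  then have "AE t in lborel. AE x in lborel. (t, x) \<notin> N g1"
    using lborel_pair.AE_commute[of "\<lambda>t x. (t, x) \<notin> N g1"] Nm[OF Im(2)] by simp
  then have "AE p in (lborel \<Otimes>\<^sub>M lborel). p \<notin> N g1"
    by (rule lborel_pair.AE_pair_measure[OF Nm[OF Im(2)]])
  then have 1: "AE p in lborel. p \<notin> N g1" by (simp only: lborel_prod)
  have "AE p in lebH. p \<in> halfplane" by (rule AE_I2) simp
  with AE_lborel_imp_lebH[OF 1] AE_lborel_imp_lebH[OF 2] AE_snd_nonzero show ?thesis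
    by eventually_elim (auto simp: N_def I_def)
qed

text \<open>The functions \<open>ws n\<close> are there because \<open>w\<close> may have a kink at \<open>x = 0\<close>, where the
  test functions built from it must be smooth.\<close>

definition admissible :: "(real \<times> real \<Rightarrow> real) \<Rightarrow> (real \<times> real \<Rightarrow> real) \<Rightarrow> (real \<times> real \<Rightarrow> real) \<Rightarrow> bool" where
  "admissible w g1 g2 \<longleftrightarrow> loc_bdd w \<and> loc_bdd g1 \<and> loc_bdd g2 \<and>
     (\<forall>t x. 0 < t \<longrightarrow> x \<noteq> 0 \<longrightarrow> ((\<lambda>t. w (t, x)) has_real_derivative g1 (t, x)) (at t) \<and>
        ((\<lambda>x. w (t, x)) has_real_derivative g2 (t, x)) (at x)) \<and>
     (\<forall>d>0. \<exists>R\<ge>1. \<forall>p\<in>halfplane. d \<le> \<bar>w p\<bar> \<longrightarrow> p \<in> rect R) \<and>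
     (\<exists>ws. (\<forall>n. smooth_on halfplane (ws n)) \<and>
        (\<forall>R\<ge>1. \<exists>C. \<forall>n. \<forall>p\<in>rect R. \<bar>ws n p\<bar> \<le> C \<and>
           \<bar>frechet_derivative (ws n) (at p) (1, 0)\<bar> \<le> C \<and> \<bar>frechet_derivative (ws n) (at p) (0, 1)\<bar> \<le> C) \<and>
        (\<forall>p\<in>halfplane. snd p \<noteq> 0 \<longrightarrow> (\<lambda>n. ws n p) \<longlonglongrightarrow> w p \<and>
           (\<lambda>n. frechet_derivative (ws n) (at p) (1, 0)) \<longlonglongrightarrow> g1 p \<and>
           (\<lambda>n. frechet_derivative (ws n) (at p) (0, 1)) \<longlonglongrightarrow> g2 p))"

lemma admissible_vanishes:
  "admissible w g1 g2 \<Longrightarrow> 0 < d \<Longrightarrow> \<exists>R\<ge>1. \<forall>p\<in>halfplane. d \<le> \<bar>w p\<bar> \<longrightarrow> p \<in> rect R"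
  by (simp add: admissible_def)

lemma admissible_loc_bdd:
  "admissible w g1 g2 \<Longrightarrow> loc_bdd w" "admissible w g1 g2 \<Longrightarrow> loc_bdd g1" "admissible w g1 g2 \<Longrightarrow> loc_bdd g2"
  by (simp_all add: admissible_def)

text \<open>The partial derivatives are passed as separate data instead of going through
  \<open>grad\<close>, because the solution need not be differentiable at x = 0.\<close>

definition rgrad :: "(real \<times> real \<Rightarrow> real) \<Rightarrow> (real \<times> real \<Rightarrow> real) \<Rightarrow> real \<times> real \<Rightarrow> complex ^ 2" where
  "rgrad g1 g2 p = vector [complex_of_real (g1 p), complex_of_real (g2 p)]"

lemma rgrad_nth [simp]: "rgrad g1 g2 p $ 1 = complex_of_real (g1 p)" "rgrad g1 g2 p $ 2 = complex_of_real (g2 p)"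
  by (simp_all add: rgrad_def)

lemma norm_rgrad_power2: "(norm (rgrad g1 g2 p))\<^sup>2 = (g1 p)\<^sup>2 + (g2 p)\<^sup>2"
  by (simp add: norm_vec2_power2)

lemma rgrad_measurable:
  assumes "g1 \<in> borel_measurable M" "g2 \<in> borel_measurable M"
  shows "rgrad g1 g2 \<in> borel_measurable M"
proof -
  have "continuous_on UNIV (\<lambda>q. (\<chi> i. if i = 1 then complex_of_real (fst q) else complex_of_real (snd q)) :: complex ^ 2)"
  proof (rule continuous_on_vec_lambda)
    fix i :: 2
    show "continuous_on UNIV (\<lambda>q. if i = 1 then complex_of_real (fst q) else complex_of_real (snd q))"
      by (cases "i = 1") (simp_all add: continuous_on_of_real continuous_on_fst continuous_on_snd continuous_on_id)
  qed
  from borel_measurable_continuous_on[OF this borel_measurable_Pair[OF assms]]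
  have "(\<lambda>p. (\<chi> i. if i = 1 then complex_of_real (g1 p) else complex_of_real (g2 p)) :: complex ^ 2) \<in> borel_measurable M"
    by (simp cong: if_cong)
  moreover have "rgrad g1 g2 = (\<lambda>p. (\<chi> i. if i = 1 then complex_of_real (g1 p) else complex_of_real (g2 p)))"
    by (rule ext) (simp add: vec2_eq_iff)
  ultimately show ?thesis by simp
qed

section \<open>Smooth approximation of truncated functions\<close>

lemma cutoff_bounded_derivative:
  assumes "1 \<le> R"
  obtains C where "0 \<le> C" "\<And>p. p \<in> rect (2 * R) \<Longrightarrow> \<bar>cutoff R p\<bar> \<le> C \<and>
    \<bar>frechet_derivative (cutoff R) (at p) (1, 0)\<bar> \<le> C \<and> \<bar>frechet_derivative (cutoff R) (at p) (0, 1)\<bar> \<le> C"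
proof -
  have s: "smooth_on UNIV (cutoff R)" by (rule smooth_on_cutoff) simp
  have l: "loc_bdd (cutoff R)" "loc_bdd (\<lambda>p. frechet_derivative (cutoff R) (at p) (1, 0))"
    "loc_bdd (\<lambda>p. frechet_derivative (cutoff R) (at p) (0, 1))"
    using smooth_on_imp_continuous_on[OF s] smooth_on_imp_continuous_on[OF smooth_on_frechet_derivative[OF s]]
    by (auto intro!: loc_bdd_continuous continuous_on_subset[of UNIV _ halfplane] simp: Basis_prod_def)
  have R: "1 \<le> 2 * R" using assms by simp
  obtain C1 where C1: "0 \<le> C1" "\<And>p. p \<in> rect (2 * R) \<Longrightarrow> \<bar>cutoff R p\<bar> \<le> C1"
    by (rule loc_bddE[OF l(1) R]) blast
  obtain C2 where C2: "\<And>p. p \<in> rect (2 * R) \<Longrightarrow> \<bar>frechet_derivative (cutoff R) (at p) (1, 0)\<bar> \<le> C2"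
    by (rule loc_bddE[OF l(2) R]) blast
  obtain C3 where C3: "\<And>p. p \<in> rect (2 * R) \<Longrightarrow> \<bar>frechet_derivative (cutoff R) (at p) (0, 1)\<bar> \<le> C3"
    by (rule loc_bddE[OF l(3) R]) blast
  show ?thesis
  proof (rule that[of "max C1 (max C2 C3)"])
    show "0 \<le> max C1 (max C2 C3)" using C1(1) by simp
  qed (use C1(2) C2 C3 in \<open>auto simp: le_max_iff_disj\<close>)
qed

text \<open>Passing from R to R + 1 puts the closed rectangle inside an open set where the cutoff is
  constant, so the derivative vanishes up to its sides.\<close>

lemma cutoff_derivative_eq_0:
  assumes "1 \<le> R" "p \<in> rect R"
  shows "frechet_derivative (cutoff (R + 1)) (at p) = (\<lambda>h. 0)"
proof -
  define T where "T = {1 / (R + 1)<..<R + 1} \<times> {- (R + 1)<..<R + 1}"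
  have T: "open T" "T \<subseteq> rect (R + 1)" by (auto simp: T_def rect_def intro: open_Times)
  have "1 / (R + 1) < 1 / R" using assms(1) by (simp add: field_simps)
  then have "p \<in> T" using assms(2) by (force simp: T_def rect_def)
  have "((\<lambda>_. 1) has_derivative (\<lambda>h. 0)) (at p)" by simp
  then have "(cutoff (R + 1) has_derivative (\<lambda>h. 0)) (at p)"
    by (rule has_derivative_transform_within_open[OF _ T(1) \<open>p \<in> T\<close>])
      (use T(2) assms(1) cutoff_eq_1[of "R + 1"] in auto)
  then show ?thesis by (rule frechet_derivative_at[symmetric])
qed

lemma dtrunc_continuous: "continuous_on UNIV (dtrunc d)"
proof -
  have "isCont (flat n) x" for n x by (rule DERIV_isCont[OF flat_has_field_derivative])
  then have c: "continuous_on UNIV (flat n)" for n by (simp add: continuous_at_imp_continuous_on)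
  show ?thesis
    unfolding dtrunc_def divide_inverse
    by (intro continuous_intros continuous_on_compose2[OF c]) auto
qed

lemma trunc_continuous: "continuous_on UNIV (trunc d)"
  using trunc_has_field_derivative by (meson DERIV_isCont continuous_at_imp_continuous_on)

lemma loc_bdd_compose:
  assumes "continuous_on UNIV F" "loc_bdd w"
  shows "loc_bdd (\<lambda>p. F (w p))"
  unfolding loc_bdd_def
proof (intro conjI allI impI)
  have w: "(\<lambda>p. indicator halfplane p * w p) \<in> borel_measurable borel" using assms(2) by (simp add: loc_bdd_def)
  have "(\<lambda>p. indicator halfplane p * F (indicator halfplane p * w p)) \<in> borel_measurable borel"
    using halfplane_measurable by (intro borel_measurable_times borel_measurable_continuous_on[OF assms(1) w]) auto
  moreover have "indicator halfplane p * F (indicator halfplane p * w p) = indicator halfplane p * F (w p)" for p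
    by (simp add: indicator_def)
  ultimately show "(\<lambda>p. indicator halfplane p * F (w p)) \<in> borel_measurable borel" by simp
  fix R :: real assume "1 \<le> R"
  then obtain C where C: "\<And>p. p \<in> rect R \<Longrightarrow> \<bar>w p\<bar> \<le> C" using loc_bddE[OF assms(2)] by metis
  have "compact (F ` {- C..C})" by (intro compact_continuous_image continuous_on_subset[OF assms(1)]) auto
  then obtain D where D: "\<And>s. s \<in> {- C..C} \<Longrightarrow> \<bar>F s\<bar> \<le> D"
    using compact_imp_bounded by (fastforce simp: bounded_iff)
  have "\<bar>F (w p)\<bar> \<le> D" if "p \<in> rect R" for p
    using C[OF that] by (intro D) auto
  then show "\<exists>D. \<forall>p\<in>rect R. \<bar>F (w p)\<bar> \<le> D" by blast
qed

lemma grad_of_real: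
  assumes "(f has_derivative D) (at p)"
  shows "grad (\<lambda>p. complex_of_real (f p)) p = rgrad (\<lambda>p. D (1, 0)) (\<lambda>p. D (0, 1)) p"
proof -
  have "((\<lambda>p. complex_of_real (f p)) has_derivative (\<lambda>h. complex_of_real (D h))) (at p)"
    using assms by (rule has_derivative_of_real)
  from frechet_derivative_at[OF this, symmetric] show ?thesis
    by (simp add: vec2_eq_iff grad_nth)
qed

text \<open>The approximants are a cutoff times the truncation of the smooth \<open>ws n\<close>.
  The cutoff provides a common compact support, since \<open>ws n\<close> is not known to be small
  near the boundary. It disappears in the limit, because the truncation of w vanishes outside
  \<open>rect R\<close> and the cutoff is 1 with zero derivative on it. The second conclusion admits
  fields that are only locally bounded, as \<open>admissible_energy\<close> requires.\<close>

lemma admissible_truncation: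
  assumes adm: "admissible w g1 g2" and d: "0 < d"
  defines "V \<equiv> \<lambda>p. complex_of_real (trunc d (w p))"
    and "G \<equiv> rgrad (\<lambda>p. dtrunc d (w p) * g1 p) (\<lambda>p. dtrunc d (w p) * g2 p)"
  shows "Hdot10 V G"
    and "loc_bdd h1 \<Longrightarrow> loc_bdd h2 \<Longrightarrow> (\<And>\<phi>. test_function halfplane \<phi> \<Longrightarrow> A_form k (rgrad h1 h2) (grad \<phi>) = 0) \<Longrightarrow>
      A_form k (rgrad h1 h2) G = 0"
proof -
  from adm obtain ws where w: "loc_bdd w" "loc_bdd g1" "loc_bdd g2" and ws: "\<And>n. smooth_on halfplane (ws n)"
    and bd: "\<forall>R\<ge>1. \<exists>C. \<forall>n. \<forall>p\<in>rect R. \<bar>ws n p\<bar> \<le> C \<and>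
           \<bar>frechet_derivative (ws n) (at p) (1, 0)\<bar> \<le> C \<and> \<bar>frechet_derivative (ws n) (at p) (0, 1)\<bar> \<le> C"
    and lim: "\<And>p. p \<in> halfplane \<Longrightarrow> snd p \<noteq> 0 \<Longrightarrow> (\<lambda>n. ws n p) \<longlonglongrightarrow> w p \<and>
           (\<lambda>n. frechet_derivative (ws n) (at p) (1, 0)) \<longlonglongrightarrow> g1 p \<and>
           (\<lambda>n. frechet_derivative (ws n) (at p) (0, 1)) \<longlonglongrightarrow> g2 p"
    unfolding admissible_def by blast
  obtain R where R: "1 \<le> R" "\<And>p. p \<in> halfplane \<Longrightarrow> d \<le> \<bar>w p\<bar> \<Longrightarrow> p \<in> rect R"
    using admissible_vanishes[OF adm d] by blast
  define K where "K = rect (2 * (R + 1))"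
  have R1: "1 \<le> R + 1" "0 < 2 * (R + 1)" "1 \<le> 2 * (R + 1)" using R(1) by auto
  have K: "compact K" "K \<subseteq> halfplane" unfolding K_def by (rule compact_rect, rule rect_subset_halfplane[OF R1(2)])
  define c where "c = cutoff (R + 1)"
  define \<phi> where "\<phi> n p = complex_of_real (c p * trunc d (ws n p))" for n p
  have c0: "c p = 0" if "p \<notin> K" for p using cutoff_eq_0[OF R1(1)] that by (simp add: c_def K_def)
  have sc: "smooth_on halfplane c" unfolding c_def by (rule smooth_on_cutoff[OF open_halfplane])
  have t: "test_function halfplane (\<phi> n)" for n
  proof (rule test_functionI[OF _ open_halfplane K])
    have "smooth_on halfplane (\<lambda>p. c p * trunc d (ws n p))"
      by (intro smooth_on_mult smooth_on_trunc open_halfplane sc ws)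
    then show "smooth_on halfplane (\<phi> n)"
      unfolding \<phi>_def by (rule smooth_on_bounded_linear[OF bounded_linear_of_real open_halfplane])
  qed (simp add: \<phi>_def c0)
  define e1 where "e1 n p = c p * (dtrunc d (ws n p) * frechet_derivative (ws n) (at p) (1, 0))
      + frechet_derivative c (at p) (1, 0) * trunc d (ws n p)" for n p
  define e2 where "e2 n p = c p * (dtrunc d (ws n p) * frechet_derivative (ws n) (at p) (0, 1))
      + frechet_derivative c (at p) (0, 1) * trunc d (ws n p)" for n p
  have gr: "grad (\<phi> n) p = rgrad (e1 n) (e2 n) p" if "p \<in> halfplane" for n p
  proof -
    have "((\<lambda>p. trunc d (ws n p)) has_derivative (\<lambda>h. dtrunc d (ws n p) * frechet_derivative (ws n) (at p) h)) (at p)"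
      using has_derivative_compose[OF smooth_on_has_derivative[OF ws that]
          trunc_has_field_derivative[unfolded has_field_derivative_def]] .
    from has_derivative_mult[OF smooth_on_has_derivative[OF sc that] this]
    show ?thesis unfolding \<phi>_def by (subst grad_of_real) (auto simp: vec2_eq_iff e1_def e2_def)
  qed
  obtain C where C: "\<And>n p. p \<in> K \<Longrightarrow> \<bar>ws n p\<bar> \<le> C \<and>
           \<bar>frechet_derivative (ws n) (at p) (1, 0)\<bar> \<le> C \<and> \<bar>frechet_derivative (ws n) (at p) (0, 1)\<bar> \<le> C"
  proof -
    from bd R1(3) obtain C where "\<forall>n. \<forall>p\<in>rect (2 * (R + 1)). \<bar>ws n p\<bar> \<le> C \<and>
           \<bar>frechet_derivative (ws n) (at p) (1, 0)\<bar> \<le> C \<and> \<bar>frechet_derivative (ws n) (at p) (0, 1)\<bar> \<le> C"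
      by presburger
    then show ?thesis using that[of C] unfolding K_def by blast
  qed
  obtain D where D: "0 \<le> D" "\<And>p. p \<in> K \<Longrightarrow> \<bar>c p\<bar> \<le> D \<and>
    \<bar>frechet_derivative c (at p) (1, 0)\<bar> \<le> D \<and> \<bar>frechet_derivative c (at p) (0, 1)\<bar> \<le> D"
  proof -
    obtain D where "0 \<le> D" "\<And>p. p \<in> rect (2 * (R + 1)) \<Longrightarrow> \<bar>cutoff (R + 1) p\<bar> \<le> D \<and>
      \<bar>frechet_derivative (cutoff (R + 1)) (at p) (1, 0)\<bar> \<le> D \<and>
      \<bar>frechet_derivative (cutoff (R + 1)) (at p) (0, 1)\<bar> \<le> D"
      by (rule cutoff_bounded_derivative[OF R1(1)]) blast
    then show ?thesis using that[of D] unfolding K_def c_def by blast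
  qed
  \<comment> \<open>The 7 bounds the derivative of the truncation, and C + 2 d bounds the truncation
    itself by \<open>trunc_close\<close>.\<close>
  define E where "E = D * (7 * C) + D * (C + 2 * d)"
  have tr: "\<bar>trunc d (ws n p)\<bar> \<le> C + 2 * d" "\<bar>dtrunc d (ws n p)\<bar> \<le> 7" if "p \<in> K" for n p
    using C[OF that, of n] trunc_close[OF d, of "ws n p"] dtrunc_nonneg[of d "ws n p"] dtrunc_le[of d "ws n p"] by auto
  have C0: "0 \<le> C" if "p \<in> K" for p using C[OF that, of 0] by linarith
  have eb: "\<bar>e1 n p\<bar> \<le> E" "\<bar>e2 n p\<bar> \<le> E" "\<bar>c p * trunc d (ws n p)\<bar> \<le> E" if "p \<in> K" for n p
  proof -
    note a = C[OF that, of n] D(2)[OF that] tr[OF that, of n] C0[OF that]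
    show "\<bar>e1 n p\<bar> \<le> E" unfolding e1_def E_def
      by (rule order_trans[OF abs_triangle_ineq], intro add_mono)
        (use a D(1) d in \<open>auto simp: abs_mult intro!: mult_mono\<close>)
    show "\<bar>e2 n p\<bar> \<le> E" unfolding e2_def E_def
      by (rule order_trans[OF abs_triangle_ineq], intro add_mono)
        (use a D(1) d in \<open>auto simp: abs_mult intro!: mult_mono\<close>)
    have "\<bar>c p * trunc d (ws n p)\<bar> \<le> D * (C + 2 * d)"
      using a D(1) d by (auto simp: abs_mult intro!: mult_mono)
    moreover have "0 \<le> D * (7 * C)" using a D(1) by simp
    ultimately show "\<bar>c p * trunc d (ws n p)\<bar> \<le> E" unfolding E_def by linarith
  qed
  have b1: "norm (\<phi> n p) \<le> 2 * E" if "p \<in> K" for n p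
    using eb(3)[OF that, of n] eb(1)[OF that, of n] by (simp add: \<phi>_def del: of_real_mult)
  have b2: "norm (grad (\<phi> n) p) \<le> 2 * E" if "p \<in> K" for n p
  proof -
    have "norm (grad (\<phi> n) p) \<le> \<bar>e1 n p\<bar> + \<bar>e2 n p\<bar>"
      using norm_vec2_le_sum[of "grad (\<phi> n) p"] gr[of p n] K(2) that by auto
    then show ?thesis using eb[OF that, of n] by linarith
  qed
  have lb: "loc_bdd (\<lambda>p. dtrunc d (w p) * g1 p)" "loc_bdd (\<lambda>p. dtrunc d (w p) * g2 p)" "loc_bdd (\<lambda>p. trunc d (w p))"
    by (intro loc_bdd_mult loc_bdd_compose[OF dtrunc_continuous] loc_bdd_compose[OF trunc_continuous] w)+
  have Vm: "V \<in> borel_measurable lebH"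
    unfolding V_def using loc_bdd_lebH[OF lb(3)] by measurable
  have Gm: "G \<in> borel_measurable lebH"
    unfolding G_def by (intro rgrad_measurable loc_bdd_lebH lb)
  have conv: "(\<lambda>n. \<phi> n p) \<longlonglongrightarrow> V p \<and> (\<lambda>n. grad (\<phi> n) p) \<longlonglongrightarrow> G p" if p: "p \<in> halfplane" "snd p \<noteq> 0" for p
  proof -
    have "isCont (trunc d) (w p)" "isCont (dtrunc d) (w p)"
      using trunc_continuous dtrunc_continuous by (auto simp: continuous_on_eq_continuous_at)
    then have T: "(\<lambda>n. trunc d (ws n p)) \<longlonglongrightarrow> trunc d (w p)" "(\<lambda>n. dtrunc d (ws n p)) \<longlonglongrightarrow> dtrunc d (w p)"
      using lim[OF p] by (auto intro: isCont_tendsto_compose)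
    \<comment> \<open>Either the cutoff is invisible to first order at p, or the truncation and its
      derivative vanish. In both cases the cutoff drops out of the limits.\<close>
    have case': "c p = 1 \<and> frechet_derivative c (at p) = (\<lambda>h. 0) \<or> trunc d (w p) = 0 \<and> dtrunc d (w p) = 0"
    proof (cases "d \<le> \<bar>w p\<bar>")
      case True
      have "p \<in> rect R" by (rule R(2)[OF p(1) True])
      moreover have "rect R \<subseteq> rect (R + 1)" using R(1) by (intro rect_mono) auto
      ultimately show ?thesis
        using cutoff_derivative_eq_0[OF R(1)] cutoff_eq_1[OF R1(1)] unfolding c_def by blast
    next
      case False
      then show ?thesis using trunc_eq_0[OF d, of "w p"] by simp
    qed
    have "(\<lambda>n. c p * trunc d (ws n p)) \<longlonglongrightarrow> c p * trunc d (w p)" by (intro tendsto_intros T)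
    also have "c p * trunc d (w p) = trunc d (w p)" using case' by auto
    finally have 1: "(\<lambda>n. \<phi> n p) \<longlonglongrightarrow> V p" unfolding \<phi>_def V_def by (rule tendsto_of_real)
    have "(\<lambda>n. e1 n p) \<longlonglongrightarrow> c p * (dtrunc d (w p) * g1 p) + frechet_derivative c (at p) (1, 0) * trunc d (w p)"
      unfolding e1_def using lim[OF p] by (intro tendsto_intros T) auto
    moreover have "c p * (dtrunc d (w p) * g1 p) + frechet_derivative c (at p) (1, 0) * trunc d (w p) = dtrunc d (w p) * g1 p"
      using case' by auto
    ultimately have 2: "(\<lambda>n. e1 n p) \<longlonglongrightarrow> dtrunc d (w p) * g1 p" by simp
    have "(\<lambda>n. e2 n p) \<longlonglongrightarrow> c p * (dtrunc d (w p) * g2 p) + frechet_derivative c (at p) (0, 1) * trunc d (w p)"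
      unfolding e2_def using lim[OF p] by (intro tendsto_intros T) auto
    moreover have "c p * (dtrunc d (w p) * g2 p) + frechet_derivative c (at p) (0, 1) * trunc d (w p) = dtrunc d (w p) * g2 p"
      using case' by auto
    ultimately have 3: "(\<lambda>n. e2 n p) \<longlonglongrightarrow> dtrunc d (w p) * g2 p" by simp
    have "(\<lambda>n. grad (\<phi> n) p) \<longlonglongrightarrow> G p"
    proof (rule vec_tendstoI)
      fix i :: 2
      have "i = 1 \<or> i = 2" by (rule exhaust_2)
      then show "(\<lambda>n. grad (\<phi> n) p $ i) \<longlonglongrightarrow> G p $ i"
        using tendsto_of_real[OF 2] tendsto_of_real[OF 3] unfolding gr[OF p(1)] G_def by auto
    qed
    with 1 show ?thesis by blast
  qed
  have "AE p in lebH. p \<in> halfplane" by (rule AE_I2) simp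
  with AE_snd_nonzero have AE: "AE p in lebH. (\<lambda>n. \<phi> n p) \<longlonglongrightarrow> V p" "AE p in lebH. (\<lambda>n. grad (\<phi> n) p) \<longlonglongrightarrow> G p"
    using conv by (auto elim!: eventually_elim2)
  have \<phi>0: "\<phi> n p = 0" if "p \<notin> K" for n p using c0[OF that] by (simp add: \<phi>_def)
  show "Hdot10 V G"
    by (rule Hdot10_of_bounded_limit(1)[OF t K _ _ _ Vm Gm AE]) (fact \<phi>0 b1 b2)+
  assume h: "loc_bdd h1" "loc_bdd h2" and z: "\<And>\<phi>. test_function halfplane \<phi> \<Longrightarrow> A_form k (rgrad h1 h2) (grad \<phi>) = 0"
  obtain B1 B2 where B: "\<And>p. p \<in> K \<Longrightarrow> \<bar>h1 p\<bar> \<le> B1" "\<And>p. p \<in> K \<Longrightarrow> \<bar>h2 p\<bar> \<le> B2"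
    using loc_bddE[OF h(1) R1(3)] loc_bddE[OF h(2) R1(3)] unfolding K_def by metis
  have "norm (rgrad h1 h2 p) \<le> B1 + B2" if "p \<in> K" for p
    using norm_vec2_le_sum[of "rgrad h1 h2 p"] B[OF that] by simp
  then have "(\<lambda>n. A_form k (rgrad h1 h2) (grad (\<phi> n))) \<longlonglongrightarrow> A_form k (rgrad h1 h2) G"
    by (intro Hdot10_of_bounded_limit(2)[OF t K _ _ _ Vm Gm AE, where C = "2 * E" and B = "B1 + B2"]
        \<phi>0 b1 b2 rgrad_measurable loc_bdd_lebH h) 
  then have "(\<lambda>n. 0 :: complex) \<longlonglongrightarrow> A_form k (rgrad h1 h2) G" by (simp add: z[OF t])
  then show "A_form k (rgrad h1 h2) G = 0" by (simp add: LIMSEQ_const_iff)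
qed

lemma loc_bdd_compact_integrable:
  assumes f: "loc_bdd f" and R: "1 \<le> R" and z: "\<And>p. p \<in> halfplane \<Longrightarrow> p \<notin> rect R \<Longrightarrow> f p = 0"
  shows "integrable lebH f"
proof -
  obtain C where C: "0 \<le> C" "\<And>p. p \<in> rect R \<Longrightarrow> \<bar>f p\<bar> \<le> C" by (rule loc_bddE[OF f R]) blast
  show ?thesis
  proof (rule Bochner_Integration.integrable_bound[OF _ loc_bdd_lebH[OF f]])
    show "integrable lebH (\<lambda>p. C * indicator (rect R) p :: real)"
      using R by (intro compact_indicator_integrable compact_rect rect_subset_halfplane) auto
    show "AE p in lebH. norm (f p) \<le> norm (C * indicator (rect R) p :: real)"
    proof (rule AE_I2)
      fix p assume "p \<in> space lebH"
      then show "norm (f p) \<le> norm (C * indicator (rect R) p :: real)"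
        using C z[of p] by (cases "p \<in> rect R") auto
    qed
  qed
qed

text \<open>Testing the equation for \<open>u1 - w\<close> with truncations of \<open>w\<close> bounds the energy of \<open>w\<close>
  by that of \<open>u1\<close>, because the antisymmetric part of the coefficients drops out.\<close>

lemma admissible_energy:
  assumes adm: "admissible w g1 g2" and h: "loc_bdd h1" "loc_bdd h2" "square_integrable (rgrad h1 h2)"
    and z: "\<And>\<phi>. test_function halfplane \<phi> \<Longrightarrow> A_form k (rgrad (\<lambda>p. h1 p - g1 p) (\<lambda>p. h2 p - g2 p)) (grad \<phi>) = 0"
  shows "square_integrable (rgrad g1 g2)"
proof -
  note g = admissible_loc_bdd[OF adm]
  define Q where "Q p = (g1 p)\<^sup>2 + (g2 p)\<^sup>2" for p
  define P where "P p = (h1 p)\<^sup>2 + (h2 p)\<^sup>2" for p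
  have Pi: "integrable lebH P" using h(3) by (simp add: square_integrable_def norm_rgrad_power2 P_def[abs_def])
  have Ql: "loc_bdd Q" unfolding Q_def power2_eq_square by (intro loc_bdd_add loc_bdd_mult g)
  \<comment> \<open>The 7 comes from \<open>dtrunc_le\<close> and 1 + k^2 from completing the square
    below; half of the energy is absorbed on the left. The bound does not involve d.\<close>
  define E where "E = 7 * (1 + k\<^sup>2) * (\<integral>p. P p \<partial>lebH)"
  have P0: "0 \<le> P p" and Q0: "0 \<le> Q p" for p by (auto simp: P_def Q_def)
  have bound: "(\<integral>\<^sup>+p. ennreal (dtrunc d (w p) * Q p) \<partial>lebH) \<le> ennreal E" if d: "0 < d" for d
  proof -
    define D where "D p = dtrunc d (w p)" for p
    define s where "s p = k * sgn (snd p)" for p :: "real \<times> real"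
    \<comment> \<open>The real pairing of A h with the gradient of w. The pairing of that gradient
      with itself leaves only Q, since the antisymmetric terms cancel.\<close>
    define b where "b p = (h1 p + s p * h2 p) * g1 p + (h2 p - s p * h1 p) * g2 p" for p
    have Dl: "loc_bdd D" unfolding D_def by (rule loc_bdd_compose[OF dtrunc_continuous g(1)])
    have sl: "loc_bdd s" unfolding s_def by (intro loc_bdd_mult loc_bdd_const loc_bdd_sgn)
    have bl: "loc_bdd b" unfolding b_def by (intro loc_bdd_add loc_bdd_diff loc_bdd_mult sl h(1,2) g)
    obtain R where R: "1 \<le> R" "\<And>p. p \<in> halfplane \<Longrightarrow> d \<le> \<bar>w p\<bar> \<Longrightarrow> p \<in> rect R"
      using admissible_vanishes[OF adm d] by blast
    have D0: "D p = 0" if "p \<in> halfplane" "p \<notin> rect R" for p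
    proof -
      have "\<not> d \<le> \<bar>w p\<bar>" using R(2)[OF that(1)] that(2) by blast
      then show ?thesis unfolding D_def using trunc_eq_0(2)[OF d, of "w p"] by simp
    qed
    have i: "integrable lebH (\<lambda>p. D p * b p)" "integrable lebH (\<lambda>p. D p * Q p)"
      by (rule loc_bdd_compact_integrable[OF loc_bdd_mult[OF Dl bl] R(1)], simp add: D0)
        (rule loc_bdd_compact_integrable[OF loc_bdd_mult[OF Dl Ql] R(1)], simp add: D0)
    have "A_form k (rgrad (\<lambda>p. h1 p - g1 p) (\<lambda>p. h2 p - g2 p)) (rgrad (\<lambda>p. dtrunc d (w p) * g1 p) (\<lambda>p. dtrunc d (w p) * g2 p)) = 0"
      by (intro admissible_truncation(2)[OF adm d] loc_bdd_diff g h(1,2) z)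
    moreover have "A_form k (rgrad (\<lambda>p. h1 p - g1 p) (\<lambda>p. h2 p - g2 p)) (rgrad (\<lambda>p. dtrunc d (w p) * g1 p) (\<lambda>p. dtrunc d (w p) * g2 p))
        = (\<integral>p. complex_of_real (D p * b p - D p * Q p) \<partial>lebH)"
      unfolding A_form_def hermitian_A_coeff
      by (intro Bochner_Integration.integral_cong refl)
        (simp add: complex_eq_iff D_def b_def Q_def s_def power2_eq_square algebra_simps)
    ultimately have "(\<integral>p. D p * b p - D p * Q p \<partial>lebH) = 0"
      by (simp only: integral_complex_of_real of_real_eq_0_iff)
    then have eq: "(\<integral>p. D p * Q p \<partial>lebH) = (\<integral>p. D p * b p \<partial>lebH)" using i by simp
    have "(\<integral>p. D p * b p \<partial>lebH) \<le> (\<integral>p. (1 / 2) * (D p * Q p) + (7 * (1 + k\<^sup>2) / 2) * P p \<partial>lebH)"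
    proof (rule integral_mono)
      show "integrable lebH (\<lambda>p. (1 / 2) * (D p * Q p) + (7 * (1 + k\<^sup>2) / 2) * P p)"
        using i Pi by (intro Bochner_Integration.integrable_add integrable_mult_right) auto
      fix p
      \<comment> \<open>Completing the square: the vector A h has squared length (1 + s^2)
        P.\<close>
      have "Q p + (1 + (s p)\<^sup>2) * P p - 2 * b p
          = (g1 p - (h1 p + s p * h2 p))\<^sup>2 + (g2 p - (h2 p - s p * h1 p))\<^sup>2"
        by (simp add: b_def Q_def P_def power2_eq_square algebra_simps)
      also have "0 \<le> \<dots>" by simp
      finally have "b p \<le> Q p / 2 + (1 + (s p)\<^sup>2) * P p / 2" by simp
      also have "(1 + (s p)\<^sup>2) * P p / 2 \<le> (1 + k\<^sup>2) * P p / 2"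
        using P0[of p] by (intro divide_right_mono mult_right_mono) (auto simp: s_def power_mult_distrib sgn_if)
      finally have "D p * b p \<le> D p * (Q p / 2 + (1 + k\<^sup>2) * P p / 2)"
        using dtrunc_nonneg[of d "w p"] by (intro mult_left_mono) (auto simp: D_def)
      also have "\<dots> = (1 / 2) * (D p * Q p) + D p * ((1 + k\<^sup>2) * P p / 2)" by (simp add: algebra_simps)
      also have "D p * ((1 + k\<^sup>2) * P p / 2) \<le> 7 * ((1 + k\<^sup>2) * P p / 2)"
        using dtrunc_le[of d "w p"] P0[of p] by (intro mult_right_mono) (auto simp: D_def)
      finally show "D p * b p \<le> (1 / 2) * (D p * Q p) + (7 * (1 + k\<^sup>2) / 2) * P p"
        by (simp add: algebra_simps)
    qed (rule i)
    also have "\<dots> = (1 / 2) * (\<integral>p. D p * Q p \<partial>lebH) + (7 * (1 + k\<^sup>2) / 2) * (\<integral>p. P p \<partial>lebH)"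
      using i(2) Pi by (subst Bochner_Integration.integral_add) auto
    finally have "(\<integral>p. D p * Q p \<partial>lebH) \<le> E" using eq by (simp add: E_def)
    moreover have "(\<integral>\<^sup>+p. ennreal (D p * Q p) \<partial>lebH) = ennreal (\<integral>p. D p * Q p \<partial>lebH)"
      by (rule nn_integral_eq_integral[OF i(2)]) (auto simp: D_def dtrunc_nonneg Q0)
    ultimately show ?thesis unfolding D_def by (simp add: ennreal_leI)
  qed
  have null: "AE p in lebH. w p = 0 \<longrightarrow> g1 p = 0 \<and> g2 p = 0"
    using adm by (intro AE_gradient_zero g) (auto simp: admissible_def)
  have [measurable]: "Q \<in> borel_measurable lebH" by (rule loc_bdd_lebH[OF Ql])
  have [measurable]: "(\<lambda>p. dtrunc d (w p)) \<in> borel_measurable lebH" for d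
    by (rule loc_bdd_lebH[OF loc_bdd_compose[OF dtrunc_continuous g(1)]])
  let ?f = "\<lambda>n p. ennreal (dtrunc (inverse (real (Suc n))) (w p) * Q p)"
  \<comment> \<open>Fatou's lemma for d tending to 0: the weight tends to 1 where w is nonzero, and
    elsewhere Q vanishes almost everywhere.\<close>
  have "(\<integral>\<^sup>+p. ennreal (Q p) \<partial>lebH) \<le> (\<integral>\<^sup>+p. liminf (\<lambda>n. ?f n p) \<partial>lebH)"
  proof (rule nn_integral_mono_AE)
    show "AE p in lebH. ennreal (Q p) \<le> liminf (\<lambda>n. ?f n p)"
      using null
    proof eventually_elim
      case (elim p)
      show ?case
      proof (cases "w p = 0")
        case True
        then show ?thesis using elim by (simp add: Q_def)
      next
        case False
        have "(\<lambda>n. dtrunc (inverse (real (Suc n))) (w p) * Q p) \<longlonglongrightarrow> 1 * Q p"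
          by (intro tendsto_intros dtrunc_tendsto_1 False)
        then have "(\<lambda>n. ?f n p) \<longlonglongrightarrow> ennreal (Q p)" using tendsto_ennrealI by fastforce
        from lim_imp_Liminf[OF _ this] show ?thesis by simp
      qed
    qed
  qed
  also have "\<dots> \<le> liminf (\<lambda>n. \<integral>\<^sup>+p. ?f n p \<partial>lebH)"
    by (rule nn_integral_liminf) measurable
  also have "\<dots> \<le> liminf (\<lambda>n. ennreal E)"
    by (intro Liminf_mono always_eventually allI bound) auto
  also have "\<dots> = ennreal E" by (rule Liminf_const) simp
  finally have "(\<integral>\<^sup>+p. ennreal (Q p) \<partial>lebH) \<le> ennreal E" .
  from le_less_trans[OF this ennreal_less_top] have "(\<integral>\<^sup>+p. ennreal (Q p) \<partial>lebH) < \<infinity>" by simp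
  then show ?thesis
    unfolding square_integrable_iff_nn norm_rgrad_power2 Q_def[symmetric]
    by (auto intro!: rgrad_measurable loc_bdd_lebH g)
qed

text \<open>The truncations at levels d = 1 / (m + 1) lie in the space and are uniformly within 2 d
  of w. Their gradients converge in the mean by dominated convergence: the factor D - 1 is at most 7
  in modulus, so 49 times the squared gradient dominates. Completeness then yields w.\<close>

lemma admissible_Hdot10:
  assumes adm: "admissible w g1 g2" and sq: "square_integrable (rgrad g1 g2)"
  shows "Hdot10 (\<lambda>p. complex_of_real (w p)) (rgrad g1 g2)"
proof -
  note g = admissible_loc_bdd[OF adm]
  define \<delta> where "\<delta> m = inverse (real (Suc m))" for m
  define D where "D m p = dtrunc (\<delta> m) (w p)" for m p
  have \<delta>: "0 < \<delta> m" for m by (simp add: \<delta>_def)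
  note [measurable] = loc_bdd_lebH[OF g(1)] loc_bdd_lebH[OF g(2)] loc_bdd_lebH[OF g(3)]
  have Dl: "loc_bdd (D m)" for m unfolding D_def by (rule loc_bdd_compose[OF dtrunc_continuous g(1)])
  note [measurable] = loc_bdd_lebH[OF Dl]
  have null: "AE p in lebH. w p = 0 \<longrightarrow> g1 p = 0 \<and> g2 p = 0"
    using adm by (intro AE_gradient_zero g) (auto simp: admissible_def)
  define Q where "Q p = (g1 p)\<^sup>2 + (g2 p)\<^sup>2" for p
  have "integrable lebH Q"
    using sq by (simp add: square_integrable_def norm_rgrad_power2 Q_def[abs_def])
  then have Qi: "integrable lebH (\<lambda>p. 49 * Q p)" by (rule integrable_mult_right)
  show ?thesis
  proof (rule Hdot10_closed)
    show "Hdot10 (\<lambda>p. complex_of_real (trunc (\<delta> m) (w p))) (rgrad (\<lambda>p. D m p * g1 p) (\<lambda>p. D m p * g2 p))" for m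
      unfolding D_def by (rule admissible_truncation(1)[OF adm \<delta>])
    show "(\<lambda>p. complex_of_real (w p)) \<in> borel_measurable lebH" by measurable
    show "rgrad g1 g2 \<in> borel_measurable lebH" by (intro rgrad_measurable) measurable
    show "norm (complex_of_real (trunc (\<delta> m) (w p)) - complex_of_real (w p)) \<le> 2 * \<delta> m" for m p
      using trunc_close[OF \<delta>, of m "w p"] by (simp flip: of_real_diff)
    show "(\<lambda>m. 2 * \<delta> m) \<longlonglongrightarrow> 0"
      unfolding \<delta>_def using tendsto_mult[OF tendsto_const[of 2] LIMSEQ_inverse_real_of_nat] by simp
    have eq: "(norm (rgrad (\<lambda>p. D m p * g1 p) (\<lambda>p. D m p * g2 p) p - rgrad g1 g2 p))\<^sup>2 = (D m p - 1)\<^sup>2 * Q p" for m p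
    proof -
      have "rgrad (\<lambda>p. D m p * g1 p) (\<lambda>p. D m p * g2 p) p - rgrad g1 g2 p
          = rgrad (\<lambda>p. (D m p - 1) * g1 p) (\<lambda>p. (D m p - 1) * g2 p) p"
        by (simp add: vec2_eq_iff algebra_simps)
      then show ?thesis
        by (simp only: norm_rgrad_power2) (simp add: Q_def power_mult_distrib distrib_left)
    qed
    have "(\<lambda>m. \<integral>\<^sup>+p. ennreal ((D m p - 1)\<^sup>2 * Q p) \<partial>lebH) \<longlonglongrightarrow> (\<integral>\<^sup>+p. 0 \<partial>lebH)"
    proof (rule nn_integral_dominated_convergence[where w = "\<lambda>p. ennreal (49 * Q p)"])
      show "AE p in lebH. ennreal ((D m p - 1)\<^sup>2 * Q p) \<le> ennreal (49 * Q p)" for m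
      proof (rule AE_I2, rule ennreal_leI)
        fix p
        have "\<bar>D m p - 1\<bar> \<le> 7" unfolding D_def
          using dtrunc_nonneg[of "\<delta> m" "w p"] dtrunc_le[of "\<delta> m" "w p"] by (auto simp: abs_le_iff)
        then have "\<bar>D m p - 1\<bar>\<^sup>2 \<le> 7\<^sup>2" by (intro power_mono) auto
        then show "(D m p - 1)\<^sup>2 * Q p \<le> 49 * Q p" by (intro mult_right_mono) (auto simp: Q_def)
      qed
      show "(\<integral>\<^sup>+p. ennreal (49 * Q p) \<partial>lebH) < \<infinity>"
        by (subst nn_integral_eq_integral[OF Qi]) (auto simp: Q_def less_top[symmetric])
      show "AE p in lebH. (\<lambda>m. ennreal ((D m p - 1)\<^sup>2 * Q p)) \<longlonglongrightarrow> 0"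
        using null
      proof eventually_elim
        case (elim p)
        show ?case
        proof (cases "w p = 0")
          case True
          then show ?thesis using elim by (simp add: Q_def)
        next
          case False
          have "(\<lambda>m. (D m p - 1)\<^sup>2 * Q p) \<longlonglongrightarrow> (1 - 1)\<^sup>2 * Q p"
            unfolding D_def \<delta>_def by (intro tendsto_intros dtrunc_tendsto_1 False)
          from tendsto_ennrealI[OF this] show ?thesis by simp
        qed
      qed
    qed (unfold Q_def, measurable)
    then show "(\<lambda>m. \<integral>\<^sup>+p. ennreal ((norm (rgrad (\<lambda>p. D m p * g1 p) (\<lambda>p. D m p * g2 p) p - rgrad g1 g2 p))\<^sup>2) \<partial>lebH) \<longlonglongrightarrow> 0"
      unfolding eq by simp
  qed
qed

section \<open>Uniqueness\<close>

text \<open>Hardy's inequality; the proof integrates \<open>\<partial>\<^sub>t (\<bar>\<phi>\<bar>\<^sup>2 / t)\<close>.\<close>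

lemma Hardy_inequality:
  assumes \<phi>: "test_function halfplane \<phi>" and R: "1 \<le> R"
  shows "(\<integral>\<^sup>+p. ennreal ((norm (\<phi> p))\<^sup>2) \<partial>(lebesgue_on (rect R)))
    \<le> ennreal (4 * R\<^sup>2) * (\<integral>\<^sup>+p. ennreal ((norm (grad \<phi> p))\<^sup>2) \<partial>lebH)"
proof -
  obtain K where s: "smooth_on UNIV \<phi>" and K: "compact K" "K \<subseteq> halfplane" "\<And>p. p \<notin> K \<Longrightarrow> \<phi> p = 0"
    by (rule test_functionE[OF \<phi>]) blast
  define \<phi>t where "\<phi>t p = frechet_derivative \<phi> (at p) (1, 0)" for p
  have c: "continuous_on UNIV \<phi>" "continuous_on UNIV \<phi>t"
    using smooth_on_imp_continuous_on[OF s] smooth_on_imp_continuous_on[OF smooth_on_frechet_derivative[OF s]]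
    by (auto simp: \<phi>t_def[abs_def] Basis_prod_def)
  have z: "\<phi>t p = 0" if "p \<notin> K" for p
    using grad_eq_0[OF compact_imp_closed[OF K(1)] K(3) that] grad_nth[of \<phi> p] by (simp add: \<phi>t_def)
  obtain S where S: "1 \<le> S" "K \<subseteq> rect S" using compact_subset_rect[OF K(1,2)] by blast
  define f where "f p = (cmod (\<phi> p))\<^sup>2 / fst p" for p
  define a where "a p = (cmod (\<phi> p))\<^sup>2 / (fst p)\<^sup>2" for p
  define b where "b p = (cmod (\<phi>t p))\<^sup>2" for p
  \<comment> \<open>The t-derivative of f on the half-plane, so its integral vanishes.\<close>
  define g where "g p = 2 * (\<phi> p \<bullet> \<phi>t p) / fst p - a p" for p
  have lb: "loc_bdd a" "loc_bdd b" "loc_bdd g"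
    unfolding a_def b_def g_def
    by (auto intro!: loc_bdd_continuous continuous_intros continuous_on_subset[OF c(1)] continuous_on_subset[OF c(2)])
  have zero: "a p = 0" "b p = 0" "g p = 0" "f p = 0" if "p \<notin> K" for p
    using z[OF that] K(3)[OF that] by (auto simp: a_def b_def g_def f_def)
  have out: "p \<notin> K" if "p \<notin> rect S \<or> p \<notin> halfplane" for p using that S(2) K(2) by blast
  have i: "integrable lebH a" "integrable lebH b" "integrable lebH g"
    using out zero by (auto intro!: loc_bdd_compact_integrable[OF _ S(1)] lb)
  have gm: "g \<in> borel_measurable borel"
  proof -
    have "(\<lambda>p. indicator halfplane p * g p) = g" using out zero by (auto simp: indicator_def fun_eq_iff)
    then show ?thesis using lb(3) by (simp add: loc_bdd_def)
  qed
  have gi: "integrable lborel g"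
  proof -
    have "integrable lebesgue (\<lambda>p. indicator halfplane p *\<^sub>R g p)"
      using i(3) halfplane_measurable by (subst (asm) integrable_restrict_space) auto
    moreover have "(\<lambda>p. indicator halfplane p *\<^sub>R g p) = g" using out zero by (auto simp: indicator_def fun_eq_iff)
    ultimately show ?thesis using gm by (simp add: integrable_completion)
  qed
  obtain r where r: "\<And>p. p \<in> K \<Longrightarrow> norm p \<le> r" using compact_imp_bounded[OF K(1)] by (auto simp: bounded_iff)
  have rout: "(t, x) \<notin> K" if "r < \<bar>t\<bar>" for t x
    using r[of "(t, x)"] norm_fst_le[of t x] that by auto
  have "(\<integral>p. g p \<partial>lborel) = 0"
  proof (rule integral_fst_derivative_compact_support[OF gi, where f = f and r = r])
    show "((\<lambda>t. f (t, x)) has_vector_derivative g (t, x)) (at t)" for t x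
    proof (cases "(t, x) \<in> K")
      case True
      then have t: "0 < t" using K(2) mem_halfplane(1) by blast
      have d: "((\<lambda>t. \<phi> (t, x)) has_derivative (\<lambda>h. h *\<^sub>R \<phi>t (t, x))) (at t)"
        using test_function_partials(1)[OF \<phi>, of x t] by (simp add: has_vector_derivative_def \<phi>t_def)
      have "((\<lambda>t. \<phi> (t, x) \<bullet> \<phi> (t, x)) has_derivative (\<lambda>h. \<phi> (t, x) \<bullet> (h *\<^sub>R \<phi>t (t, x)) + (h *\<^sub>R \<phi>t (t, x)) \<bullet> \<phi> (t, x))) (at t)"
        by (rule has_derivative_inner[OF d d])
      then have "((\<lambda>t. (cmod (\<phi> (t, x)))\<^sup>2) has_real_derivative 2 * (\<phi> (t, x) \<bullet> \<phi>t (t, x))) (at t)"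
        unfolding has_field_derivative_def power2_norm_eq_inner
        by (rule has_derivative_eq_rhs) (auto simp: fun_eq_iff inner_commute)
      from DERIV_divide[OF this DERIV_ident] t
      have "((\<lambda>t. (cmod (\<phi> (t, x)))\<^sup>2 / t) has_real_derivative
          (2 * (\<phi> (t, x) \<bullet> \<phi>t (t, x)) * t - (cmod (\<phi> (t, x)))\<^sup>2 * 1) / (t * t)) (at t)" by simp
      moreover have "(2 * (\<phi> (t, x) \<bullet> \<phi>t (t, x)) * t - (cmod (\<phi> (t, x)))\<^sup>2 * 1) / (t * t) = g (t, x)"
        using t by (simp add: g_def a_def power2_eq_square diff_divide_distrib)
      ultimately show ?thesis by (simp add: f_def has_real_derivative_iff_has_vector_derivative)
    next
      case False
      then show ?thesis
        using vector_derivative_zero_outside[OF compact_imp_closed[OF K(1)], of f "\<lambda>t. (t, x)" t] zero(3)[OF False]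
        by (simp add: zero(4) continuous_on_Pair)
    qed
  qed (use rout zero in auto)
  moreover have "(\<integral>p. g p \<partial>lebH) = (\<integral>p. g p \<partial>lborel)"
    by (rule integral_lebH_lborel[OF gm]) (use out zero in auto)
  ultimately have g0: "(\<integral>p. g p \<partial>lebH) = 0" by simp
  have "(\<integral>p. a p \<partial>lebH) \<le> (\<integral>p. - (2 * g p) + 4 * b p \<partial>lebH)"
  proof (rule integral_mono_AE)
    have "AE p in lebH. p \<in> halfplane" by (rule AE_I2) simp
    then show "AE p in lebH. a p \<le> - (2 * g p) + 4 * b p"
    proof eventually_elim
      case (elim p)
      then have t: "0 < fst p" by simp
      \<comment> \<open>The weights 1 and 2 turn the cross term into a multiple of the derivative g:
        the expanded square says a \<le> 4 b - 2 g, and g integrates to 0.\<close>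
      have "0 \<le> (norm (\<phi> p /\<^sub>R fst p - 2 *\<^sub>R \<phi>t p))\<^sup>2" by simp
      also have "\<dots> = a p - 4 * (\<phi> p \<bullet> \<phi>t p) / fst p + 4 * b p"
        unfolding a_def b_def power2_norm_eq_inner
        using t by (simp add: inner_diff_left inner_diff_right inner_commute power2_eq_square field_simps)
      finally show ?case by (simp add: g_def)
    qed
  qed (use i in auto)
  also have "\<dots> = 4 * (\<integral>p. b p \<partial>lebH)" using i g0 by simp
  finally have ab: "(\<integral>p. a p \<partial>lebH) \<le> 4 * (\<integral>p. b p \<partial>lebH)" .
  have "rect R \<in> sets lebesgue" using lmeasurable_compact[OF compact_rect] by (simp add: fmeasurable_def)
  have "(\<integral>\<^sup>+p. ennreal ((norm (\<phi> p))\<^sup>2) \<partial>(lebesgue_on (rect R))) \<le> (\<integral>\<^sup>+p. ennreal (R\<^sup>2 * a p) \<partial>(lebesgue_on (rect R)))"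
  proof (rule nn_integral_mono, rule ennreal_leI)
    fix p assume "p \<in> space (lebesgue_on (rect R))"
    then have p: "p \<in> rect R" by simp
    then have t: "0 < fst p" "fst p \<le> R" using rect_subset_halfplane[of R] R by (auto simp: rect_def)
    then have "(fst p)\<^sup>2 \<le> R\<^sup>2" by (intro power_mono) auto
    then have "(fst p)\<^sup>2 * a p \<le> R\<^sup>2 * a p" by (intro mult_right_mono) (auto simp: a_def)
    then show "(norm (\<phi> p))\<^sup>2 \<le> R\<^sup>2 * a p" using t by (simp add: a_def)
  qed
  also have "\<dots> \<le> (\<integral>\<^sup>+p. ennreal (R\<^sup>2 * a p) \<partial>lebH)"
    using R \<open>rect R \<in> sets lebesgue\<close> halfplane_measurable
    by (intro nn_integral_lebesgue_on_mono rect_subset_halfplane) auto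
  also have "\<dots> = ennreal (R\<^sup>2 * (\<integral>p. a p \<partial>lebH))"
  proof -
    have "0 \<le> R\<^sup>2 * a p" for p by (simp add: a_def)
    then show ?thesis
      by (subst nn_integral_eq_integral[OF integrable_mult_right[OF i(1)]]) auto
  qed
  also have "\<dots> \<le> ennreal (R\<^sup>2 * (4 * (\<integral>p. b p \<partial>lebH)))"
    by (intro ennreal_leI mult_left_mono ab) auto
  also have "\<dots> = ennreal (4 * R\<^sup>2) * (\<integral>\<^sup>+p. ennreal (b p) \<partial>lebH)"
    using i(2) by (subst nn_integral_eq_integral) (auto simp: b_def ennreal_mult'[symmetric] mult_ac)
  also have "\<dots> \<le> ennreal (4 * R\<^sup>2) * (\<integral>\<^sup>+p. ennreal ((norm (grad \<phi> p))\<^sup>2) \<partial>lebH)"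
    by (intro mult_left_mono nn_integral_mono ennreal_leI)
      (auto simp: b_def \<phi>t_def norm_vec2_power2 grad_nth)
  finally show ?thesis .
qed

text \<open>The energies of the approximants tend to 0, so by Hardy's inequality the approximants
  themselves tend to 0 in mean square on each rectangle. There they also tend to V, and countably
  many rectangles exhaust the half-plane.\<close>

lemma Hdot10_gradient_zero:
  assumes V: "Hdot10 V G" and G: "AE p in lebH. G p = 0"
  shows "AE p in lebH. V p = 0"
proof -
  obtain \<phi> where 1: "\<And>n. test_function halfplane (\<phi> n)"
    "(\<lambda>n. \<integral>\<^sup>+p. ennreal ((norm (grad (\<phi> n) p - G p))\<^sup>2) \<partial>lebH) \<longlonglongrightarrow> 0"
    "\<And>K. compact K \<Longrightarrow> K \<subseteq> halfplane \<Longrightarrow>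
      (\<lambda>n. \<integral>\<^sup>+p. ennreal ((norm (\<phi> n p - V p))\<^sup>2) \<partial>(lebesgue_on K)) \<longlonglongrightarrow> 0"
    by (rule Hdot10D[OF V]; rule that; assumption)
  have "(\<integral>\<^sup>+p. ennreal ((norm (grad (\<phi> n) p - G p))\<^sup>2) \<partial>lebH) = (\<integral>\<^sup>+p. ennreal ((norm (grad (\<phi> n) p))\<^sup>2) \<partial>lebH)" for n
    using G by (intro nn_integral_cong_AE) (auto elim: eventually_mono)
  then have g0: "(\<lambda>n. \<integral>\<^sup>+p. ennreal ((norm (grad (\<phi> n) p))\<^sup>2) \<partial>lebH) \<longlonglongrightarrow> 0" using 1(2) by simp
  have "AE p in lebH. p \<in> rect (real (Suc m)) \<longrightarrow> V p = 0" for m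
  proof -
    define R where "R = real (Suc m)"
    have R: "1 \<le> R" "0 < R" by (auto simp: R_def)
    note K = compact_rect[of R] rect_subset_halfplane[OF R(2)]
    have Rm: "rect R \<in> sets lebesgue" using lmeasurable_compact[OF K(1)] by (simp add: fmeasurable_def)
    note m = lebesgue_on_mono_measurable[OF _ K(2) halfplane_measurable(1)]
    have mm: "\<phi> n \<in> borel_measurable lebH" for n
      using smooth_on_imp_continuous_on[OF test_function_smooth_on[OF 1(1)]] by (rule continuous_measurable_lebH)
    have [measurable]: "V \<in> borel_measurable (lebesgue_on (rect R))" "\<phi> n \<in> borel_measurable (lebesgue_on (rect R))" for n
      using m mm Hdot10_measurable(1)[OF V] by blast+
    have "(\<lambda>n. \<integral>\<^sup>+p. ennreal ((norm (\<phi> n p))\<^sup>2) \<partial>(lebesgue_on (rect R))) \<longlonglongrightarrow> 0"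
    proof (rule ennreal_squeeze_0)
      have "(\<lambda>n. ennreal (4 * R\<^sup>2) * (\<integral>\<^sup>+p. ennreal ((norm (grad (\<phi> n) p))\<^sup>2) \<partial>lebH)) \<longlonglongrightarrow> ennreal (4 * R\<^sup>2) * 0"
        by (intro ennreal_tendsto_cmult g0) simp
      then show "(\<lambda>n. ennreal (4 * R\<^sup>2) * (\<integral>\<^sup>+p. ennreal ((norm (grad (\<phi> n) p))\<^sup>2) \<partial>lebH)) \<longlonglongrightarrow> 0" by simp
    qed (intro always_eventually allI Hardy_inequality 1(1) R)
    from tendsto_ennreal_lincomb_0[OF this 1(3)[OF K], of 2]
    have "(\<lambda>n. 2 * (\<integral>\<^sup>+p. ennreal ((norm (\<phi> n p))\<^sup>2) \<partial>(lebesgue_on (rect R)))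
        + ennreal 2 * (\<integral>\<^sup>+p. ennreal ((norm (\<phi> n p - V p))\<^sup>2) \<partial>(lebesgue_on (rect R)))) \<longlonglongrightarrow> 0" .
    moreover have "(\<integral>\<^sup>+p. ennreal ((norm (V p))\<^sup>2) \<partial>(lebesgue_on (rect R)))
        \<le> 2 * (\<integral>\<^sup>+p. ennreal ((norm (\<phi> n p))\<^sup>2) \<partial>(lebesgue_on (rect R)))
        + ennreal (2 * 1\<^sup>2) * (\<integral>\<^sup>+p. ennreal ((norm (\<phi> n p - V p))\<^sup>2) \<partial>(lebesgue_on (rect R)))" for n
      by (rule nn_norm_lincomb_le) (auto simp: norm_minus_commute norm_triangle_sub)
    ultimately have "(\<integral>\<^sup>+p. ennreal ((norm (V p))\<^sup>2) \<partial>(lebesgue_on (rect R))) \<le> 0"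
      by (intro LIMSEQ_le_const) auto
    then have "(\<integral>\<^sup>+p. ennreal ((norm (V p))\<^sup>2) \<partial>(lebesgue_on (rect R))) = 0" by simp
    then have "AE p in lebesgue_on (rect R). V p = 0"
      by (subst (asm) nn_integral_0_iff_AE) auto
    then have "AE p in lebesgue. p \<in> rect R \<longrightarrow> V p = 0"
      using Rm by (subst (asm) AE_restrict_space_iff) auto
    then show ?thesis
      using halfplane_measurable by (subst AE_restrict_space_iff) (auto simp: R_def elim: eventually_mono)
  qed
  then have "AE p in lebH. \<forall>m. p \<in> rect (real (Suc m)) \<longrightarrow> V p = 0"
    unfolding AE_all_countable by blast
  moreover have "AE p in lebH. p \<in> halfplane" by (rule AE_I2) simp
  ultimately show ?thesis
  proof eventually_elim
    case (elim p)
    obtain R where R: "1 \<le> R" "{p} \<subseteq> rect R" using compact_subset_rect[of "{p}"] elim(2) by auto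
    obtain m :: nat where "R \<le> real m" using real_arch_simple by blast
    then have "rect R \<subseteq> rect (real (Suc m))" using R(1) by (intro rect_mono) auto
    then show ?case using elim(1) R(2) by blast
  qed
qed

section \<open>The explicit solution\<close>

lemma even_part_holomorphic:
  assumes "-1 < \<alpha>" "\<alpha> < 1" "datum u"
  shows "even_part \<alpha> u holomorphic_on upper_halfplane"
  unfolding even_part_def
  by (intro holomorphic_on_mult powr_holomorphic_upper cauchy_int_square_holomorphic
      datum_measurable weight_times_datum_integrable assms)

lemma odd_part_holomorphic:
  assumes "datum u"
  shows "odd_part u holomorphic_on upper_halfplane"
  unfolding odd_part_def
  by (intro cauchy_int_square_holomorphic datum_measurable mult_datum_integrable assms)

lemma holomorphic_partials:
  assumes f: "f holomorphic_on upper_halfplane" and t: "0 < t"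
  shows "((\<lambda>t. Re (f (Complex x t))) has_real_derivative - Im (deriv f (Complex x t))) (at t)"
    "((\<lambda>t. Im (f (Complex x t))) has_real_derivative Re (deriv f (Complex x t))) (at t)"
    "((\<lambda>x. Re (f (Complex x t))) has_real_derivative Re (deriv f (Complex x t))) (at x)"
    "((\<lambda>x. Im (f (Complex x t))) has_real_derivative Im (deriv f (Complex x t))) (at x)"
proof -
  have D: "(f has_field_derivative deriv f (Complex x t)) (at (Complex x t))"
    by (rule holomorphic_derivI[OF f open_upper_halfplane]) (simp add: t)
  have 1: "((\<lambda>t. Complex x t) has_vector_derivative \<i>) (at t)"
    unfolding has_vector_derivative_def Complex_eq
    by (auto intro!: derivative_eq_intros simp: scaleR_conv_of_real)
  have 2: "((\<lambda>x. Complex x t) has_vector_derivative 1) (at x)"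
    unfolding has_vector_derivative_def Complex_eq
    by (auto intro!: derivative_eq_intros simp: scaleR_conv_of_real)
  have 3: "((\<lambda>t. f (Complex x t)) has_vector_derivative \<i> * deriv f (Complex x t)) (at t)"
    using field_vector_diff_chain_at[OF 1 D] by (simp add: o_def)
  have 4: "((\<lambda>x. f (Complex x t)) has_vector_derivative deriv f (Complex x t)) (at x)"
    using field_vector_diff_chain_at[OF 2 D] by (simp add: o_def)
  show "((\<lambda>t. Re (f (Complex x t))) has_real_derivative - Im (deriv f (Complex x t))) (at t)"
    "((\<lambda>t. Im (f (Complex x t))) has_real_derivative Re (deriv f (Complex x t))) (at t)"
    using bounded_linear.has_vector_derivative[OF bounded_linear_Re 3]
      bounded_linear.has_vector_derivative[OF bounded_linear_Im 3]
    by (simp_all add: has_real_derivative_iff_has_vector_derivative)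
  show "((\<lambda>x. Re (f (Complex x t))) has_real_derivative Re (deriv f (Complex x t))) (at x)"
    "((\<lambda>x. Im (f (Complex x t))) has_real_derivative Im (deriv f (Complex x t))) (at x)"
    using bounded_linear.has_vector_derivative[OF bounded_linear_Re 4]
      bounded_linear.has_vector_derivative[OF bounded_linear_Im 4]
    by (simp_all add: has_real_derivative_iff_has_vector_derivative)
qed

lemma DERIV_compose_abs:
  fixes g :: "real \<Rightarrow> real"
  assumes "(g has_real_derivative d) (at \<bar>x\<bar>)" "x \<noteq> 0"
  shows "((\<lambda>x. g \<bar>x\<bar>) has_real_derivative sgn x * d) (at x)"
proof -
  have "((\<lambda>x::real. \<bar>x\<bar>) has_real_derivative sgn x) (at x)"
  proof (cases "0 < x")
    case True
    show ?thesis
      by (rule has_field_derivative_transform_within_open[where S = "{0<..}" and f = "\<lambda>x. x"])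
        (use True in auto)
  next
    case False
    show ?thesis
      by (rule has_field_derivative_transform_within_open[where S = "{..<0}" and f = "\<lambda>x. - x"])
        (use False assms(2) in \<open>auto intro!: derivative_eq_intros\<close>)
  qed
  from DERIV_chain2[OF assms(1) this] show ?thesis by (simp add: mult.commute)
qed

lemma deriv_holomorphic_upper: "f holomorphic_on upper_halfplane \<Longrightarrow> deriv f holomorphic_on upper_halfplane"
  by (rule holomorphic_deriv[OF _ open_upper_halfplane])

lemma continuous_holomorphic_Complex:
  assumes "f holomorphic_on upper_halfplane" "continuous_on S a" "continuous_on S b" "\<And>p. p \<in> S \<Longrightarrow> 0 < b p"
  shows "continuous_on S (\<lambda>p. f (Complex (a p) (b p)))"
proof (rule continuous_on_compose2[OF holomorphic_on_imp_continuous_on[OF assms(1)]])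
  show "continuous_on S (\<lambda>p. Complex (a p) (b p))"
    unfolding Complex_eq by (intro continuous_intros assms)
qed (use assms(4) in auto)

lemma loc_bdd_holomorphic:
  assumes "f holomorphic_on upper_halfplane" "continuous_on UNIV q"
  shows "loc_bdd (\<lambda>p. Re (f (Complex (q (snd p)) (fst p))))" "loc_bdd (\<lambda>p. Im (f (Complex (q (snd p)) (fst p))))"
proof -
  have "continuous_on halfplane (\<lambda>p. f (Complex (q (snd p)) (fst p)))"
    by (rule continuous_holomorphic_Complex[OF assms(1)])
      (auto intro!: continuous_intros continuous_on_compose2[OF assms(2)])
  then show "loc_bdd (\<lambda>p. Re (f (Complex (q (snd p)) (fst p))))" "loc_bdd (\<lambda>p. Im (f (Complex (q (snd p)) (fst p))))"
    by (auto intro!: loc_bdd_continuous continuous_intros)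
qed

text \<open>Differentiated along the axis, this says that the conormal derivative of the even part vanishes there.\<close>

lemma even_part_axis:
  assumes "-1 < \<alpha>" "\<alpha> < 1" "k = tan (pi * \<alpha> / 2)" "0 < t"
  shows "Re (even_part \<alpha> u (Complex 0 t)) + k * Im (even_part \<alpha> u (Complex 0 t)) = 0"
proof -
  have z: "Complex 0 t = complex_of_real t * \<i>" by (simp add: complex_eq_iff)
  have "(Complex 0 t)\<^sup>2 = cnj ((Complex 0 t)\<^sup>2)" by (simp add: complex_eq_iff power2_eq_square)
  then have "cauchy_int w ((Complex 0 t)\<^sup>2) = cnj (cauchy_int w ((Complex 0 t)\<^sup>2))" for w
    by (metis cauchy_int_cnj)
  from arg_cong[OF this, of Im] have im: "Im (cauchy_int w ((Complex 0 t)\<^sup>2)) = 0" for w by simp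
  have "cos (pi * \<alpha> / 2) \<noteq> 0"
    using mult_strict_left_mono[OF assms(1) pi_gt_zero] mult_strict_left_mono[OF assms(2) pi_gt_zero]
    by (intro less_imp_neq[symmetric] cos_gt_zero_pi) auto
  then have k: "k * cos (pi * \<alpha> / 2) = sin (pi * \<alpha> / 2)" by (simp add: assms(3) tan_def)
  have "(Complex 0 t) powr complex_of_real (\<alpha> + 1)
      = complex_of_real (t powr (\<alpha> + 1)) * Complex (- sin (pi * \<alpha> / 2)) (cos (pi * \<alpha> / 2))"
    unfolding z i_powr[symmetric]
    using assms(4) by (subst powr_times_real_left) (simp_all add: powr_of_real del: of_real_add)
  then obtain r where r: "even_part \<alpha> u (Complex 0 t) = complex_of_real r * Complex (- sin (pi * \<alpha> / 2)) (cos (pi * \<alpha> / 2))"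
    using im[of "\<lambda>y. \<bar>y\<bar> powr (- \<alpha>) * u y"] that[of "t powr (\<alpha> + 1) * Re (cauchy_int (\<lambda>y. \<bar>y\<bar> powr (- \<alpha>) * u y) ((Complex 0 t)\<^sup>2))"]
    by (simp add: even_part_def complex_eq_iff)
  have "- (r * sin (pi * \<alpha> / 2)) + k * (r * cos (pi * \<alpha> / 2)) = r * (k * cos (pi * \<alpha> / 2) - sin (pi * \<alpha> / 2))"
    by (simp add: algebra_simps)
  then show ?thesis using k by (simp add: r)
qed

text \<open>For holomorphic f the imaginary part has t-derivative Re f' and x-derivative Im f'; this
  gives \<open>sol_t\<close> and \<open>sol_x\<close>, where in the latter the sign stems from
  \<open>\<bar>x\<bar>\<close>. At x = 0 the sign is 0, so \<open>sol_x\<close> takes a default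
  value for the kinked term there.\<close>

definition sol_t :: "real \<Rightarrow> (real \<Rightarrow> real) \<Rightarrow> real \<times> real \<Rightarrow> real" where
  "sol_t \<alpha> u p = (Re (deriv (even_part \<alpha> u) (Complex \<bar>snd p\<bar> (fst p))) + Re (deriv (odd_part u) (Complex (snd p) (fst p)))) / pi"

definition sol_x :: "real \<Rightarrow> (real \<Rightarrow> real) \<Rightarrow> real \<times> real \<Rightarrow> real" where
  "sol_x \<alpha> u p = (sgn (snd p) * Im (deriv (even_part \<alpha> u) (Complex \<bar>snd p\<bar> (fst p))) + Im (deriv (odd_part u) (Complex (snd p) (fst p)))) / pi"

lemma sol_partials:
  assumes "-1 < \<alpha>" "\<alpha> < 1" "datum u" "0 < t" "x \<noteq> 0"
  shows "((\<lambda>t. sol \<alpha> u (t, x)) has_real_derivative sol_t \<alpha> u (t, x)) (at t)"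
    "((\<lambda>x. sol \<alpha> u (t, x)) has_real_derivative sol_x \<alpha> u (t, x)) (at x)"
  unfolding sol_def sol_t_def sol_x_def fst_conv snd_conv
  by (intro DERIV_cdivide DERIV_add DERIV_compose_abs holomorphic_partials
      even_part_holomorphic odd_part_holomorphic assms)+

lemma loc_bdd_divide_pi: "loc_bdd f \<Longrightarrow> loc_bdd (\<lambda>p. f p / pi)"
  using loc_bdd_mult[OF _ loc_bdd_const[of "1 / pi"]] by simp

lemma sol_continuous:
  assumes "-1 < \<alpha>" "\<alpha> < 1" "datum u"
  shows "continuous_on halfplane (sol \<alpha> u)"
  unfolding sol_def
  by (intro continuous_intros continuous_holomorphic_Complex[OF even_part_holomorphic[OF assms]]
      continuous_holomorphic_Complex[OF odd_part_holomorphic[OF assms(3)]]) auto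

lemma sol_loc_bdd:
  assumes "-1 < \<alpha>" "\<alpha> < 1" "datum u"
  shows "loc_bdd (sol \<alpha> u)" "loc_bdd (sol_t \<alpha> u)" "loc_bdd (sol_x \<alpha> u)"
proof -
  note E = deriv_holomorphic_upper[OF even_part_holomorphic[OF assms]]
  note Od = deriv_holomorphic_upper[OF odd_part_holomorphic[OF assms(3)]]
  show "loc_bdd (sol \<alpha> u)" by (rule loc_bdd_continuous[OF sol_continuous[OF assms]])
  show "loc_bdd (sol_t \<alpha> u)" "loc_bdd (sol_x \<alpha> u)"
    unfolding sol_t_def sol_x_def
    by (intro loc_bdd_divide_pi loc_bdd_add loc_bdd_mult loc_bdd_sgn
        loc_bdd_holomorphic[OF E, where q = abs] loc_bdd_holomorphic[OF Od, where q = "\<lambda>x. x"] continuous_intros)+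
qed

text \<open>A factor that vanishes at 0 neutralises the jump of the sign. This is how the conormal
  derivative is seen to be continuous across the axis.\<close>

lemma continuous_sgn_mult:
  fixes q :: "real \<Rightarrow> real"
  assumes "continuous_on UNIV q" "q 0 = 0"
  shows "continuous_on UNIV (\<lambda>x. sgn x * q x)"
proof (rule continuous_at_imp_continuous_on, rule ballI)
  fix x
  have q: "isCont q x" for x using assms(1) by (simp add: continuous_on_eq_continuous_at)
  show "isCont (\<lambda>x. sgn x * q x) x"
  proof (cases "x = 0")
    case True
    have "((\<lambda>x. sgn x * q x) \<longlongrightarrow> 0) (at 0)"
    proof (rule Lim_null_comparison)
      show "\<forall>\<^sub>F x in at 0. norm (sgn x * q x) \<le> \<bar>q x\<bar>"
        by (intro always_eventually) (auto simp: abs_mult sgn_if)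
      show "((\<lambda>x. \<bar>q x\<bar>) \<longlongrightarrow> 0) (at 0)"
        using tendsto_rabs[OF q[of 0, unfolded isCont_def]] assms(2) by simp
    qed
    then show ?thesis using True by (simp add: isCont_def)
  next
    case False
    have "isCont sgn x" unfolding isCont_def by (rule tendsto_sgn[OF tendsto_ident_at False])
    then show ?thesis by (intro isCont_mult q)
  qed
qed

text \<open>B1 and B2 are the components of A applied to the gradient. Off the axis the field is
  divergence free by the Cauchy-Riemann equations. Across the axis only continuity of the normal
  component B2 is required, and this is where the value of k enters.\<close>

lemma sol_weak:
  assumes \<alpha>: "-1 < \<alpha>" "\<alpha> < 1" "k = tan (pi * \<alpha> / 2)" and u: "datum u" and \<phi>: "test_function halfplane \<phi>"
  shows "A_form k (rgrad (sol_t \<alpha> u) (sol_x \<alpha> u)) (grad \<phi>) = 0"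
proof -
  define E Od where "E = even_part \<alpha> u" and "Od = odd_part u"
  have hE: "E holomorphic_on upper_halfplane" "deriv E holomorphic_on upper_halfplane"
    "deriv (deriv E) holomorphic_on upper_halfplane"
    unfolding E_def by (intro deriv_holomorphic_upper even_part_holomorphic \<alpha> u)+
  have hO: "Od holomorphic_on upper_halfplane" "deriv Od holomorphic_on upper_halfplane"
    "deriv (deriv Od) holomorphic_on upper_halfplane"
    unfolding Od_def by (intro deriv_holomorphic_upper odd_part_holomorphic u)+
  define B1 where "B1 p = sol_t \<alpha> u p + k * sgn (snd p) * sol_x \<alpha> u p" for p
  define B2 where "B2 p = sol_x \<alpha> u p - k * sgn (snd p) * sol_t \<alpha> u p" for p
  \<comment> \<open>The product of two signs is left as it is: the t-derivative of B1 is required at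
    x = 0 as well, where this product is 0 and not 1.\<close>
  define m where "m p = ((- Im (deriv (deriv E) (Complex \<bar>snd p\<bar> (fst p))) + k * sgn (snd p) * sgn (snd p) * Re (deriv (deriv E) (Complex \<bar>snd p\<bar> (fst p))))
    + (- Im (deriv (deriv Od) (Complex (snd p) (fst p))) + k * sgn (snd p) * Re (deriv (deriv Od) (Complex (snd p) (fst p))))) / pi" for p
  have lb: "loc_bdd B1" "loc_bdd B2"
    unfolding B1_def B2_def by (intro loc_bdd_add loc_bdd_diff loc_bdd_mult loc_bdd_const loc_bdd_sgn sol_loc_bdd \<alpha> u)+
  have neg: "loc_bdd f \<Longrightarrow> loc_bdd (\<lambda>p. - f p)" for f using loc_bdd_mult[OF loc_bdd_const[of "-1"]] by fastforce
  have lm: "loc_bdd m" unfolding m_def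
    by (intro loc_bdd_divide_pi loc_bdd_add neg loc_bdd_mult loc_bdd_const loc_bdd_sgn
        loc_bdd_holomorphic[OF hE(3), where q = abs] loc_bdd_holomorphic[OF hO(3), where q = "\<lambda>x. x"] continuous_intros)
  have axisE: "Im (deriv E (Complex 0 t)) - k * Re (deriv E (Complex 0 t)) = 0" if t: "0 < t" for t
  proof -
    have "((\<lambda>t. Re (E (Complex 0 t)) + k * Im (E (Complex 0 t))) has_real_derivative
        - Im (deriv E (Complex 0 t)) + k * Re (deriv E (Complex 0 t))) (at t)"
      by (intro DERIV_add DERIV_cmult holomorphic_partials[OF hE(1)] t)
    moreover have "((\<lambda>t. Re (E (Complex 0 t)) + k * Im (E (Complex 0 t))) has_real_derivative 0) (at t)"
      by (rule has_field_derivative_transform_within_open[where S = "{0<..}" and f = "\<lambda>_. 0"])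
        (use t even_part_axis[OF \<alpha>] in \<open>auto simp: E_def\<close>)
    ultimately have "- Im (deriv E (Complex 0 t)) + k * Re (deriv E (Complex 0 t)) = 0" by (rule DERIV_unique)
    then show ?thesis by simp
  qed
  have axisO: "Re (deriv Od (Complex 0 t)) = 0" if t: "0 < t" for t
  proof -
    have "((\<lambda>t. Im (Od (Complex 0 t))) has_real_derivative 0) (at t)"
      by (rule has_field_derivative_transform_within_open[where S = "{0<..}" and f = "\<lambda>_. 0"])
        (use t Im_odd_part_sgn[of u 0] in \<open>auto simp: Od_def\<close>)
    with holomorphic_partials(2)[OF hO(1) t, of 0] show ?thesis by (rule DERIV_unique)
  qed
  \<comment> \<open>All discontinuities are collected in one multiple of \<open>sgn x\<close>, whose
    other factor vanishes at x = 0 by \<open>axisE\<close> and \<open>axisO\<close>.\<close>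
  have B2_eq: "B2 (t, x) = (sgn x * (Im (deriv E (Complex \<bar>x\<bar> t)) - k * Re (deriv E (Complex \<bar>x\<bar> t)) - k * Re (deriv Od (Complex x t)))
      + Im (deriv Od (Complex x t))) / pi" for t x
    by (simp add: B2_def sol_t_def sol_x_def E_def Od_def field_simps)
  have cont: "continuous_on UNIV (\<lambda>x. B2 (t, x))" if t: "0 < t" for t
    unfolding B2_eq
    by (intro continuous_intros continuous_sgn_mult continuous_holomorphic_Complex[OF hE(2)]
        continuous_holomorphic_Complex[OF hO(2)]) (use t axisE[OF t] axisO[OF t] in auto)
  have B1_eq: "B1 (t, x) = ((Re (deriv E (Complex \<bar>x\<bar> t)) + k * sgn x * sgn x * Im (deriv E (Complex \<bar>x\<bar> t)))
      + (Re (deriv Od (Complex x t)) + k * sgn x * Im (deriv Od (Complex x t)))) / pi" for t x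
    by (simp add: B1_def sol_t_def sol_x_def E_def Od_def field_simps)
  have d1: "((\<lambda>t. B1 (t, x)) has_real_derivative m (t, x)) (at t)" if t: "0 < t" for t x
    unfolding B1_eq m_def fst_conv snd_conv
    by (intro DERIV_cdivide DERIV_add DERIV_cmult holomorphic_partials hE hO t)
  have d2: "((\<lambda>x. B2 (t, x)) has_real_derivative - m (t, x)) (at x)" if t: "0 < t" and x: "x \<noteq> 0" for t x
  proof -
    define s where "s = sgn x"
    have s: "s * s = 1" using x by (simp add: s_def sgn_if)
    have "((\<lambda>y. (s * (Im (deriv E (Complex \<bar>y\<bar> t)) - k * Re (deriv E (Complex \<bar>y\<bar> t)) - k * Re (deriv Od (Complex y t)))
        + Im (deriv Od (Complex y t))) / pi) has_real_derivative
        (s * (sgn x * Im (deriv (deriv E) (Complex \<bar>x\<bar> t)) - k * (sgn x * Re (deriv (deriv E) (Complex \<bar>x\<bar> t)))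
          - k * Re (deriv (deriv Od) (Complex x t))) + Im (deriv (deriv Od) (Complex x t))) / pi) (at x)"
      by (intro DERIV_cdivide DERIV_add DERIV_diff DERIV_cmult DERIV_compose_abs[OF _ x] holomorphic_partials hE hO t)
    moreover have "(s * (sgn x * Im (deriv (deriv E) (Complex \<bar>x\<bar> t)) - k * (sgn x * Re (deriv (deriv E) (Complex \<bar>x\<bar> t)))
          - k * Re (deriv (deriv Od) (Complex x t))) + Im (deriv (deriv Od) (Complex x t))) / pi = - m (t, x)"
    proof -
      have a: "s * (s * a - k * (s * b) - k * c) = (s * s) * a - k * (s * s) * b - k * s * c" for a b c
        by (simp add: algebra_simps)
      have b: "k * s * s * c = k * (s * s) * c" for c by (simp add: mult.assoc)
      show ?thesis
        unfolding m_def fst_conv snd_conv s_def[symmetric] a b s by (simp add: field_simps)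
    qed
    ultimately have "((\<lambda>y. (s * (Im (deriv E (Complex \<bar>y\<bar> t)) - k * Re (deriv E (Complex \<bar>y\<bar> t)) - k * Re (deriv Od (Complex y t)))
        + Im (deriv Od (Complex y t))) / pi) has_real_derivative - m (t, x)) (at x)" by simp
    then show ?thesis
    proof (rule has_field_derivative_transform_within_open)
      show "open {y. 0 < y * x}" by (intro open_Collect_less continuous_intros)
      show "x \<in> {y. 0 < y * x}" using x by (auto simp: zero_less_mult_iff linorder_neq_iff)
      fix y assume "y \<in> {y. 0 < y * x}"
      then have "sgn y = s" by (auto simp: s_def zero_less_mult_iff)
      then show "(s * (Im (deriv E (Complex \<bar>y\<bar> t)) - k * Re (deriv E (Complex \<bar>y\<bar> t)) - k * Re (deriv Od (Complex y t)))
        + Im (deriv Od (Complex y t))) / pi = B2 (t, y)" by (simp only: B2_eq)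
    qed
  qed
  obtain K where s: "smooth_on UNIV \<phi>" and K: "compact K" "K \<subseteq> halfplane" "\<And>p. p \<notin> K \<Longrightarrow> \<phi> p = 0"
    by (rule test_functionE[OF \<phi>]) blast
  \<comment> \<open>The form conjugates its second argument, so the divergence identity is tested
    with the conjugate of \<phi>.\<close>
  have sc: "smooth_on UNIV (\<lambda>p. cnj (\<phi> p))"
    by (rule smooth_on_bounded_linear[OF bounded_linear_cnj open_UNIV s])
  have \<psi>: "test_function halfplane (\<lambda>p. cnj (\<phi> p))"
    by (rule test_functionI[OF smooth_on_subset[OF sc] open_halfplane K(1,2)]) (use K(3) in auto)
  have fd: "frechet_derivative (\<lambda>p. cnj (\<phi> p)) (at p) = (\<lambda>h. cnj (frechet_derivative \<phi> (at p) h))" for p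
    by (rule frechet_derivative_at[symmetric], rule bounded_linear.has_derivative[OF bounded_linear_cnj])
      (rule test_function_has_derivative[OF \<phi>])
  have "(\<integral>p. B1 p *\<^sub>R frechet_derivative (\<lambda>p. cnj (\<phi> p)) (at p) (1, 0)
      + B2 p *\<^sub>R frechet_derivative (\<lambda>p. cnj (\<phi> p)) (at p) (0, 1) \<partial>lebH) = 0"
    by (rule divergence_free_weak[OF lb lm cont d1 d2 \<psi>])
  moreover have "A_form k (rgrad (sol_t \<alpha> u) (sol_x \<alpha> u)) (grad \<phi>) = (\<integral>p. B1 p *\<^sub>R frechet_derivative (\<lambda>p. cnj (\<phi> p)) (at p) (1, 0)
      + B2 p *\<^sub>R frechet_derivative (\<lambda>p. cnj (\<phi> p)) (at p) (0, 1) \<partial>lebH)"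
    unfolding A_form_def hermitian_A_coeff fd grad_nth rgrad_nth B1_def B2_def
    by (intro Bochner_Integration.integral_cong refl) (simp add: scaleR_conv_of_real)
  ultimately show ?thesis by simp
qed

section \<open>Extension of the datum and admissibility of the difference\<close>

lemma smooth_on_compose_real:
  fixes u :: "real \<Rightarrow> real"
  assumes "smooth_on UNIV u" "smooth_on S f" "open S"
  shows "smooth_on S (\<lambda>p. u (f p))"
proof -
  define F where "F m = ((\<lambda>f x. frechet_derivative f (at x) 1) ^^ m) u" for m :: nat
  have F: "smooth_on UNIV (F m)" for m
  proof (induction m)
    case 0
    then show ?case using assms(1) by (simp add: F_def)
  next
    case (Suc m)
    have "F (Suc m) = (\<lambda>x. frechet_derivative (F m) (at x) 1)" by (simp add: F_def)
    then show ?case using smooth_on_frechet_derivative[OF Suc, of 1] by simp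
  qed
  have "smooth_on S (\<lambda>p. F 0 (f p))"
  proof (rule smooth_on_comp[OF assms(2,3), where T = UNIV])
    fix m x
    have D: "(F m has_derivative frechet_derivative (F m) (at x)) (at x)"
      by (rule smooth_on_has_derivative[OF F]) simp
    have "frechet_derivative (F m) (at x) = (\<lambda>h. F (Suc m) x * h)"
    proof
      show "frechet_derivative (F m) (at x) h = F (Suc m) x * h" for h
        using linear_scale[OF has_derivative_linear[OF D], of h 1] by (simp add: F_def)
    qed
    then show "(F m has_field_derivative F (Suc m) x) (at x)"
      using D by (simp add: has_field_derivative_def)
  qed simp
  then show ?thesis by (simp add: F_def)
qed

lemma test_function_extension:
  fixes u :: "real \<Rightarrow> real"
  assumes "test_function UNIV u"
  obtains U1 :: "real \<times> real \<Rightarrow> real" where "test_function UNIV U1" "\<And>x. U1 (0, x) = u x"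
proof -
  obtain K where u: "smooth_on UNIV u" "compact K" "\<And>x. x \<notin> K \<Longrightarrow> u x = 0"
    by (rule test_functionE[OF assms]) blast
  \<comment> \<open>The first two factors form a bump in t with support in [-1, 1], normalised to
    the value 1 at t = 0.\<close>
  define U1 where "U1 p = flat 0 (1 - fst p * fst p) * inverse (flat 0 1) * u (snd p)" for p :: "real \<times> real"
  have "smooth_on UNIV U1" unfolding U1_def
    by (intro smooth_on_mult smooth_on_flat smooth_on_diff smooth_on_const smooth_on_fst smooth_on_snd
        smooth_on_compose_real[OF u(1)] open_UNIV)
  moreover have "U1 p = 0" if "p \<notin> {- 1..1} \<times> K" for p
  proof (cases "snd p \<in> K")
    case True
    then have "1 \<le> \<bar>fst p\<bar>" using that by (auto simp: mem_Times_iff)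
    then have "1 * 1 \<le> \<bar>fst p\<bar> * \<bar>fst p\<bar>" by (intro mult_mono) auto
    then have "1 - fst p * fst p \<le> 0" by (simp flip: abs_mult)
    then show ?thesis by (simp add: U1_def flat_0)
  qed (simp add: U1_def u(3))
  ultimately have "test_function UNIV U1"
    using u(2) by (intro test_functionI[where K = "{- 1..1} \<times> K"]) (auto intro: compact_Times)
  moreover have "U1 (0, x) = u x" for x by (simp add: U1_def flat_0)
  ultimately show ?thesis by (rule that)
qed

lemma test_function_datum:
  fixes u :: "real \<Rightarrow> real"
  assumes "test_function UNIV u"
  shows "datum u"
proof -
  obtain K where u: "smooth_on UNIV u" "compact K" "\<And>x. x \<notin> K \<Longrightarrow> u x = 0"
    by (rule test_functionE[OF assms]) blast
  obtain R where R: "\<And>x. x \<in> K \<Longrightarrow> \<bar>x\<bar> \<le> R" using compact_imp_bounded[OF u(2)] by (auto simp: bounded_iff)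
  define d where "d x = frechet_derivative u (at x) 1" for x
  have D: "(u has_derivative (\<lambda>h. h * d x)) (at x)" for x
  proof -
    have D: "(u has_derivative frechet_derivative u (at x)) (at x)"
      by (rule smooth_on_has_derivative[OF u(1)]) simp
    have "frechet_derivative u (at x) = (\<lambda>h. h * d x)"
    proof
      show "frechet_derivative u (at x) h = h * d x" for h
        using linear_scale[OF has_derivative_linear[OF D], of h 1] by (simp add: d_def)
    qed
    then show ?thesis using D by simp
  qed
  have "smooth_on UNIV d" unfolding d_def by (rule smooth_on_frechet_derivative[OF u(1)]) simp
  then have cd: "continuous_on UNIV d" by (rule smooth_on_imp_continuous_on)
  have d0: "d x = 0" if "R < \<bar>x\<bar>" for x
  proof -
    have "((\<lambda>_. 0) has_derivative (\<lambda>h. 0)) (at x)" by simp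
    then have "(u has_derivative (\<lambda>h. 0)) (at x)"
    proof (rule has_derivative_transform_within_open)
      show "open {x::real. R < \<bar>x\<bar>}" by (intro open_Collect_less continuous_intros)
      show "x \<in> {x. R < \<bar>x\<bar>}" using that by simp
      show "0 = u y" if "y \<in> {x. R < \<bar>x\<bar>}" for y using R[of y] u(3)[of y] that by force
    qed
    then have "(\<lambda>h. h * d x) = (\<lambda>h. 0)" by (rule has_derivative_unique[OF D])
    from fun_cong[OF this, of 1] show ?thesis by simp
  qed
  obtain B where B: "\<And>x. \<bar>d x\<bar> \<le> B" using compact_support_bounded[OF cd d0] by blast
  have "\<bar>u y - u (- y)\<bar> \<le> (2 * B) * \<bar>y\<bar>" for y
  proof -
    have "norm (u y - u (- y)) \<le> B * norm (y - (- y))"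
    proof (rule differentiable_bound[of UNIV])
      show "(u has_derivative (\<lambda>h. h * d x)) (at x within UNIV)" for x using D by simp
      show "onorm (\<lambda>h. h * d x) \<le> B" for x
      proof (rule onorm_le)
        fix h
        show "norm (h * d x) \<le> B * norm h"
          using mult_right_mono[OF B[of x] abs_ge_zero[of h]] by (simp add: abs_mult mult.commute)
      qed
    qed auto
    then show ?thesis by simp
  qed
  moreover have "\<forall>y. R < \<bar>y\<bar> \<longrightarrow> u y = 0" using R u(3) by force
  ultimately show ?thesis
    unfolding datum_def using smooth_on_imp_continuous_on[OF u(1)] by blast
qed

text \<open>Extension by 0 is continuous on the closed half-plane because of the boundary limits.
  The set where it is at least d in modulus is therefore closed; it lies in a ball by the decay at
  infinity and misses the boundary line, so it is compact in the open half-plane.\<close>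

lemma vanishing_outside_rect:
  fixes w :: "real \<times> real \<Rightarrow> real"
  assumes cont: "continuous_on halfplane w" and bd: "\<And>x. (w \<longlongrightarrow> 0) (at (0, x) within halfplane)"
    and inf: "\<And>p. p \<in> halfplane \<Longrightarrow> M \<le> norm p \<Longrightarrow> \<bar>w p\<bar> < d" and d: "0 < d"
  shows "\<exists>R\<ge>1. \<forall>p\<in>halfplane. d \<le> \<bar>w p\<bar> \<longrightarrow> p \<in> rect R"
proof -
  define C where "C = {p :: real \<times> real. 0 \<le> fst p}"
  define W where "W p = (if 0 < fst p then w p else 0)" for p
  have C: "C = halfplane \<union> {p. fst p = 0}" by (auto simp: C_def)
  have "(W \<longlongrightarrow> W p) (at p within C)" if "p \<in> C" for p
  proof (cases "0 < fst p")
    case True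
    have "isCont w p"
      using cont open_halfplane True by (simp add: continuous_on_eq_continuous_at)
    then have "(w \<longlongrightarrow> w p) (at p)" by (simp add: isCont_def)
    moreover have "\<forall>\<^sub>F q in at p. w q = W q"
    proof -
      have "\<forall>\<^sub>F q in at p. q \<in> halfplane"
        using open_halfplane True by (intro eventually_at_in_open') auto
      then show ?thesis by eventually_elim (simp add: W_def)
    qed
    ultimately have "(W \<longlongrightarrow> w p) (at p)" by (rule Lim_transform_eventually)
    then show ?thesis using True by (simp add: W_def tendsto_within_subset[OF _ subset_UNIV])
  next
    case False
    then have p: "p = (0, snd p)" using that by (auto simp: C_def prod_eq_iff)
    have "\<forall>\<^sub>F q in at p within halfplane. w q = W q" by (auto simp: eventually_at_filter W_def)
    with bd[of "snd p"] p have 1: "(W \<longlongrightarrow> 0) (at p within halfplane)"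
      using Lim_transform_eventually by metis
    have "\<forall>\<^sub>F q in at p within {p. fst p = 0}. 0 = W q" by (auto simp: eventually_at_filter W_def)
    then have 2: "(W \<longlongrightarrow> 0) (at p within {p. fst p = 0})" by (rule Lim_transform_eventually[OF tendsto_const])
    show ?thesis unfolding C using Lim_Un[OF 1 2] False by (simp add: W_def)
  qed
  then have cW: "continuous_on C W" by (simp add: continuous_on_def)
  have clC: "closed C" unfolding C_def by (intro closed_Collect_le continuous_intros)
  define L where "L = C \<inter> cball 0 M"
  have L: "compact L" unfolding L_def using clC by (simp add: closed_Int_compact)
  have "compact {p \<in> L. d \<le> \<bar>W p\<bar>}"
  proof -
    have "continuous_on L (\<lambda>p. \<bar>W p\<bar>)" by (intro continuous_intros continuous_on_subset[OF cW]) (auto simp: L_def)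
    then have "closed {p \<in> L. d \<le> \<bar>W p\<bar>}"
      by (rule continuous_on_closed_Collect_le[OF continuous_on_const _ compact_imp_closed[OF L]])
    then show ?thesis using L by (metis (no_types, lifting) compact_Int_closed inf.absorb2 mem_Collect_eq subsetI)
  qed
  moreover have "{p \<in> L. d \<le> \<bar>W p\<bar>} \<subseteq> halfplane" using d by (auto simp: W_def)
  ultimately obtain R where R: "1 \<le> R" "{p \<in> L. d \<le> \<bar>W p\<bar>} \<subseteq> rect R" by (rule compact_subset_rect)
  have "p \<in> rect R" if "p \<in> halfplane" "d \<le> \<bar>w p\<bar>" for p
  proof -
    have "norm p < M" using inf[OF that(1)] that(2) by (meson not_le)
    then show ?thesis using that R(2) by (auto simp: L_def C_def W_def)
  qed
  with R(1) show ?thesis by blast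
qed

lemma test_function_UNIV_bounded_support:
  fixes f :: "real \<times> real \<Rightarrow> 'b::real_normed_vector"
  assumes "test_function UNIV f"
  obtains M where "\<And>p. M \<le> norm p \<Longrightarrow> f p = 0"
proof -
  obtain K where K: "compact K" "\<And>p. p \<notin> K \<Longrightarrow> f p = 0" by (rule test_functionE[OF assms]) blast
  obtain B where B: "\<And>p. p \<in> K \<Longrightarrow> norm p \<le> B" using compact_imp_bounded[OF K(1)] by (auto simp: bounded_iff)
  show ?thesis by (rule that[of "B + 1"]) (use K(2) B in force)
qed

abbreviation pd_t :: "(real \<times> real \<Rightarrow> real) \<Rightarrow> real \<times> real \<Rightarrow> real" where
  "pd_t f p \<equiv> frechet_derivative f (at p) (1, 0)"

abbreviation pd_x :: "(real \<times> real \<Rightarrow> real) \<Rightarrow> real \<times> real \<Rightarrow> real" where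
  "pd_x f p \<equiv> frechet_derivative f (at p) (0, 1)"

lemma test_function_loc_bdd:
  assumes "test_function UNIV f"
  shows "loc_bdd f" "loc_bdd (pd_t f)" "loc_bdd (pd_x f)"
proof -
  have s: "smooth_on UNIV f" by (rule test_function_smooth_on[OF assms])
  show "loc_bdd f" "loc_bdd (pd_t f)" "loc_bdd (pd_x f)"
    using smooth_on_imp_continuous_on[OF s] smooth_on_imp_continuous_on[OF smooth_on_frechet_derivative[OF s]]
    by (auto intro!: loc_bdd_continuous continuous_on_subset[of UNIV _ halfplane] simp: Basis_prod_def)
qed

text \<open>Uniqueness has to compare different extensions of the same datum. Their difference has
  zero trace and must be placed in the completion; being smooth, it serves as its own approximating
  sequence.\<close>

lemma zero_trace_admissible:
  assumes f: "test_function UNIV f" and z: "\<And>x. f (0, x) = 0"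
  shows "admissible f (pd_t f) (pd_x f)"
proof -
  have s: "smooth_on UNIV f" by (rule test_function_smooth_on[OF f])
  have c: "continuous_on UNIV f" by (rule smooth_on_imp_continuous_on[OF s])
  obtain M where M: "\<And>p. M \<le> norm p \<Longrightarrow> f p = 0" by (rule test_function_UNIV_bounded_support[OF f]) blast
  note lb = test_function_loc_bdd[OF f]
  show ?thesis
    unfolding admissible_def
  proof (intro conjI allI impI exI[of _ "\<lambda>n. f"] ballI)
    fix t x :: real
    show "((\<lambda>t. f (t, x)) has_real_derivative pd_t f (t, x)) (at t)"
      "((\<lambda>x. f (t, x)) has_real_derivative pd_x f (t, x)) (at x)"
      using test_function_partials[OF f] by (auto simp: has_real_derivative_iff_has_vector_derivative)
  next
    fix d :: real assume d: "0 < d"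
    show "\<exists>R\<ge>1. \<forall>p\<in>halfplane. d \<le> \<bar>f p\<bar> \<longrightarrow> p \<in> rect R"
    proof (rule vanishing_outside_rect[OF _ _ _ d])
      show "continuous_on halfplane f" by (rule continuous_on_subset[OF c]) simp
      show "(f \<longlongrightarrow> 0) (at (0, x) within halfplane)" for x
        using c z[of x] by (metis UNIV_I continuous_on_def tendsto_within_subset subset_UNIV)
      show "\<bar>f p\<bar> < d" if "M \<le> norm p" for p using M[OF that] d by simp
    qed
  next
    fix R :: real assume "1 \<le> R"
    obtain A where A: "\<And>p. p \<in> rect R \<Longrightarrow> \<bar>f p\<bar> \<le> A" by (rule loc_bddE[OF lb(1) \<open>1 \<le> R\<close>]) blast
    obtain B where B: "\<And>p. p \<in> rect R \<Longrightarrow> \<bar>pd_t f p\<bar> \<le> B" by (rule loc_bddE[OF lb(2) \<open>1 \<le> R\<close>]) blast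
    obtain C where C: "\<And>p. p \<in> rect R \<Longrightarrow> \<bar>pd_x f p\<bar> \<le> C" by (rule loc_bddE[OF lb(3) \<open>1 \<le> R\<close>]) blast
    show "\<exists>C. \<forall>n::nat. \<forall>p\<in>rect R. \<bar>f p\<bar> \<le> C \<and> \<bar>pd_t f p\<bar> \<le> C \<and> \<bar>pd_x f p\<bar> \<le> C"
      by (rule exI[of _ "max A (max B C)"]) (use A B C in \<open>auto simp: le_max_iff_disj\<close>)
  qed (use lb smooth_on_subset[OF s] in auto)
qed

text \<open>Smoothing \<open>\<bar>x\<bar>\<close> inside the holomorphic function keeps the shape
  of the partial derivatives: only \<open>sgn\<close> is replaced by \<open>dsabs n\<close>, which
  is bounded and converges to it off the axis.\<close>

lemma sol_approximation:
  assumes hE: "E holomorphic_on upper_halfplane" and hO: "Q holomorphic_on upper_halfplane"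
    and f: "test_function UNIV f"
  defines "ws \<equiv> \<lambda>n p. f p - inverse pi * (Im (E (Complex (sabs n (snd p)) (fst p))) + Im (Q (Complex (snd p) (fst p))))"
  shows "smooth_on halfplane (ws n)"
    and "0 < fst p \<Longrightarrow> pd_t (ws n) p = pd_t f p - inverse pi * (Re (deriv E (Complex (sabs n (snd p)) (fst p))) + Re (deriv Q (Complex (snd p) (fst p))))"
    and "0 < fst p \<Longrightarrow> pd_x (ws n) p = pd_x f p - inverse pi * (dsabs n (snd p) * Im (deriv E (Complex (sabs n (snd p)) (fst p))) + Im (deriv Q (Complex (snd p) (fst p))))"
proof -
  note sf = test_function_smooth_on[OF f]
  define Z where "Z n p = complex_of_real (sabs n (snd p)) + \<i> * complex_of_real (fst p)" for n and p :: "real \<times> real"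
  define Z0 where "Z0 p = complex_of_real (snd p) + \<i> * complex_of_real (fst p)" for p :: "real \<times> real"
  have Zeq: "Complex (sabs n (snd p)) (fst p) = Z n p" "Complex (snd p) (fst p) = Z0 p" for n p
    by (simp_all add: Z_def Z0_def Complex_eq)
  have ofr: "smooth_on halfplane (\<lambda>p. complex_of_real (g p))" if "smooth_on halfplane g" for g
    by (rule smooth_on_bounded_linear[OF bounded_linear_of_real open_halfplane that])
  have sZ: "smooth_on halfplane (Z n)" "smooth_on halfplane Z0" for n
    unfolding Z_def Z0_def
    by (intro smooth_on_add smooth_on_mult smooth_on_const ofr smooth_on_sabs smooth_on_fst smooth_on_snd open_halfplane)+
  have Zup: "Z n p \<in> upper_halfplane" "Z0 p \<in> upper_halfplane" if "p \<in> halfplane" for n p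
    using that by (auto simp: Z_def Z0_def)
  have hol: "smooth_on halfplane (\<lambda>p. Im (F (z p)))" if "F holomorphic_on upper_halfplane" "smooth_on halfplane z"
    "\<And>p. p \<in> halfplane \<Longrightarrow> z p \<in> upper_halfplane" for F z
    by (rule smooth_on_bounded_linear[OF bounded_linear_Im open_halfplane
          smooth_on_holomorphic[OF that(2) open_halfplane that(3) that(1) open_upper_halfplane]])
  show "smooth_on halfplane (ws n)"
    unfolding ws_def Zeq
    by (intro smooth_on_diff smooth_on_mult smooth_on_add smooth_on_const open_halfplane
        smooth_on_subset[OF sf] hol hE hO sZ Zup) auto
  assume p: "0 < fst p"
  then have pH: "p \<in> halfplane" by simp
  have dZ: "(Z n has_derivative (\<lambda>h. complex_of_real (snd h * dsabs n (snd p)) + \<i> * complex_of_real (fst h))) (at p)"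
  proof -
    have "((\<lambda>p::real \<times> real. sabs n (snd p)) has_derivative (\<lambda>h. dsabs n (snd p) * snd h)) (at p)"
      by (rule has_derivative_compose[OF _ sabs_has_field_derivative[unfolded has_field_derivative_def]])
        (auto intro!: derivative_eq_intros)
    then show ?thesis unfolding Z_def
      by (intro has_derivative_add has_derivative_of_real has_derivative_mult_right)
        (auto intro!: derivative_eq_intros simp: mult.commute)
  qed
  have dZ0: "(Z0 has_derivative (\<lambda>h. complex_of_real (snd h) + \<i> * complex_of_real (fst h))) (at p)"
    unfolding Z0_def by (intro has_derivative_add has_derivative_of_real has_derivative_mult_right)
      (auto intro!: derivative_eq_intros)
  have dF: "((\<lambda>p. Im (F (z p))) has_derivative (\<lambda>h. Im (deriv F (z p) * z' h))) (at p)"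
    if "F holomorphic_on upper_halfplane" "(z has_derivative z') (at p)" "z p \<in> upper_halfplane" for F z z'
    using bounded_linear.has_derivative[OF bounded_linear_Im has_derivative_compose[OF that(2)
          holomorphic_derivI[OF that(1) open_upper_halfplane that(3), unfolded has_field_derivative_def]]] .
  have "(ws n has_derivative (\<lambda>h. frechet_derivative f (at p) h - inverse pi *
      (Im (deriv E (Z n p) * (complex_of_real (snd h * dsabs n (snd p)) + \<i> * complex_of_real (fst h)))
       + Im (deriv Q (Z0 p) * (complex_of_real (snd h) + \<i> * complex_of_real (fst h)))))) (at p)"
    unfolding ws_def Zeq
    by (intro has_derivative_diff has_derivative_mult_right has_derivative_add dF hE hO dZ dZ0 Zup pH
        test_function_has_derivative[OF f])
  from frechet_derivative_at[OF this, symmetric]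
  show "pd_t (ws n) p = pd_t f p - inverse pi * (Re (deriv E (Complex (sabs n (snd p)) (fst p))) + Re (deriv Q (Complex (snd p) (fst p))))"
    "pd_x (ws n) p = pd_x f p - inverse pi * (dsabs n (snd p) * Im (deriv E (Complex (sabs n (snd p)) (fst p))) + Im (deriv Q (Complex (snd p) (fst p))))"
    by (simp_all add: Zeq)
qed

lemma holomorphic_bounded_rect:
  assumes "f holomorphic_on upper_halfplane" "1 \<le> R"
  obtains C where "0 \<le> C" "\<And>a b. \<bar>a\<bar> \<le> R \<Longrightarrow> 1 / R \<le> b \<Longrightarrow> b \<le> R \<Longrightarrow> cmod (f (Complex a b)) \<le> C"
proof -
  define S where "S = (\<lambda>p. f (Complex (snd p) (fst p))) ` rect R"
  have "continuous_on (rect R) (\<lambda>p. f (Complex (snd p) (fst p)))"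
    using rect_subset_halfplane[of R] assms(2)
    by (intro continuous_holomorphic_Complex[OF assms(1)] continuous_intros) auto
  then have "bounded S" unfolding S_def by (intro compact_imp_bounded compact_continuous_image compact_rect)
  then obtain C where C: "\<And>z. z \<in> S \<Longrightarrow> cmod z \<le> C" by (auto simp: bounded_iff)
  show ?thesis
  proof (rule that[of "\<bar>C\<bar>"])
    fix a b assume "\<bar>a\<bar> \<le> R" "1 / R \<le> b" "b \<le> R"
    then have "(b, a) \<in> rect R" by (auto simp: rect_def)
    then have "f (Complex a b) \<in> S" unfolding S_def by force
    from C[OF this] show "cmod (f (Complex a b)) \<le> \<bar>C\<bar>" by simp
  qed simp
qed

text \<open>The trace condition cancels the boundary limit of the solution, and the compact support
  of f leaves only its decay at infinity. The partial derivatives are bounded on rectangles only,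
  with no control up to the boundary.\<close>

lemma sol_admissible:
  assumes \<alpha>: "-1 < \<alpha>" "\<alpha> < 1" and u: "datum u" and f: "test_function UNIV f" and tr: "\<And>x. f (0, x) = u x"
  shows "admissible (\<lambda>p. f p - sol \<alpha> u p) (\<lambda>p. pd_t f p - sol_t \<alpha> u p) (\<lambda>p. pd_x f p - sol_x \<alpha> u p)"
proof -
  define E Q where "E = even_part \<alpha> u" and "Q = odd_part u"
  have hE: "E holomorphic_on upper_halfplane" "deriv E holomorphic_on upper_halfplane"
    unfolding E_def by (intro deriv_holomorphic_upper even_part_holomorphic \<alpha> u)+
  have hQ: "Q holomorphic_on upper_halfplane" "deriv Q holomorphic_on upper_halfplane"
    unfolding Q_def by (intro deriv_holomorphic_upper odd_part_holomorphic u)+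
  define ws where "ws n p = f p - inverse pi * (Im (E (Complex (sabs n (snd p)) (fst p))) + Im (Q (Complex (snd p) (fst p))))" for n p
  have ws_eq: "ws n = (\<lambda>p. f p - inverse pi * (Im (E (Complex (sabs n (snd p)) (fst p))) + Im (Q (Complex (snd p) (fst p)))))" for n
    by (rule ext) (simp only: ws_def)
  note ap = sol_approximation[OF hE(1) hQ(1) f, folded ws_eq]
  note lbf = test_function_loc_bdd[OF f]
  have c: "continuous_on UNIV f" by (rule smooth_on_imp_continuous_on[OF test_function_smooth_on[OF f]])
  show ?thesis
    unfolding admissible_def
  proof (intro conjI allI impI exI[of _ ws] ballI)
    show "loc_bdd (\<lambda>p. f p - sol \<alpha> u p)" "loc_bdd (\<lambda>p. pd_t f p - sol_t \<alpha> u p)" "loc_bdd (\<lambda>p. pd_x f p - sol_x \<alpha> u p)"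
      by (intro loc_bdd_diff lbf sol_loc_bdd \<alpha> u)+
  next
    fix t x :: real assume "0 < t" "x \<noteq> 0"
    show "((\<lambda>t. f (t, x) - sol \<alpha> u (t, x)) has_real_derivative pd_t f (t, x) - sol_t \<alpha> u (t, x)) (at t)"
      "((\<lambda>x. f (t, x) - sol \<alpha> u (t, x)) has_real_derivative pd_x f (t, x) - sol_x \<alpha> u (t, x)) (at x)"
      using test_function_partials(1)[OF f, of x t] test_function_partials(2)[OF f, of t x]
      by (auto intro!: DERIV_diff sol_partials \<alpha> u \<open>0 < t\<close> \<open>x \<noteq> 0\<close> simp: has_real_derivative_iff_has_vector_derivative[symmetric])
  next
    fix d :: real assume d: "0 < d"
    obtain M where M: "\<And>p. p \<in> halfplane \<Longrightarrow> M \<le> norm p \<Longrightarrow> \<bar>sol \<alpha> u p\<bar> < d"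
      by (rule sol_vanishes_at_infinity[OF \<alpha> u d]) blast
    obtain M' where M': "\<And>p. M' \<le> norm p \<Longrightarrow> f p = 0" by (rule test_function_UNIV_bounded_support[OF f]) blast
    show "\<exists>R\<ge>1. \<forall>p\<in>halfplane. d \<le> \<bar>f p - sol \<alpha> u p\<bar> \<longrightarrow> p \<in> rect R"
    proof (rule vanishing_outside_rect[OF _ _ _ d])
      show "continuous_on halfplane (\<lambda>p. f p - sol \<alpha> u p)"
        by (intro continuous_intros sol_continuous \<alpha> u continuous_on_subset[OF c]) simp
      show "((\<lambda>p. f p - sol \<alpha> u p) \<longlongrightarrow> 0) (at (0, x) within halfplane)" for x
      proof -
        have "(f \<longlongrightarrow> f (0, x)) (at (0, x) within halfplane)"
          using c by (metis UNIV_I continuous_on_def tendsto_within_subset subset_UNIV)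
        from tendsto_diff[OF this sol_tendsto_boundary[OF \<alpha> u]] show ?thesis by (simp add: tr)
      qed
      show "\<bar>f p - sol \<alpha> u p\<bar> < d" if "p \<in> halfplane" "max M M' \<le> norm p" for p
        using M[OF that(1)] M'[of p] that(2) by simp
    qed
  next
    show "smooth_on halfplane (ws n)" for n by (rule ap(1))
  next
    fix R :: real assume R: "1 \<le> R"
    obtain A1 where A1: "\<And>p. p \<in> rect R \<Longrightarrow> \<bar>f p\<bar> \<le> A1" by (rule loc_bddE[OF lbf(1) R]) blast
    obtain A2 where A2: "\<And>p. p \<in> rect R \<Longrightarrow> \<bar>pd_t f p\<bar> \<le> A2" by (rule loc_bddE[OF lbf(2) R]) blast
    obtain A3 where A3: "\<And>p. p \<in> rect R \<Longrightarrow> \<bar>pd_x f p\<bar> \<le> A3" by (rule loc_bddE[OF lbf(3) R]) blast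
    obtain C1 where C1: "0 \<le> C1" "\<And>a b. \<bar>a\<bar> \<le> R \<Longrightarrow> 1 / R \<le> b \<Longrightarrow> b \<le> R \<Longrightarrow> cmod (E (Complex a b)) \<le> C1"
      by (rule holomorphic_bounded_rect[OF hE(1) R]) blast
    obtain C2 where C2: "0 \<le> C2" "\<And>a b. \<bar>a\<bar> \<le> R \<Longrightarrow> 1 / R \<le> b \<Longrightarrow> b \<le> R \<Longrightarrow> cmod (deriv E (Complex a b)) \<le> C2"
      by (rule holomorphic_bounded_rect[OF hE(2) R]) blast
    obtain C3 where C3: "0 \<le> C3" "\<And>a b. \<bar>a\<bar> \<le> R \<Longrightarrow> 1 / R \<le> b \<Longrightarrow> b \<le> R \<Longrightarrow> cmod (Q (Complex a b)) \<le> C3"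
      by (rule holomorphic_bounded_rect[OF hQ(1) R]) blast
    obtain C4 where C4: "0 \<le> C4" "\<And>a b. \<bar>a\<bar> \<le> R \<Longrightarrow> 1 / R \<le> b \<Longrightarrow> b \<le> R \<Longrightarrow> cmod (deriv Q (Complex a b)) \<le> C4"
      by (rule holomorphic_bounded_rect[OF hQ(2) R]) blast
    define D1 where "D1 = A1 + inverse pi * (C1 + C3)"
    define D2 where "D2 = A2 + inverse pi * (C2 + C4)"
    define D3 where "D3 = A3 + inverse pi * (2 * C2 + C4)"
    have b: "\<bar>x - inverse pi * (y + z)\<bar> \<le> X + inverse pi * (Y + Z)" if "\<bar>x\<bar> \<le> X" "\<bar>y\<bar> \<le> Y" "\<bar>z\<bar> \<le> Z" for x y z X Y Z
    proof -
      have "\<bar>inverse pi * (y + z)\<bar> \<le> inverse pi * (Y + Z)"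
        unfolding abs_mult using that by (intro mult_mono) auto
      then show ?thesis using that(1) abs_triangle_ineq4[of x "inverse pi * (y + z)"] by linarith
    qed
    have "\<bar>ws n p\<bar> \<le> D1 \<and> \<bar>pd_t (ws n) p\<bar> \<le> D2 \<and> \<bar>pd_x (ws n) p\<bar> \<le> D3" if p: "p \<in> rect R" for n p
    proof -
      have q: "\<bar>snd p\<bar> \<le> R" "1 / R \<le> fst p" "fst p \<le> R" using p by (auto simp: rect_def)
      have q0: "0 < fst p" using p rect_subset_halfplane[of R] R by auto
      have sa: "\<bar>sabs n (snd p)\<bar> \<le> R" using sabs_bounds[of n "snd p"] q(1) by linarith
      note im = order_trans[OF abs_Im_le_cmod] and re = order_trans[OF abs_Re_le_cmod]
      have "\<bar>dsabs n (snd p) * Im (deriv E (Complex (sabs n (snd p)) (fst p)))\<bar> \<le> 2 * C2"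
        unfolding abs_mult by (intro mult_mono sabs_bounds im C2 sa q) auto
      then show ?thesis
        unfolding ap(2,3)[OF q0] unfolding ws_def D1_def D2_def D3_def
        by (intro conjI b im[OF C1(2)] re[OF C2(2)] im[OF C3(2)] re[OF C4(2)] im[OF C4(2)] A1 A2 A3 p sa q)
    qed
    then show "\<exists>C. \<forall>n. \<forall>p\<in>rect R. \<bar>ws n p\<bar> \<le> C \<and> \<bar>pd_t (ws n) p\<bar> \<le> C \<and> \<bar>pd_x (ws n) p\<bar> \<le> C"
      by (intro exI[of _ "max D1 (max D2 D3)"]) (auto simp: le_max_iff_disj)
  next
    fix p :: "real \<times> real" assume p: "p \<in> halfplane" "snd p \<noteq> 0"
    then have t: "0 < fst p" by simp
    have Z: "(\<lambda>n. Complex (sabs n (snd p)) (fst p)) \<longlonglongrightarrow> Complex \<bar>snd p\<bar> (fst p)"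
      by (intro tendsto_Complex sabs_tendsto p tendsto_const)
    have ct: "isCont F (Complex \<bar>snd p\<bar> (fst p))" if "F holomorphic_on upper_halfplane" for F
      using holomorphic_on_imp_continuous_on[OF that] open_upper_halfplane t
      by (simp add: continuous_on_eq_continuous_at)
    note T = isCont_tendsto_compose[OF ct Z]
    note sx = sol_def[of \<alpha> u p] sol_t_def[of \<alpha> u p] sol_x_def[of \<alpha> u p]
    have "(\<lambda>n. ws n p) \<longlonglongrightarrow> f p - inverse pi * (Im (E (Complex \<bar>snd p\<bar> (fst p))) + Im (Q (Complex (snd p) (fst p))))"
      unfolding ws_def by (intro tendsto_intros T hE)
    then show "(\<lambda>n. ws n p) \<longlonglongrightarrow> f p - sol \<alpha> u p"
      by (simp add: sx E_def Q_def divide_inverse mult.commute)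
    have "(\<lambda>n. pd_t (ws n) p) \<longlonglongrightarrow> pd_t f p - inverse pi * (Re (deriv E (Complex \<bar>snd p\<bar> (fst p))) + Re (deriv Q (Complex (snd p) (fst p))))"
      unfolding ap(2)[OF t] by (intro tendsto_intros T hE)
    then show "(\<lambda>n. pd_t (ws n) p) \<longlonglongrightarrow> pd_t f p - sol_t \<alpha> u p"
      by (simp add: sx E_def Q_def divide_inverse mult.commute)
    have "(\<lambda>n. pd_x (ws n) p) \<longlonglongrightarrow> pd_x f p - inverse pi * (sgn (snd p) * Im (deriv E (Complex \<bar>snd p\<bar> (fst p))) + Im (deriv Q (Complex (snd p) (fst p))))"
      unfolding ap(3)[OF t] by (intro tendsto_intros T hE sabs_tendsto p)
    then show "(\<lambda>n. pd_x (ws n) p) \<longlonglongrightarrow> pd_x f p - sol_x \<alpha> u p"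
      by (simp add: sx E_def Q_def divide_inverse mult.commute)
  qed
qed

section \<open>Existence, linearity, uniqueness and the kernel formula\<close>

lemma test_function_bounded_linear:
  assumes "test_function \<Omega> f" "bounded_linear L"
  shows "test_function \<Omega> (\<lambda>p. L (f p))"
proof -
  obtain K where K: "smooth_on UNIV f" "compact K" "K \<subseteq> \<Omega>" "\<And>p. p \<notin> K \<Longrightarrow> f p = 0"
    by (rule test_functionE[OF assms(1)]) blast
  have "smooth_on UNIV (\<lambda>p. L (f p))"
    by (rule smooth_on_bounded_linear[OF assms(2) open_UNIV K(1)])
  then have "test_function UNIV (\<lambda>p. L (f p))"
    by (rule test_functionI[OF _ open_UNIV K(2)]) (use K(4) linear_0[OF bounded_linear.linear[OF assms(2)]] in auto)
  moreover have "closure {p. L (f p) \<noteq> 0} \<subseteq> K"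
    by (rule closure_minimal[OF _ compact_imp_closed[OF K(2)]])
      (use K(4) linear_0[OF bounded_linear.linear[OF assms(2)]] in force)
  ultimately show ?thesis using K(3) by (auto simp: test_function_def)
qed

lemma grad_of_real_test_function:
  assumes "test_function \<Omega> f"
  shows "grad (\<lambda>p. complex_of_real (f p)) = rgrad (pd_t f) (pd_x f)"
proof
  fix p
  show "grad (\<lambda>p. complex_of_real (f p)) p = rgrad (pd_t f) (pd_x f) p"
    using grad_of_real[OF test_function_has_derivative[OF assms, of p]] by (simp add: rgrad_def)
qed

lemma rgrad_pd_square_integrable:
  assumes "test_function \<Omega> f"
  shows "square_integrable (rgrad (pd_t f) (pd_x f))"
  using grad_square_integrable[OF test_function_bounded_linear[OF assms bounded_linear_of_real]]
  by (simp only: grad_of_real_test_function[OF assms])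

text \<open>The roles are U1 = f, an extension of the datum, and U2 = f - sol. Once the energy bound
  is available, the weak equation for the solution extends from test functions to the whole
  completion, and linearity turns it into the variational equation for U2.\<close>

lemma sol_Dirichlet:
  assumes \<alpha>: "-1 < \<alpha>" "\<alpha> < 1" "k = tan (pi * \<alpha> / 2)" and u: "test_function UNIV u"
  shows "Hdot1_Dirichlet_solution k (\<lambda>x. complex_of_real (u x)) (\<lambda>p. complex_of_real (sol \<alpha> u p))"
proof -
  obtain f :: "real \<times> real \<Rightarrow> real" where f: "test_function UNIV f" "\<And>x. f (0, x) = u x"
    by (rule test_function_extension[OF u]) blast
  have d: "datum u" by (rule test_function_datum[OF u])
  define g1 g2 where "g1 p = pd_t f p - sol_t \<alpha> u p" and "g2 p = pd_x f p - sol_x \<alpha> u p" for p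
  have adm: "admissible (\<lambda>p. f p - sol \<alpha> u p) g1 g2"
    unfolding g1_def g2_def by (rule sol_admissible[OF \<alpha>(1,2) d f])
  have s: "rgrad (\<lambda>p. pd_t f p - g1 p) (\<lambda>p. pd_x f p - g2 p) = rgrad (sol_t \<alpha> u) (sol_x \<alpha> u)"
    by (simp add: g1_def g2_def)
  have sqf: "square_integrable (rgrad (pd_t f) (pd_x f))" by (rule rgrad_pd_square_integrable[OF f(1)])
  have sqg: "square_integrable (rgrad g1 g2)"
    by (rule admissible_energy[OF adm test_function_loc_bdd(2,3)[OF f(1)] sqf])
      (unfold s, rule sol_weak[OF \<alpha> d])
  have eq: "rgrad (sol_t \<alpha> u) (sol_x \<alpha> u) = (\<lambda>p. rgrad (pd_t f) (pd_x f) p + (- 1) *s rgrad g1 g2 p)"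
    by (rule ext) (simp add: vec2_eq_iff g1_def g2_def)
  have sqs: "square_integrable (rgrad (sol_t \<alpha> u) (sol_x \<alpha> u))"
    unfolding eq by (intro square_integrable_add square_integrable_smult sqf sqg)
  show ?thesis
    unfolding Hdot1_Dirichlet_solution_def
  proof (intro exI conjI allI impI)
    show "test_function UNIV (\<lambda>p. complex_of_real (f p))"
      by (rule test_function_bounded_linear[OF f(1) bounded_linear_of_real])
    show "complex_of_real (f (0, x)) = complex_of_real (u x)" for x by (simp add: f(2))
    show "Hdot10 (\<lambda>p. complex_of_real (f p - sol \<alpha> u p)) (rgrad g1 g2)"
      by (rule admissible_Hdot10[OF adm sqg])
    show "A_form k (rgrad g1 g2) H = A_form k (grad (\<lambda>p. complex_of_real (f p))) H" if "Hdot10 \<psi> H" for \<psi> H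
    proof -
      have sqH: "square_integrable H" by (rule Hdot10D[OF that])
      have "A_form k (rgrad (sol_t \<alpha> u) (sol_x \<alpha> u)) H = 0"
        by (rule A_form_Hdot10_eq[OF sqs _ that]) (rule sol_weak[OF \<alpha> d])
      then have "A_form k (rgrad (pd_t f) (pd_x f)) H + (- 1) * A_form k (rgrad g1 g2) H = 0"
        unfolding eq by (subst (asm) A_form_add_left[OF sqf sqg sqH])
      then show ?thesis by (simp add: grad_of_real_test_function[OF f(1)])
    qed
    show "\<forall>p\<in>halfplane. complex_of_real (sol \<alpha> u p) = complex_of_real (f p) - complex_of_real (f p - sol \<alpha> u p)"
      by simp
  qed
qed

lemma Hdot10_square_integrable: "Hdot10 V G \<Longrightarrow> square_integrable G"
  by (erule Hdot10D)

lemma Dirichlet_solution_lincomb: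
  assumes "Hdot1_Dirichlet_solution k u U" "Hdot1_Dirichlet_solution k v V"
  shows "Hdot1_Dirichlet_solution k (\<lambda>x. u x + c * v x) (\<lambda>p. U p + c * V p)"
proof -
  obtain U1 U2 G2 where U: "test_function UNIV U1" "\<And>x. U1 (0, x) = u x" "Hdot10 U2 G2"
    "\<And>\<psi> H. Hdot10 \<psi> H \<Longrightarrow> A_form k G2 H = A_form k (grad U1) H" "\<And>p. p \<in> halfplane \<Longrightarrow> U p = U1 p - U2 p"
    using assms(1) unfolding Hdot1_Dirichlet_solution_def by blast
  obtain V1 V2 F2 where V: "test_function UNIV V1" "\<And>x. V1 (0, x) = v x" "Hdot10 V2 F2"
    "\<And>\<psi> H. Hdot10 \<psi> H \<Longrightarrow> A_form k F2 H = A_form k (grad V1) H" "\<And>p. p \<in> halfplane \<Longrightarrow> V p = V1 p - V2 p"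
    using assms(2) unfolding Hdot1_Dirichlet_solution_def by blast
  show ?thesis
    unfolding Hdot1_Dirichlet_solution_def
  proof (intro exI conjI allI impI ballI)
    show "test_function UNIV (\<lambda>p. U1 p + c * V1 p)" by (rule test_function_lincomb(1)[OF U(1) V(1)])
    show "U1 (0, x) + c * V1 (0, x) = u x + c * v x" for x by (simp add: U V)
    show "Hdot10 (\<lambda>p. U2 p + c * V2 p) (\<lambda>p. G2 p + c *s F2 p)" by (rule Hdot10_lincomb[OF U(3) V(3)])
    show "A_form k (\<lambda>p. G2 p + c *s F2 p) H = A_form k (grad (\<lambda>p. U1 p + c * V1 p)) H" if "Hdot10 \<psi> H" for \<psi> H
      unfolding test_function_lincomb(2)[OF U(1) V(1)]
      using A_form_add_left[OF Hdot10_square_integrable[OF U(3)] Hdot10_square_integrable[OF V(3)] Hdot10_square_integrable[OF that]]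
        A_form_add_left[OF grad_square_integrable[OF U(1)] grad_square_integrable[OF V(1)] Hdot10_square_integrable[OF that]]
        U(4)[OF that] V(4)[OF that] by simp
    show "U p + c * V p = (U1 p + c * V1 p) - (U2 p + c * V2 p)" if "p \<in> halfplane" for p
      unfolding U(5)[OF that] V(5)[OF that] by (simp add: algebra_simps)
  qed
qed

lemma zero_trace_Hdot10:
  fixes f :: "real \<times> real \<Rightarrow> complex"
  assumes f: "test_function UNIV f" and z: "\<And>x. f (0, x) = 0"
  shows "Hdot10 f (grad f)"
proof -
  have t: "test_function UNIV (\<lambda>p. Re (f p))" "test_function UNIV (\<lambda>p. Im (f p))"
    by (rule test_function_bounded_linear[OF f bounded_linear_Re], rule test_function_bounded_linear[OF f bounded_linear_Im])
  have *: "Hdot10 (\<lambda>p. complex_of_real (g p)) (grad (\<lambda>p. complex_of_real (g p)))"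
    if "test_function UNIV g" "\<And>x. g (0, x) = 0" for g
    unfolding grad_of_real_test_function[OF that(1)]
    by (rule admissible_Hdot10[OF zero_trace_admissible[OF that] rgrad_pd_square_integrable[OF that(1)]])
  have tc: "test_function UNIV (\<lambda>p. complex_of_real (Re (f p)))" "test_function UNIV (\<lambda>p. complex_of_real (Im (f p)))"
    by (rule test_function_bounded_linear[OF t(1) bounded_linear_of_real], rule test_function_bounded_linear[OF t(2) bounded_linear_of_real])
  have eq: "f = (\<lambda>p. complex_of_real (Re (f p)) + \<i> * complex_of_real (Im (f p)))"
    by (rule ext) (simp add: complex_eq)
  have "Hdot10 (\<lambda>p. complex_of_real (Re (f p)) + \<i> * complex_of_real (Im (f p)))
      (\<lambda>p. grad (\<lambda>p. complex_of_real (Re (f p))) p + \<i> *s grad (\<lambda>p. complex_of_real (Im (f p))) p)"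
    by (intro Hdot10_lincomb * t) (simp_all add: z)
  then have "Hdot10 (\<lambda>p. complex_of_real (Re (f p)) + \<i> * complex_of_real (Im (f p)))
      (grad (\<lambda>p. complex_of_real (Re (f p)) + \<i> * complex_of_real (Im (f p))))"
    by (simp only: test_function_lincomb(2)[OF tc])
  then show ?thesis unfolding eq[symmetric] .
qed

text \<open>The two solutions may come from different extensions, so U2 - V2 alone need not have
  zero energy. Subtracting U1 - V1, which has zero trace and hence lies in the completion, gives an
  element W whose gradient is annihilated by the form against itself. Coercivity makes this gradient
  0, and Hardy's inequality makes W vanish. The conclusion is almost everywhere because
  \<open>Hdot10\<close> describes classes of functions.\<close>

lemma Dirichlet_solution_unique:
  assumes "Hdot1_Dirichlet_solution k u U" "Hdot1_Dirichlet_solution k u V"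
  shows "AE p in lebH. U p = V p"
proof -
  obtain U1 U2 G2 where U: "test_function UNIV U1" "\<And>x. U1 (0, x) = u x" "Hdot10 U2 G2"
    "\<And>\<psi> H. Hdot10 \<psi> H \<Longrightarrow> A_form k G2 H = A_form k (grad U1) H" "\<And>p. p \<in> halfplane \<Longrightarrow> U p = U1 p - U2 p"
    using assms(1) unfolding Hdot1_Dirichlet_solution_def by blast
  obtain V1 V2 F2 where V: "test_function UNIV V1" "\<And>x. V1 (0, x) = u x" "Hdot10 V2 F2"
    "\<And>\<psi> H. Hdot10 \<psi> H \<Longrightarrow> A_form k F2 H = A_form k (grad V1) H" "\<And>p. p \<in> halfplane \<Longrightarrow> V p = V1 p - V2 p"
    using assms(2) unfolding Hdot1_Dirichlet_solution_def by blast
  note sq = Hdot10_square_integrable[OF U(3)] Hdot10_square_integrable[OF V(3)]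
    grad_square_integrable[OF U(1)] grad_square_integrable[OF V(1)]
  have tW: "test_function UNIV (\<lambda>p. U1 p + (- 1) * V1 p)" by (rule test_function_lincomb(1)[OF U(1) V(1)])
  have gW: "grad (\<lambda>p. U1 p + (- 1) * V1 p) = (\<lambda>p. grad U1 p + (- 1) *s grad V1 p)"
    by (rule test_function_lincomb(2)[OF U(1) V(1)])
  have "Hdot10 (\<lambda>p. U1 p + (- 1) * V1 p) (\<lambda>p. grad U1 p + (- 1) *s grad V1 p)"
    using zero_trace_Hdot10[OF tW] U(2) V(2) unfolding gW by simp
  define W where "W p = (U2 p + (- 1) * V2 p) + (- 1) * (U1 p + (- 1) * V1 p)" for p
  define G where "G p = (G2 p + (- 1) *s F2 p) + (- 1) *s (grad U1 p + (- 1) *s grad V1 p)" for p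
  have H: "Hdot10 W G" unfolding W_def G_def
    by (rule Hdot10_lincomb[OF Hdot10_lincomb[OF U(3) V(3)]]) fact
  note sqG = Hdot10_square_integrable[OF H]
  have "A_form k G G = 0"
  proof -
    have "A_form k G G = (A_form k G2 G + (- 1) * A_form k F2 G) + (- 1) * (A_form k (grad U1) G + (- 1) * A_form k (grad V1) G)"
      unfolding G_def[abs_def]
      by (subst A_form_add_left, (intro square_integrable_add square_integrable_smult sq)+)+
        (unfold G_def[abs_def, symmetric], simp add: A_form_add_left[OF sq(3,4) sqG] A_form_add_left[OF sq(1,2) sqG])
    then show ?thesis using U(4)[OF H] V(4)[OF H] by simp
  qed
  moreover have "Re (A_form k G G) = (\<integral>p. (norm (G p))\<^sup>2 \<partial>lebH)"
    unfolding A_form_def using integral_Re[OF hermitian_A_integrable[OF sqG sqG, of k]]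
    by (simp add: Re_hermitian_A_coeff_self)
  ultimately have "(\<integral>p. (norm (G p))\<^sup>2 \<partial>lebH) = 0" by simp
  then have "AE p in lebH. (norm (G p))\<^sup>2 = 0"
    using sqG by (subst (asm) integral_nonneg_eq_0_iff_AE) (auto simp: square_integrable_def)
  then have "AE p in lebH. G p = 0" by eventually_elim simp
  from Hdot10_gradient_zero[OF H this]
  have "AE p in lebH. W p = 0" .
  moreover have "AE p in lebH. p \<in> halfplane" by (rule AE_I2) simp
  ultimately show ?thesis
  proof eventually_elim
    case (elim p)
    show ?case
      using elim(1) unfolding U(5)[OF elim(2)] V(5)[OF elim(2)] W_def by algebra
  qed
qed

text \<open>For z = x + i t, and equally with \<open>\<bar>x\<bar>\<close> in place of x, the
  squared modulus of y^2 - z^2 = (y - z)(y + z) is the product in the denominator of the kernel.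
  Rationalising both fractions therefore gives the same denominator.\<close>

lemma kernel_eq:
  assumes t: "0 < t"
  shows "kernel \<alpha> t x y = Im (complex_of_real (\<bar>y\<bar> powr (- \<alpha>)) * (Complex \<bar>x\<bar> t powr complex_of_real (\<alpha> + 1)
      / (complex_of_real (y\<^sup>2) - (Complex \<bar>x\<bar> t)\<^sup>2))) + Im (complex_of_real y / (complex_of_real (y\<^sup>2) - (Complex x t)\<^sup>2))"
proof -
  define P where "P = Complex \<bar>x\<bar> t powr complex_of_real (\<alpha> + 1)"
  define D where "D = (t\<^sup>2 + (x - y)\<^sup>2) * (t\<^sup>2 + (x + y)\<^sup>2)"
  have D: "(y\<^sup>2 - x\<^sup>2 + t\<^sup>2)\<^sup>2 + (2 * x * t)\<^sup>2 = D" "(y\<^sup>2 - x\<^sup>2 + t\<^sup>2)\<^sup>2 + (2 * \<bar>x\<bar> * t)\<^sup>2 = D"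
    by (simp_all add: D_def power2_eq_square algebra_simps)
  have sq: "(Complex a b)\<^sup>2 = Complex (a\<^sup>2 - b\<^sup>2) (2 * a * b)" for a b
    by (simp add: complex_eq_iff power2_eq_square)
  have q: "Re (complex_of_real (y\<^sup>2) - (Complex a b)\<^sup>2) = y\<^sup>2 - a\<^sup>2 + b\<^sup>2" "Im (complex_of_real (y\<^sup>2) - (Complex a b)\<^sup>2) = - (2 * a * b)" for a b
    unfolding sq minus_complex.sel by simp_all
  have 1: "Im (P / (complex_of_real (y\<^sup>2) - (Complex \<bar>x\<bar> t)\<^sup>2)) = (Im P * (y\<^sup>2 - x\<^sup>2 + t\<^sup>2) + Re P * (2 * \<bar>x\<bar> * t)) / D"
    unfolding Im_divide q using D(2) by simp
  have 2: "Im (complex_of_real y / (complex_of_real (y\<^sup>2) - (Complex x t)\<^sup>2)) = (2 * x * t * y) / D"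
    unfolding Im_divide q using D(1) by (simp add: mult_ac)
  have 3: "Im (P * (complex_of_real (y\<^sup>2) - (Complex \<bar>x\<bar> (- t))\<^sup>2)) = Im P * (y\<^sup>2 - x\<^sup>2 + t\<^sup>2) + Re P * (2 * \<bar>x\<bar> * t)"
    unfolding times_complex.sel q by simp
  show ?thesis
    unfolding kernel_def P_def[symmetric] D_def[symmetric] 3 2 Im_of_real_mult 1
    by (simp add: add_divide_distrib distrib_left)
qed

lemma kernel_integral:
  assumes \<alpha>: "-1 < \<alpha>" "\<alpha> < 1" and u: "datum u" and t: "0 < t"
  shows "has_bochner_integral lborel (\<lambda>y. kernel \<alpha> t x y * u y) (pi * sol \<alpha> u (t, x))"
proof -
  define P where "P = Complex \<bar>x\<bar> t powr complex_of_real (\<alpha> + 1)"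
  have z: "(Complex \<bar>x\<bar> t)\<^sup>2 \<notin> \<real>\<^sub>\<ge>\<^sub>0" "(Complex x t)\<^sup>2 \<notin> \<real>\<^sub>\<ge>\<^sub>0"
    using square_notin_nonneg_Reals[of "Complex _ t"] t by auto
  obtain d where d: "0 < d" "\<And>y::real. d \<le> cmod (complex_of_real (y\<^sup>2) - (Complex \<bar>x\<bar> t)\<^sup>2)"
    by (rule nonneg_real_distance[OF z(1)]) blast
  obtain d' where d': "0 < d'" "\<And>y::real. d' \<le> cmod (complex_of_real (y\<^sup>2) - (Complex x t)\<^sup>2)"
    by (rule nonneg_real_distance[OF z(2)]) blast
  let ?w = "\<lambda>y. \<bar>y\<bar> powr (- \<alpha>) * u y"
  have i1: "integrable lborel (\<lambda>y. P * (complex_of_real (?w y) / (complex_of_real (y\<^sup>2) - (Complex \<bar>x\<bar> t)\<^sup>2)))"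
    by (intro integrable_mult_right cauchy_int_integrable[OF datum_measurable(3)[OF u] weight_times_datum_integrable(2)[OF \<alpha> u] d])
  have i2: "integrable lborel (\<lambda>y. complex_of_real (y * u y) / (complex_of_real (y\<^sup>2) - (Complex x t)\<^sup>2))"
    by (rule cauchy_int_integrable[OF datum_measurable(2)[OF u] mult_datum_integrable(2)[OF u] d'])
  have e1: "(\<integral>y. P * (complex_of_real (?w y) / (complex_of_real (y\<^sup>2) - (Complex \<bar>x\<bar> t)\<^sup>2)) \<partial>lborel) = even_part \<alpha> u (Complex \<bar>x\<bar> t)"
    by (simp only: integral_mult_right_zero even_part_def cauchy_int_def P_def)
  have e2: "(\<integral>y. complex_of_real (y * u y) / (complex_of_real (y\<^sup>2) - (Complex x t)\<^sup>2) \<partial>lborel) = odd_part u (Complex x t)"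
    by (simp only: odd_part_def cauchy_int_def)
  have k: "kernel \<alpha> t x y * u y = Im (P * (complex_of_real (?w y) / (complex_of_real (y\<^sup>2) - (Complex \<bar>x\<bar> t)\<^sup>2)))
      + Im (complex_of_real (y * u y) / (complex_of_real (y\<^sup>2) - (Complex x t)\<^sup>2))" for y
  proof -
    define q1 q2 where "q1 = complex_of_real (y\<^sup>2) - (Complex \<bar>x\<bar> t)\<^sup>2" and "q2 = complex_of_real (y\<^sup>2) - (Complex x t)\<^sup>2"
    have "P * (complex_of_real (?w y) / q1) = complex_of_real (u y) * (complex_of_real (\<bar>y\<bar> powr (- \<alpha>)) * (P / q1))"
      "complex_of_real (y * u y) / q2 = complex_of_real (u y) * (complex_of_real y / q2)" by simp_all
    then show ?thesis
      unfolding kernel_eq[OF t] P_def[symmetric] q1_def[symmetric] q2_def[symmetric]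
      by (simp only: Im_of_real_mult distrib_left distrib_right mult.commute[of _ "u y"])
  qed
  have b: "has_bochner_integral lborel (\<lambda>y. Im (f y)) (Im (\<integral>y. f y \<partial>lborel))"
    if "integrable lborel f" for f :: "real \<Rightarrow> complex"
    using that by (simp add: has_bochner_integral_iff)
  have "has_bochner_integral lborel (\<lambda>y. kernel \<alpha> t x y * u y)
      (Im (even_part \<alpha> u (Complex \<bar>x\<bar> t)) + Im (odd_part u (Complex x t)))"
    unfolding k e1[symmetric] e2[symmetric]
    by (intro has_bochner_integral_add b i1 i2)
  then show ?thesis by (simp add: sol_def)
qed

theorem mainTheorem3:
  fixes \<alpha> k :: real and u :: "real \<Rightarrow> complex"
  assumes "-1 < \<alpha>" and "\<alpha> < 1"
    and "k = tan (pi * \<alpha> / 2)"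
    and "test_function UNIV u"
  shows "(\<forall>t x. 0 < t \<longrightarrow> integrable lborel (\<lambda>y. complex_of_real (kernel \<alpha> t x y) * u y)) \<and>
         continuous_on halfplane (U_formula \<alpha> u) \<and>
         Hdot1_Dirichlet_solution k u (U_formula \<alpha> u) \<and>
         (\<forall>U. Hdot1_Dirichlet_solution k u U \<longrightarrow>
            (AE p in lebesgue_on halfplane. U p = U_formula \<alpha> u p))"
proof -
  define a b where "a y = Re (u y)" and "b y = Im (u y)" for y
  have t: "test_function UNIV a" "test_function UNIV b"
    unfolding a_def b_def
    by (rule test_function_bounded_linear[OF assms(4) bounded_linear_Re], rule test_function_bounded_linear[OF assms(4) bounded_linear_Im])
  note d = test_function_datum[OF t(1)] test_function_datum[OF t(2)]
  have u: "u y = complex_of_real (a y) + \<i> * complex_of_real (b y)" for y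
    by (simp add: a_def b_def complex_eq)
  have ku: "complex_of_real (kernel \<alpha> t x y) * u y
      = complex_of_real (kernel \<alpha> t x y * a y) + \<i> * complex_of_real (kernel \<alpha> t x y * b y)" for t x y
    by (simp add: u algebra_simps)
  have K: "has_bochner_integral lborel (\<lambda>y. complex_of_real (kernel \<alpha> t x y) * u y)
      (complex_of_real (pi * sol \<alpha> a (t, x)) + \<i> * complex_of_real (pi * sol \<alpha> b (t, x)))" if "0 < t" for t x
    unfolding ku
    by (intro has_bochner_integral_add has_bochner_integral_mult_right has_bochner_integral_of_real
        kernel_integral assms d that)
  have U: "U_formula \<alpha> u p = complex_of_real (sol \<alpha> a p) + \<i> * complex_of_real (sol \<alpha> b p)" if "p \<in> halfplane" for p
    using K[of "fst p" "snd p"] that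
    by (simp add: U_formula_def case_prod_unfold has_bochner_integral_iff field_simps)
  have 1: "Hdot1_Dirichlet_solution k (\<lambda>x. complex_of_real (a x) + \<i> * complex_of_real (b x))
      (\<lambda>p. complex_of_real (sol \<alpha> a p) + \<i> * complex_of_real (sol \<alpha> b p))"
    by (intro Dirichlet_solution_lincomb sol_Dirichlet assms t)
  have sol: "Hdot1_Dirichlet_solution k u (U_formula \<alpha> u)"
    using 1 unfolding u[symmetric] Hdot1_Dirichlet_solution_def by (simp add: U)
  have "continuous_on halfplane (\<lambda>p. complex_of_real (sol \<alpha> a p) + \<i> * complex_of_real (sol \<alpha> b p))"
    by (intro continuous_intros sol_continuous assms d)
  then have "continuous_on halfplane (U_formula \<alpha> u)"
    by (rule continuous_on_eq) (simp add: U)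
  then show ?thesis
    using K sol Dirichlet_solution_unique[OF _ sol] by (auto simp: has_bochner_integral_iff)
qed

end
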